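(* Let $d=2$, let $\mu$ be a probability measure on $\mathcal{P}$, and let $(X_n)_{n\ge 0}$ be the random walk in i.i.d. random environment determined by $\mu$, with annealed law $P$. For every $\ell\in\mathbb{R}^2\setminus\{o\}$, the event $A_\ell=\{X_n\cdot\ell\to+\infty \text{ as } n\to\infty\}$ satisfies $P(A_\ell)\in\{0,1\}$.
   Context: $\mathcal{E}=\{\pm e_i: i=1,\dots,d\}$ is the set of unit vectors in $\mathbb{Z}^d$ and $o$ is the origin. $\mathcal{P}$ is the set of probability measures on $\mathcal{E}$, and $\mu$ is a probability measure on $\mathcal{P}$. $\Omega=\mathcal{P}^{\mathbb{Z}^d}$ carries the product measure $\nu=\mu^{\otimes\mathbb{Z}^d}$; an environment is $\omega=(\omega_x)_{x\in\mathbb{Z}^d}\in\Omega$ (so the $\omega_x$ are i.i.d. with law $\mu$ under $\nu$), and $\omega_x(e)$ means $\omega_x(\{e\})$. Given $\omega$, $\mathbb{P}_\omega$ is the law of the time-homogeneous Markov chain $(X_n)_{n\ge0}$ on $\mathbb{Z}^d$ with $X_0=o$ and transition probability $\omega_x(e)$ from $x$ to $x+e$, $e\in\mathcal{E}$. The annealed law is $P(\cdot)=\int \mathbb{P}_\omega(\cdot)\,d\nu(\omega)$. No ellipticity is assumed: $\omega_x(e)$ may vanish. *)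

theory Defs
  imports "HOL-Probability.Probability"
begin

definition unit_vectors :: "(int ^ 'd) set" where
  "unit_vectors = {e. \<exists>i. e = axis i 1 \<or> e = - axis i 1}"

text \<open>The space of probability measures on the unit vectors. Its \<open>\<sigma>\<close>-algebra is generated by the
  evaluations \<open>p \<mapsto> p A\<close>, so it is the Borel \<open>\<sigma>\<close>-algebra of the simplex.\<close>

definition step_laws :: "(int ^ 'd) measure measure" where
  "step_laws = prob_algebra (count_space unit_vectors)"

definition env_law :: "(int ^ 'd) measure measure \<Rightarrow> (int ^ 'd \<Rightarrow> (int ^ 'd) measure) measure" where
  "env_law \<mu> = (\<Pi>\<^sub>M x\<in>UNIV. \<mu>)"

definition path_space :: "(nat \<Rightarrow> int ^ 'd) measure" where
  "path_space = (\<Pi>\<^sub>M n\<in>UNIV. count_space UNIV)"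

text \<open>The conditional law of \<open>X n\<close> given \<open>X 0, \<dots>, X (n - 1)\<close> in the environment \<open>\<omega>\<close>.\<close>

definition walk_kernel ::
    "(int ^ 'd \<Rightarrow> (int ^ 'd) measure) \<Rightarrow> nat \<Rightarrow> (nat \<Rightarrow> int ^ 'd) \<Rightarrow> (int ^ 'd) measure" where
  "walk_kernel \<omega> n X =
     (if n = 0 then return (count_space UNIV) 0
      else distr (\<omega> (X (n - 1))) (count_space UNIV) (\<lambda>e. X (n - 1) + e))"

text \<open>The law on path space with these conditional laws, given by the Ionescu-Tulcea theorem; its
  finite-dimensional distributions are computed in \<open>quenched_law_cylinder\<close> below.\<close>

definition quenched_law ::
    "(int ^ 'd \<Rightarrow> (int ^ 'd) measure) \<Rightarrow> (nat \<Rightarrow> int ^ 'd) measure" where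
  "quenched_law \<omega> =
     projective_family.lim UNIV (Ionescu_Tulcea.CI (walk_kernel \<omega>) (\<lambda>_. count_space UNIV))
       (\<lambda>_. count_space UNIV)"

text \<open>The monadic bind is the mixture \<open>A \<mapsto> \<integral> quenched_law \<omega> A d\<nu>(\<omega>)\<close>; see \<open>emeasure_annealed_law\<close> and
  \<open>measure_annealed_law\<close> below.\<close>

definition annealed_law :: "(int ^ 'd) measure measure \<Rightarrow> (nat \<Rightarrow> int ^ 'd) measure" where
  "annealed_law \<mu> = env_law \<mu> \<bind> quenched_law"

definition real_vec :: "int ^ 'd \<Rightarrow> real ^ 'd" where
  "real_vec x = (\<chi> i. real_of_int (x $ i))"

definition directional_transience :: "real ^ 'd \<Rightarrow> (nat \<Rightarrow> int ^ 'd) set" where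
  "directional_transience l = {X. filterlim (\<lambda>n. real_vec (X n) \<bullet> l) at_top sequentially}"


subsection \<open>The definitions describe the intended objects\<close>

lemma space_path_space [simp]: "space path_space = UNIV"
  by (simp add: path_space_def space_PiM)

lemma measurable_coordinate [measurable]:
  "(\<lambda>X. X n) \<in> measurable path_space (count_space UNIV)"
  unfolding path_space_def by measurable

lemma directional_transience_sets [measurable]:
  fixes l :: "real ^ 'd"
  shows "directional_transience l \<in> sets path_space"
proof -
  have eq: "directional_transience l =
      {X \<in> space path_space. \<forall>Z::nat. \<exists>N. \<forall>n\<ge>N. real Z \<le> real_vec (X n) \<bullet> l}"
    (is "_ = {X \<in> _. ?Q X}")
  proof -
    have "filterlim (\<lambda>n. real_vec (X n) \<bullet> l) at_top sequentially \<longleftrightarrow> ?Q X" for X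
    proof
      assume "filterlim (\<lambda>n. real_vec (X n) \<bullet> l) at_top sequentially"
      then show "?Q X" by (simp add: filterlim_at_top eventually_sequentially)
    next
      assume Q: "?Q X"
      show "filterlim (\<lambda>n. real_vec (X n) \<bullet> l) at_top sequentially"
        unfolding filterlim_at_top eventually_sequentially
      proof
        fix Z :: real
        obtain k :: nat where k: "Z \<le> real k" using real_arch_simple by blast
        then show "\<exists>N. \<forall>n\<ge>N. Z \<le> real_vec (X n) \<bullet> l" using Q by (meson order_trans)
      qed
    qed
    then show ?thesis by (auto simp: directional_transience_def)
  qed
  have [measurable]: "(\<lambda>X. real_vec (X n) \<bullet> l) \<in> borel_measurable path_space" for n
    by (rule measurable_compose[OF measurable_coordinate]) simp
  show ?thesis unfolding eq by measurable
qed

lemma space_env_imp: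
  assumes "\<omega> \<in> space (env_law \<mu>)" and "sets \<mu> = sets step_laws"
  shows "\<omega> x \<in> space step_laws"
  using assms sets_eq_imp_space_eq[OF assms(2)] by (auto simp: env_law_def space_PiM PiE_iff)

lemma step_law_distr:
  assumes "p \<in> space (step_laws :: (int ^ 'd) measure measure)"
  shows "prob_space (distr p (count_space UNIV) (\<lambda>e. v + e))"
proof -
  have s: "sets p = sets (count_space unit_vectors)" and "prob_space p"
    using assms by (auto simp: step_laws_def space_prob_algebra)
  then show ?thesis
    by (intro prob_space.prob_space_distr) (auto simp: measurable_cong_sets[OF s refl])
qed

lemma walk_kernel_measurable:
  fixes n :: nat
  shows "(\<lambda>(\<omega>, X). walk_kernel \<omega> n X) \<in>
    measurable ((\<Pi>\<^sub>M x\<in>UNIV. step_laws) \<Otimes>\<^sub>M (\<Pi>\<^sub>M i\<in>{0..<n}. count_space (UNIV :: (int ^ 'd) set)))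
      (prob_algebra (count_space UNIV))"
proof (cases n)
  case 0
  then show ?thesis
    by (auto simp: walk_kernel_def space_prob_algebra prob_space_return intro!: measurable_const)
next
  case (Suc m)
  let ?M = "(\<Pi>\<^sub>M x\<in>UNIV. step_laws) \<Otimes>\<^sub>M (\<Pi>\<^sub>M i\<in>{0..<n}. count_space (UNIV :: (int ^ 'd) set))"
  have a: "(\<lambda>z. snd z m) \<in> measurable ?M (count_space UNIV)"
    by (rule measurable_compose[OF measurable_snd measurable_component_singleton]) (simp add: Suc)
  have b: "(\<lambda>z. distr (fst z v) (count_space UNIV) (\<lambda>e. v + e))
      \<in> measurable ?M (prob_algebra (count_space UNIV))" for v :: "int ^ 'd"
  proof (rule measurable_compose[where f="\<lambda>z. fst z v"])
    show "(\<lambda>z. fst z v) \<in> measurable ?M step_laws"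
      by (rule measurable_compose[OF measurable_fst measurable_component_singleton]) simp
    show "(\<lambda>p. distr p (count_space UNIV) (\<lambda>e. v + e))
        \<in> measurable step_laws (prob_algebra (count_space UNIV))"
      unfolding step_laws_def by (rule measurable_distr_prob_space) simp
  qed
  have "(\<lambda>z. (\<lambda>v z. distr (fst z v) (count_space UNIV) (\<lambda>e. v + e)) (snd z m) z)
      \<in> measurable ?M (prob_algebra (count_space UNIV))"
    by (rule measurable_compose_countable[OF b a])
  then show ?thesis by (simp add: walk_kernel_def Suc case_prod_beta')
qed

lemma Ionescu_Tulcea_walk:
  fixes \<omega> :: "int ^ 'd \<Rightarrow> (int ^ 'd) measure"
  assumes "\<And>x. \<omega> x \<in> space step_laws"
  shows "Ionescu_Tulcea (walk_kernel \<omega>) (\<lambda>_. count_space UNIV)"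
proof (rule Ionescu_Tulcea.intro)
  have \<omega>: "\<omega> \<in> space (\<Pi>\<^sub>M x\<in>UNIV. step_laws)"
    using assms by (auto simp: space_PiM)
  fix i
  have "(\<lambda>X. (\<lambda>(\<omega>, X). walk_kernel \<omega> i X) (\<omega>, X)) \<in>
      measurable (\<Pi>\<^sub>M j\<in>{0..<i}. count_space UNIV) (prob_algebra (count_space UNIV))"
    by (rule measurable_compose[OF measurable_Pair1'[OF \<omega>] walk_kernel_measurable])
  then show "walk_kernel \<omega> i \<in>
      measurable (\<Pi>\<^sub>M j\<in>{0..<i}. count_space UNIV) (subprob_algebra (count_space UNIV))"
    by (auto dest: measurable_prob_algebraD)
next
  fix i and X :: "nat \<Rightarrow> int ^ 'd"
  show "prob_space (walk_kernel \<omega> i X)"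
    by (auto simp: walk_kernel_def prob_space_return intro!: step_law_distr assms)
qed

lemma sets_quenched_law:
  assumes "\<And>x. \<omega> x \<in> space step_laws"
  shows "sets (quenched_law \<omega>) = sets path_space"
proof -
  interpret Ionescu_Tulcea "walk_kernel \<omega>" "\<lambda>_. count_space UNIV"
    by (rule Ionescu_Tulcea_walk[OF assms])
  show ?thesis by (simp add: quenched_law_def path_space_def PF.sets_lim)
qed

lemma emeasure_quenched_law_emb:
  fixes \<omega> :: "int ^ 'd \<Rightarrow> (int ^ 'd) measure"
  assumes "\<And>x. \<omega> x \<in> space step_laws"
    and "J \<subseteq> {0..<n}" and "A \<in> sets (\<Pi>\<^sub>M i\<in>J. count_space UNIV)"
  shows "emeasure (quenched_law \<omega>) (prod_emb UNIV (\<lambda>_. count_space UNIV) J A) =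
    emeasure (Ionescu_Tulcea.C (walk_kernel \<omega>) (\<lambda>_. count_space UNIV) 0 n (\<lambda>_. undefined))
      (prod_emb {0..<n} (\<lambda>_. count_space UNIV) J A)"
proof -
  interpret Ionescu_Tulcea "walk_kernel \<omega>" "\<lambda>_. count_space UNIV"
    by (rule Ionescu_Tulcea_walk[OF assms(1)])
  show ?thesis
    using assms(2,3) finite_subset[OF assms(2)] by (simp add: quenched_law_def lim emeasure_CI)
qed

lemma prob_space_quenched_law:
  assumes "\<And>x. \<omega> x \<in> space step_laws"
  shows "prob_space (quenched_law \<omega>)"
proof -
  interpret Ionescu_Tulcea "walk_kernel \<omega>" "\<lambda>_. count_space UNIV"
    by (rule Ionescu_Tulcea_walk[OF assms])
  show ?thesis unfolding quenched_law_def
  proof (rule prob_spaceI)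
    have "emeasure PF.lim (PF.emb UNIV {} (space (PiM {} (\<lambda>_. count_space UNIV)))) = 
        emeasure (CI {}) (space (PiM {} (\<lambda>_. count_space UNIV)))"
      by (rule lim) auto
    moreover have "\<dots> = 1"
      using prob_space.emeasure_space_1[OF PF.prob_space_P[of "{}"]] by (simp add: PF.space_P)
    moreover have "PF.emb UNIV {} (space (PiM {} (\<lambda>_. count_space UNIV))) = space PF.lim"
      by (auto simp: prod_emb_def PF.space_lim space_PiM)
    ultimately show "emeasure PF.lim (space PF.lim) = 1" by simp
  qed
qed

lemma emeasure_step:
  assumes "p \<in> space (step_laws :: (int ^ 'd) measure measure)"
  shows "emeasure (distr p (count_space UNIV) (\<lambda>e. v + e)) {w} = emeasure p {w - v}"
proof -
  have s: "sets p = sets (count_space unit_vectors)"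
    using assms by (auto simp: step_laws_def space_prob_algebra)
  have sp: "space p = unit_vectors" using sets_eq_imp_space_eq[OF s] by simp
  have "emeasure (distr p (count_space UNIV) (\<lambda>e. v + e)) {w} =
      emeasure p ((\<lambda>e. v + e) -` {w} \<inter> unit_vectors)"
    by (subst emeasure_distr) (auto simp: measurable_cong_sets[OF s refl] sp)
  also have "(\<lambda>e. v + e) -` {w} \<inter> unit_vectors = {w - v} \<inter> unit_vectors"
    by (auto simp: algebra_simps)
  also have "emeasure p ({w - v} \<inter> unit_vectors) = emeasure p {w - v}"
    by (cases "w - v \<in> unit_vectors") (auto simp: s emeasure_notin_sets)
  finally show ?thesis .
qed

lemma emeasure_walk_C:
  fixes \<omega> :: "int ^ 'd \<Rightarrow> (int ^ 'd) measure"
  assumes "\<And>x. \<omega> x \<in> space step_laws"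
  shows "emeasure (Ionescu_Tulcea.C (walk_kernel \<omega>) (\<lambda>_. count_space UNIV) 0 (Suc n) (\<lambda>_. undefined))
      {restrict x {0..<Suc n}} =
    (if x 0 = 0 then \<Prod>i<n. emeasure (\<omega> (x i)) {x (Suc i) - x i} else 0)"
proof -
  interpret Ionescu_Tulcea "walk_kernel \<omega>" "\<lambda>_. count_space UNIV"
    by (rule Ionescu_Tulcea_walk[OF assms])
  let ?u = "\<lambda>_::nat. undefined :: int ^ 'd"
  have sing: "{restrict x {0..<k}} \<in> sets (\<Pi>\<^sub>M i\<in>{0..<k}. count_space UNIV)" for k
  proof -
    have "{restrict x {0..<k}} = (\<Pi>\<^sub>E i\<in>{0..<k}. {x i})"
      by (auto simp: fun_eq_iff PiE_iff extensional_def)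
    then show ?thesis by (auto intro!: sets_PiM_I_finite)
  qed
  have u: "?u \<in> space (\<Pi>\<^sub>M i\<in>{0..<0}. count_space UNIV)" by (simp add: space_PiM)
  have step: "emeasure (C 0 (Suc m) ?u) {restrict x {0..<Suc m}} =
      emeasure (walk_kernel \<omega> m (restrict x {0..<m})) {x m} *
      emeasure (C 0 m ?u) {restrict x {0..<m}}" for m
  proof -
    have *: "emeasure (eP m y) {restrict x {0..<Suc m}} =
        emeasure (walk_kernel \<omega> m (restrict x {0..<m})) {x m} * indicator {restrict x {0..<m}} y"
      if y: "y \<in> space (\<Pi>\<^sub>M i\<in>{0..<m}. count_space UNIV)" for y
    proof -
      have ext: "y \<in> extensional {0..<m}" using y by (auto simp: space_PiM PiE_def)
      have eq: "y(m := v) = restrict x {0..<Suc m} \<longleftrightarrow> y = restrict x {0..<m} \<and> v = x m" for v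
      proof
        assume h: "y(m := v) = restrict x {0..<Suc m}"
        have "y i = restrict x {0..<m} i" for i
          using fun_cong[OF h, of i] ext by (cases "i < m") (auto simp: extensional_def split: if_splits)
        moreover have "v = x m" using fun_cong[OF h, of m] by simp
        ultimately show "y = restrict x {0..<m} \<and> v = x m" by auto
      qed (auto simp: fun_eq_iff)
      show ?thesis
        unfolding emeasure_eP[OF y sing] vimage_def by (auto simp: eq split: split_indicator)
    qed
    have "emeasure (C 0 (Suc m) ?u) {restrict x {0..<Suc m}} =
        (\<integral>\<^sup>+y. emeasure (eP m y) {restrict x {0..<Suc m}} \<partial>C 0 m ?u)"
      using space_C[OF u, of m] sets_C[OF u, of m]
      by (simp, subst emeasure_bind[OF _ _ sing])
        (auto simp: measurable_cong_sets[OF sets_C[OF u, of m] refl]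
          intro: prob_space.not_empty[OF prob_space_C[OF u, of m]])
    also have "\<dots> = (\<integral>\<^sup>+y. emeasure (walk_kernel \<omega> m (restrict x {0..<m})) {x m} *
        indicator {restrict x {0..<m}} y \<partial>C 0 m ?u)"
      using space_C[OF u, of m] by (intro nn_integral_cong *) simp
    also have "\<dots> = emeasure (walk_kernel \<omega> m (restrict x {0..<m})) {x m} *
        emeasure (C 0 m ?u) {restrict x {0..<m}}"
      using sing[of m] sets_C[OF u, of m] by (intro nn_integral_cmult_indicator) simp
    finally show ?thesis .
  qed
  show ?thesis
  proof (induction n)
    case 0
    have "restrict x {0..<0} = ?u" by auto
    then show ?case
      using sing[of 0] unfolding step[of 0]
      by (simp add: walk_kernel_def indicator_def split: if_split_asm)
  next
    case (Suc n)
    have "emeasure (walk_kernel \<omega> (Suc n) (restrict x {0..<Suc n})) {x (Suc n)} =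
        emeasure (\<omega> (x n)) {x (Suc n) - x n}"
      by (simp add: walk_kernel_def emeasure_step assms)
    then show ?case unfolding step[of "Suc n"] Suc by (auto simp: mult.commute)
  qed
qed

lemma quenched_law_cylinder:
  fixes \<omega> :: "int ^ 'd \<Rightarrow> (int ^ 'd) measure"
  assumes "\<And>x. \<omega> x \<in> space step_laws"
  shows "measure (quenched_law \<omega>) {X. \<forall>i\<le>n. X i = x i} =
    (if x 0 = 0 then \<Prod>i<n. measure (\<omega> (x i)) {x (Suc i) - x i} else 0)"
proof -
  let ?M = "\<lambda>_::nat. count_space (UNIV :: (int ^ 'd) set)" and ?J = "{0..<Suc n}"
  have sing: "{restrict x ?J} = (\<Pi>\<^sub>E i\<in>?J. {x i})"
    by (auto simp: fun_eq_iff PiE_iff extensional_def)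
  have sets: "{restrict x ?J} \<in> sets (PiM ?J ?M)"
    unfolding sing by (auto intro!: sets_PiM_I_finite)
  have cyl: "{X. \<forall>i\<le>n. X i = x i} = prod_emb UNIV ?M ?J {restrict x ?J}"
    unfolding sing by (auto simp: prod_emb_def less_Suc_eq_le PiE_iff)
  have emb: "prod_emb ?J ?M ?J {restrict x ?J} = {restrict x ?J}"
    using sets by (intro prod_emb_id) (auto simp: sing PiE_iff)
  have p: "prob_space (\<omega> y)" for y using assms[of y] by (simp add: step_laws_def space_prob_algebra)
  have "emeasure (quenched_law \<omega>) {X. \<forall>i\<le>n. X i = x i} =
      (if x 0 = 0 then \<Prod>i<n. emeasure (\<omega> (x i)) {x (Suc i) - x i} else 0)"
    unfolding cyl emeasure_quenched_law_emb[OF assms order_refl sets] emb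
    by (rule emeasure_walk_C[OF assms])
  also have "\<dots> = ennreal (if x 0 = 0 then \<Prod>i<n. measure (\<omega> (x i)) {x (Suc i) - x i} else 0)"
    using p by (auto simp: finite_measure.emeasure_eq_measure prob_space.finite_measure prod_ennreal)
  finally show ?thesis by (auto simp: measure_def prod_nonneg)
qed

lemma quenched_law_measurable [measurable]:
  "quenched_law \<in> measurable (\<Pi>\<^sub>M x\<in>UNIV. step_laws) (prob_algebra path_space)"
proof -
  let ?M = "\<lambda>_::nat. count_space (UNIV :: (int ^ 'd) set)"
  let ?S = "\<Pi>\<^sub>M x\<in>(UNIV :: (int ^ 'd) set). (step_laws :: (int ^ 'd) measure measure)"
  let ?C = "\<lambda>\<omega> n. Ionescu_Tulcea.C (walk_kernel \<omega>) ?M 0 n (\<lambda>_. undefined)"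
  have S: "\<omega> x \<in> space step_laws" if "\<omega> \<in> space ?S" for \<omega> and x :: "int ^ 'd"
    using that by (auto simp: space_PiM)
  note IT = Ionescu_Tulcea_walk[OF S]
  have C: "(\<lambda>\<omega>. ?C \<omega> n) \<in> measurable ?S (prob_algebra (PiM {0..<n} ?M))" for n
  proof (induction n)
    case 0
    have "return (PiM {0..<0} ?M) (\<lambda>_. undefined) \<in> space (prob_algebra (PiM {0..<0} ?M))"
      by (auto simp: space_prob_algebra space_PiM intro!: prob_space_return)
    then have "(\<lambda>\<omega>. return (PiM {0..<0} ?M) (\<lambda>_. undefined))
        \<in> measurable ?S (prob_algebra (PiM {0..<0} ?M))"
      by (rule measurable_const)
    then show ?case
      by (subst measurable_cong[OF Ionescu_Tulcea.C.simps(1)[OF IT]])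
  next
    case (Suc n)
    have upd: "(\<lambda>(z, v). (snd z)(n := v)) \<in>
        measurable ((?S \<Otimes>\<^sub>M PiM {0..<n} ?M) \<Otimes>\<^sub>M count_space UNIV) (PiM {0..<Suc n} ?M)"
      unfolding case_prod_beta'
      by (rule measurable_fun_upd[where J="{0..<n}"]) auto
    have "(\<lambda>z. distr ((\<lambda>(\<omega>, X). walk_kernel \<omega> n X) z) (PiM {0..<Suc n} ?M) (\<lambda>v. (snd z)(n := v)))
        \<in> measurable (?S \<Otimes>\<^sub>M PiM {0..<n} ?M) (prob_algebra (PiM {0..<Suc n} ?M))"
      by (rule measurable_distr_prob_space2[OF walk_kernel_measurable upd])
    then have eP: "(\<lambda>(\<omega>, y). distr (walk_kernel \<omega> n y) (PiM {0..<Suc n} ?M) (fun_upd y n))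
        \<in> measurable (?S \<Otimes>\<^sub>M PiM {0..<n} ?M) (prob_algebra (PiM {0..<Suc n} ?M))"
      by (simp add: case_prod_beta')
    have "?C \<omega> (Suc n) =
        ?C \<omega> n \<bind> (\<lambda>y. distr (walk_kernel \<omega> n y) (PiM {0..<Suc n} ?M) (fun_upd y n))"
      if "\<omega> \<in> space ?S" for \<omega>
      using Ionescu_Tulcea.C.simps(2)[OF IT[OF that], where n=0 and m=n] Ionescu_Tulcea.eP_def[OF IT[OF that]]
      by (simp add: fun_eq_iff cong: bind_cong)
    then show ?case
      using measurable_bind_prob_space2[OF Suc eP] by (subst measurable_cong)
  qed
  show ?thesis
  proof (rule measurable_prob_algebra_generated)
    show "sets path_space = sigma_sets (\<Pi>\<^sub>E i\<in>UNIV. space (?M i)) (prod_algebra UNIV ?M)"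
      unfolding path_space_def by (rule sets_PiM)
    show "Int_stable (prod_algebra UNIV ?M)" by (rule Int_stable_prod_algebra)
    show "prod_algebra UNIV ?M \<subseteq> Pow (\<Pi>\<^sub>E i\<in>UNIV. space (?M i))" by (rule prod_algebra_sets_into_space)
    show "prob_space (quenched_law \<omega>)" if "\<omega> \<in> space ?S" for \<omega>
      by (rule prob_space_quenched_law[OF S[OF that]])
    show "sets (quenched_law \<omega>) = sets path_space" if "\<omega> \<in> space ?S" for \<omega>
      by (rule sets_quenched_law[OF S[OF that]])
    fix A assume "A \<in> prod_algebra UNIV ?M"
    then obtain J E where A: "A = prod_emb UNIV ?M J (\<Pi>\<^sub>E j\<in>J. E j)" and J: "finite J"
      by (rule prod_algebraE) auto
    obtain n where n: "J \<subseteq> {0..<n}"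
      using J by (metis atLeast0LessThan finite_nat_iff_bounded)
    have E: "(\<Pi>\<^sub>E j\<in>J. E j) \<in> sets (PiM J ?M)" using J by (auto intro!: sets_PiM_I_finite)
    have emb: "prod_emb {0..<n} ?M J (\<Pi>\<^sub>E j\<in>J. E j) \<in> sets (PiM {0..<n} ?M)"
      using n E by (rule measurable_prod_emb)
    have "(\<lambda>\<omega>. emeasure (?C \<omega> n) (prod_emb {0..<n} ?M J (\<Pi>\<^sub>E j\<in>J. E j))) \<in> borel_measurable ?S"
      using measurable_compose[OF measurable_prob_algebraD[OF C]
          measurable_emeasure_subprob_algebra[OF emb]] .
    then show "(\<lambda>\<omega>. emeasure (quenched_law \<omega>) A) \<in> borel_measurable ?S"
      unfolding A
      by (subst measurable_cong[OF emeasure_quenched_law_emb[OF S n E]])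
  qed
qed

context
  fixes \<mu> :: "(int ^ 'd) measure measure"
  assumes \<mu>: "prob_space \<mu>" "sets \<mu> = sets step_laws"
begin

lemma env_law_in_prob_algebra: "env_law \<mu> \<in> space (prob_algebra (\<Pi>\<^sub>M x\<in>UNIV. step_laws))"
  using \<mu> by (auto simp: space_prob_algebra env_law_def intro!: prob_space_PiM sets_PiM_cong)

lemma sets_annealed_law: "sets (annealed_law \<mu>) = sets path_space"
  unfolding annealed_law_def
  by (rule sets_bind'[OF env_law_in_prob_algebra quenched_law_measurable])

lemma prob_space_annealed_law: "prob_space (annealed_law \<mu>)"
  unfolding annealed_law_def
  by (rule prob_space_bind'[OF env_law_in_prob_algebra quenched_law_measurable])

lemma emeasure_annealed_law:
  assumes "A \<in> sets path_space"
  shows "emeasure (annealed_law \<mu>) A = (\<integral>\<^sup>+\<omega>. emeasure (quenched_law \<omega>) A \<partial>env_law \<mu>)"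
  unfolding annealed_law_def
  by (rule emeasure_bind_prob_algebra[OF env_law_in_prob_algebra quenched_law_measurable assms])

lemma measure_annealed_law:
  assumes A: "A \<in> sets path_space"
  shows "measure (annealed_law \<mu>) A = (\<integral>\<omega>. measure (quenched_law \<omega>) A \<partial>env_law \<mu>)"
proof -
  have s: "sets (env_law \<mu>) = sets (\<Pi>\<^sub>M x\<in>UNIV. step_laws)"
    using env_law_in_prob_algebra by (simp add: space_prob_algebra)
  have m: "(\<lambda>\<omega>. measure (quenched_law \<omega>) A) \<in> borel_measurable (env_law \<mu>)"
    unfolding measurable_cong_sets[OF s refl]
    by (rule measurable_compose[OF quenched_law_measurable measurable_measure_prob_algebra[OF A]])
  have p: "prob_space (quenched_law \<omega>)" if "\<omega> \<in> space (env_law \<mu>)" for \<omega>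
    using prob_space_quenched_law space_env_imp[OF that \<mu>(2)] by blast
  have "emeasure (annealed_law \<mu>) A = (\<integral>\<^sup>+\<omega>. ennreal (measure (quenched_law \<omega>) A) \<partial>env_law \<mu>)"
    unfolding emeasure_annealed_law[OF A]
    by (intro nn_integral_cong)
      (simp add: p finite_measure.emeasure_eq_measure prob_space.finite_measure)
  then show ?thesis
    by (simp add: measure_def integral_eq_nn_integral[OF m[unfolded measure_def]])
qed

end

end

(* If P(A_l) > 0, then P(A_l or A_{-l}) = 1 (Kalikow), and in the plane P(A_{-l}) = 0.

Kalikow's law without ellipticity. If P(A_l) > 0, the walk stays above its starting level forever with
positive probability, and every record of X.l gives it an independent chance to do so; hence A_l holds almost
surely when X.l is unbounded above. On the remaining event the walk is neither unbounded above nor in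
A_{-l}. Every fresh site visited near the limsup of X.l gives an independent chance of a step above that level,
so only finitely many sites near the limsup are visited and the maximum is attained. Thus the walk stays
below its starting level with positive probability, and on the remaining event it is also bounded below.
Then the minimum is attained as well, so the walk has positive probability of staying above its starting
level while being bounded; trying this at every record excludes A_l.

The planar part follows Zerner. Let one walk start at 0 and try to achieve A_l without going below its
start, and let another one start at y, far up, and try to achieve A_{-l} without going above its start. Call
the probabilities of success p and q. In a common environment both succeed with probability close to pq when
y is far away. They cannot meet then, up to a small probability: the quenched probability of A_l seen from
a late position of a walk is close to 0 or 1, according to what this walk does. As long as they do not meet,
the walks might as well be in independent environments. But for two independent walks the paths cross with
probability at least pq/4, if y is placed at a median of the point where the first walk reaches its level. *)

theory Submission
  imports Defs
begin

subsection \<open>Path space\<close>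

text \<open>Without ellipticity no step can be forced, and under the annealed law the walk is in
  general not Markov. Locality replaces both: a prefix of the path reads the environment only at the
  sites it has left, so a continuation that reads other sites is independent of it. At a strict
  record these are the continuations in the half-space above; at a fresh site it is the next step.
  Conversely, by stationarity of the environment, an event that is null for the walk from 0 is null
  from every later time on; hence what the walk does from some random time on, with positive
  probability, it also does from the start with positive probability.

  The plane enters only through the crossing of paths. Two sides of \<open>y\<close> on which the
  first walk passes and two sides of 0 on which the second one arrives make four combinations; a
  median column gives weight p/2 to both sides of \<open>y\<close>, one side of 0 has weight q/2,
  and one of the two remaining combinations forces a meeting. The bound pq/4 does not depend on the
  level of \<open>y\<close>, so the level can be taken as high as the two error estimates
  require.\<close>

definition seq_space :: "(nat \<Rightarrow> 'a) measure" where
  "seq_space = (\<Pi>\<^sub>M n\<in>UNIV. count_space UNIV)"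

definition cyl :: "nat \<Rightarrow> (nat \<Rightarrow> 'a) \<Rightarrow> (nat \<Rightarrow> 'a) set" where
  "cyl n x = {X. \<forall>i\<le>n. X i = x i}"

definition determined :: "nat \<Rightarrow> (nat \<Rightarrow> 'a) set \<Rightarrow> bool" where
  "determined n A \<longleftrightarrow> (\<forall>X Y. (\<forall>i\<le>n. X i = Y i) \<longrightarrow> X \<in> A \<longrightarrow> Y \<in> A)"

text \<open>Cylinders are the fibres of this map. Over a countable state space its values lie in a
  countable type, so an event determined at time \<open>n\<close> splits into countably many
  disjoint cylinders.\<close>

definition prefix_upto :: "nat \<Rightarrow> (nat \<Rightarrow> 'a) \<Rightarrow> 'a list" where
  "prefix_upto n X = map X [0..<Suc n]"

lemma length_prefix_upto [simp]: "length (prefix_upto n X) = Suc n"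
  by (simp add: prefix_upto_def)

lemma prefix_upto_eq_iff: "prefix_upto n X = prefix_upto n Y \<longleftrightarrow> (\<forall>i\<le>n. X i = Y i)"
  unfolding prefix_upto_def map_eq_conv by (metis atLeastLessThan_iff less_Suc_eq_le set_upt zero_le)

lemma cyl_eq_vimage: "cyl n x = prefix_upto n -` {prefix_upto n x}"
  by (auto simp: cyl_def prefix_upto_eq_iff)

lemma self_in_cyl [simp]: "x \<in> cyl n x"
  by (simp add: cyl_def)

lemma determined_mono: "determined m A \<Longrightarrow> m \<le> n \<Longrightarrow> determined n A"
  unfolding determined_def by (meson order_trans)

lemma determined_Compl: "determined n A \<Longrightarrow> determined n (- A)"
  unfolding determined_def by (metis ComplD ComplI)

lemma determined_Int: "determined n A \<Longrightarrow> determined n B \<Longrightarrow> determined n (A \<inter> B)"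
  unfolding determined_def by blast

lemma determined_UN: "(\<And>i. i \<in> I \<Longrightarrow> determined n (A i)) \<Longrightarrow> determined n (\<Union>i\<in>I. A i)"
  unfolding determined_def by blast

lemma cyl_subset_determined: "determined n A \<Longrightarrow> x \<in> A \<Longrightarrow> cyl n x \<subseteq> A"
  unfolding determined_def cyl_def by (auto; metis)

lemma space_seq_space [simp]: "space seq_space = UNIV"
  by (simp add: seq_space_def space_PiM)

lemma measurable_seq_coordinate [measurable]:
  "(\<lambda>X. X n) \<in> seq_space \<rightarrow>\<^sub>M count_space UNIV"
  unfolding seq_space_def by measurable

lemma cyl_sets [measurable]: "cyl n x \<in> sets (seq_space :: (nat \<Rightarrow> 'a::countable) measure)"
proof -
  have "cyl n x = (\<Inter>i\<in>{..n}. (\<lambda>X. X i) -` {x i} \<inter> space seq_space)"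
    by (auto simp: cyl_def)
  also have "\<dots> \<in> sets seq_space"
    by (intro sets.finite_INT measurable_sets[OF measurable_seq_coordinate]) auto
  finally show ?thesis .
qed

lemma disjoint_cyl:
  "disjoint_family_on (\<lambda>xs. prefix_upto n -` {xs}) I"
  by (auto simp: disjoint_family_on_def)

lemma determined_sets:
  fixes A :: "(nat \<Rightarrow> 'a::countable) set"
  assumes "determined n A"
  shows "A \<in> sets seq_space"
proof -
  have "A = (\<Union>xs\<in>prefix_upto n ` A. prefix_upto n -` {xs})"
    using assms by (auto simp: determined_def prefix_upto_eq_iff) metis
  also have "\<dots> \<in> sets seq_space"
    by (intro sets.countable_UN') (auto simp flip: cyl_eq_vimage)
  finally show ?thesis .
qed

lemma Int_stable_determined: "Int_stable {A. \<exists>n. determined n A}"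
proof (rule Int_stableI; clarify)
  fix A B :: "(nat \<Rightarrow> 'a) set" and m n assume "determined m A" "determined n B"
  then have "determined (max m n) (A \<inter> B)"
    by (intro determined_Int) (auto intro: determined_mono)
  then show "\<exists>n. determined n (A \<inter> B)" by blast
qed

lemma sets_seq_space:
  "sets (seq_space :: (nat \<Rightarrow> 'a::countable) measure) = sigma_sets UNIV {A. \<exists>n. determined n A}"
    (is "sets ?S = sigma_sets UNIV ?E")
proof
  show "sets ?S \<subseteq> sigma_sets UNIV ?E"
  proof -
    have "sets ?S = sigma_sets UNIV {{f\<in>\<Pi>\<^sub>E i\<in>UNIV. UNIV. f i \<in> A} | i A. i \<in> UNIV \<and> A \<in> UNIV}"
      unfolding seq_space_def sets_PiM_single by simp
    also have "\<dots> \<subseteq> sigma_sets UNIV ?E"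
    proof (rule sigma_sets_mono', safe)
      fix i :: nat and A :: "'a set"
      have "determined i {f\<in>\<Pi>\<^sub>E i\<in>UNIV. UNIV. f i \<in> A}"
        by (auto simp: determined_def)
      then show "\<exists>n. determined n {f\<in>\<Pi>\<^sub>E i\<in>UNIV. UNIV. f i \<in> A}" ..
    qed
    finally show ?thesis .
  qed
  show "sigma_sets UNIV ?E \<subseteq> sets ?S"
    using sets.sigma_sets_subset[of ?E ?S] determined_sets by auto
qed

text \<open>The events determined at a finite time generate the \<sigma>-algebra, and the sets with
  such approximations are closed under complements and countable unions. The two halves of the
  symmetric difference are bounded separately because a complement just exchanges them.\<close>

lemma determined_approx:
  fixes M :: "(nat \<Rightarrow> 'a::countable) measure"
  assumes "finite_measure M" and sets: "sets M = sets seq_space"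
    and "A \<in> sets seq_space" and "e > 0"
  shows "\<exists>n C. determined n C \<and> measure M (A - C) < e \<and> measure M (C - A) < e"
proof -
  interpret finite_measure M by fact
  note det = determined_sets[folded sets]
  have "A \<in> sigma_sets UNIV {A. \<exists>n. determined n A}"
    using assms by (simp add: sets_seq_space)
  then have "\<forall>e>0. \<exists>n C. determined n C \<and> measure M (A - C) < e \<and> measure M (C - A) < e"
  proof induction
    case (Basic a)
    then show ?case by force
  next
    case Empty
    have "determined 0 ({} :: (nat \<Rightarrow> 'a) set)" by (simp add: determined_def)
    then show ?case by force
  next
    case (Compl a)
    show ?case
    proof (intro allI impI)
      fix e :: real assume "e > 0"
      with Compl.IH obtain n C where "determined n C" "measure M (a - C) < e" "measure M (C - a) < e"
        by blast
      moreover have "UNIV - a - - C = C - a" "- C - (UNIV - a) = a - C" by auto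
      ultimately show "\<exists>n C. determined n C \<and> measure M (UNIV - a - C) < e \<and>
          measure M (C - (UNIV - a)) < e"
        using determined_Compl by metis
    qed
  next
    case (Union a)
    have a: "a i \<in> sets M" for i using Union.hyps by (simp add: sets sets_seq_space)
    show ?case
    proof (intro allI impI)
      fix e :: real assume e: "e > 0"
      have "(\<lambda>n. measure M (\<Union>i\<le>n. a i)) \<longlonglongrightarrow> measure M (\<Union>n. \<Union>i\<le>n. a i)"
        by (rule finite_Lim_measure_incseq) (fastforce simp: incseq_def a intro!: sets.finite_UN)+
      moreover have "(\<Union>n. \<Union>i\<le>n. a i) = (\<Union>i. a i)" by auto
      ultimately have "\<forall>\<^sub>F n in sequentially. measure M (\<Union>i\<le>n. a i) > measure M (\<Union>i. a i) - e / 2"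
        using e by (intro order_tendstoD(1)[where y="measure M (\<Union>i. a i)"]) auto
      \<comment> \<open>Half of \<open>e\<close> pays for cutting the union off after
        \<open>N\<close>, the other half for the \<open>Suc N\<close> approximations.\<close>
      then obtain N where N: "measure M (\<Union>i\<le>N. a i) > measure M (\<Union>i. a i) - e / 2"
        by (auto simp: eventually_sequentially)
      define Q where "Q i nC \<longleftrightarrow> determined (fst nC) (snd nC) \<and>
          measure M (a i - snd nC) < e / (2 * Suc N) \<and> measure M (snd nC - a i) < e / (2 * Suc N)"
        for i and nC :: "nat \<times> (nat \<Rightarrow> 'a) set"
      have "\<exists>nC. Q i nC" for i
      proof -
        have "e / (2 * Suc N) > 0" using e by simp
        with Union.IH[of i] show ?thesis unfolding Q_def by (metis fst_conv snd_conv)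
      qed
      then obtain p where "Q i (p i)" for i by metis
      then have p: "\<And>i. determined (fst (p i)) (snd (p i))"
          "\<And>i. measure M (a i - snd (p i)) < e / (2 * Suc N)"
          "\<And>i. measure M (snd (p i) - a i) < e / (2 * Suc N)"
        by (auto simp only: Q_def)
      define n where "n = Max ((\<lambda>i. fst (p i)) ` {..N})"
      define C where "C = (\<Union>i\<le>N. snd (p i))"
      have pm: "snd (p i) \<in> sets M" for i using det[OF p(1)] sets by simp
      have "determined n (snd (p i))" if "i \<le> N" for i
        by (rule determined_mono[OF p(1)]) (use that in \<open>auto simp: n_def\<close>)
      then have "determined n C" unfolding C_def by (intro determined_UN) auto
      moreover have "measure M ((\<Union>i. a i) - C) < e"
      proof -
        have "(\<Union>i. a i) - C \<subseteq> ((\<Union>i. a i) - (\<Union>i\<le>N. a i)) \<union> (\<Union>i\<le>N. a i - snd (p i))"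
          by (auto simp: C_def)
        then have "measure M ((\<Union>i. a i) - C) \<le>
            measure M (((\<Union>i. a i) - (\<Union>i\<le>N. a i)) \<union> (\<Union>i\<le>N. a i - snd (p i)))"
          using a pm by (intro finite_measure_mono) (auto intro!: sets.finite_UN)
        also have "\<dots> \<le> measure M ((\<Union>i. a i) - (\<Union>i\<le>N. a i)) + measure M (\<Union>i\<le>N. a i - snd (p i))"
          using a pm by (intro measure_Un_le) auto
        also have "measure M (\<Union>i\<le>N. a i - snd (p i)) \<le> (\<Sum>i\<le>N. measure M (a i - snd (p i)))"
          using a pm by (intro measure_UNION_le) auto
        also have "\<dots> \<le> (\<Sum>i\<le>N. e / (2 * Suc N))" using p(2) by (intro sum_mono less_imp_le)
        also have "\<dots> = e / 2" by (simp add: field_simps)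
        also have "measure M ((\<Union>i. a i) - (\<Union>i\<le>N. a i)) =
            measure M (\<Union>i. a i) - measure M (\<Union>i\<le>N. a i)"
          using a by (intro finite_measure_Diff) auto
        finally show ?thesis using N by simp
      qed
      moreover have "measure M (C - (\<Union>i. a i)) < e"
      proof -
        have "measure M (C - (\<Union>i. a i)) \<le> measure M (\<Union>i\<le>N. snd (p i) - a i)"
          using a pm by (intro finite_measure_mono) (auto simp: C_def)
        also have "\<dots> \<le> (\<Sum>i\<le>N. measure M (snd (p i) - a i))"
          using a pm by (intro measure_UNION_le) auto
        also have "\<dots> \<le> (\<Sum>i\<le>N. e / (2 * Suc N))" using p(3) by (intro sum_mono less_imp_le)
        also have "\<dots> = e / 2" by (simp add: field_simps)
        finally show ?thesis using e by simp
      qed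
      ultimately show "\<exists>n C. determined n C \<and> measure M ((\<Union>i. a i) - C) < e \<and>
          measure M (C - (\<Union>i. a i)) < e" by blast
    qed
  qed
  then show ?thesis using \<open>e > 0\<close> by blast
qed

section \<open>Comparing laws on path space through cylinders\<close>

lemma emeasure_eq_on_determined:
  fixes M N :: "(nat \<Rightarrow> 'a::countable) measure"
  assumes sets: "sets M = sets seq_space" "sets N = sets seq_space"
    and D: "determined n D"
    and eq: "\<And>x. x \<in> D \<Longrightarrow> emeasure M (cyl n x) = emeasure N (cyl n x)"
  shows "emeasure M D = emeasure N D"
proof -
  have D': "D = (\<Union>xs\<in>prefix_upto n ` D. prefix_upto n -` {xs})"
    using D by (auto simp: determined_def prefix_upto_eq_iff) metis
  have *: "emeasure K D = (\<integral>\<^sup>+xs. emeasure K (prefix_upto n -` {xs}) \<partial>count_space (prefix_upto n ` D))"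
    if "sets K = sets seq_space" for K
    by (subst D', rule emeasure_UN_countable)
      (auto simp: that disjoint_cyl simp flip: cyl_eq_vimage)
  show ?thesis
    unfolding *[OF sets(1)] *[OF sets(2)]
    by (intro nn_integral_cong) (use eq in \<open>auto simp: image_iff simp flip: cyl_eq_vimage\<close>)
qed

text \<open>Agreement on cylinders with pairwise related entries suffices for events whose paths are
  related at all times. A binary \<open>R\<close> can say that two walks, coded as one path of
  pairs, never share a site even at different times; an \<open>R\<close> that ignores its second
  argument says that the path stays in a set.\<close>

lemma emeasure_eq_on_related:
  fixes M N :: "(nat \<Rightarrow> 'a::countable) measure"
  assumes fin: "finite_measure M" "finite_measure N"
    and sets: "sets M = sets seq_space" "sets N = sets seq_space"
    and eq: "\<And>n x. (\<And>i j. i \<le> n \<Longrightarrow> j \<le> n \<Longrightarrow> R (x i) (x j)) \<Longrightarrow>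
      emeasure M (cyl n x) = emeasure N (cyl n x)"
    and A: "A \<in> sets seq_space" "\<And>X i j. X \<in> A \<Longrightarrow> R (X i) (X j)"
  shows "emeasure M A = emeasure N A"
proof -
  define S where "S = (\<lambda>n::nat. {X. \<forall>i\<le>n. \<forall>j\<le>n. R (X i) (X j)})"
  have S: "determined n (S n)" for n by (auto simp: S_def determined_def)
  define S' where "S' = (\<Inter>n. S n)"
  have S'_sets: "S' \<in> sets seq_space" unfolding S'_def using determined_sets[OF S] by auto
  \<comment> \<open>Both \<open>D\<close> and \<open>S (n + m)\<close> are determined at time
    \<open>n + m\<close>, so the hypothesis on cylinders applies; then \<open>n\<close> tends to
    infinity.\<close>
  have step: "emeasure M (D \<inter> S') = emeasure N (D \<inter> S')" if D: "determined m D" for m D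
  proof -
    have lim: "(\<lambda>n. emeasure K (D \<inter> S (n + m))) \<longlonglongrightarrow> emeasure K (D \<inter> S')"
      if K: "finite_measure K" "sets K = sets seq_space" for K
    proof -
      have "(\<lambda>n. emeasure K (D \<inter> S (n + m))) \<longlonglongrightarrow> emeasure K (\<Inter>n. D \<inter> S (n + m))"
      proof (rule Lim_emeasure_decseq)
        show "range (\<lambda>n. D \<inter> S (n + m)) \<subseteq> sets K"
          using determined_sets[OF S] determined_sets[OF D] K(2) by auto
        show "decseq (\<lambda>n. D \<inter> S (n + m))" by (auto simp: decseq_def S_def)
        show "\<And>i. emeasure K (D \<inter> S (i + m)) \<noteq> \<infinity>"
          using finite_measure.emeasure_finite[OF K(1)] by (simp add: infinity_ennreal_def)
      qed
      moreover have "(\<Inter>n. D \<inter> S (n + m)) = D \<inter> S'"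
      proof -
        have "S (n + m) \<subseteq> S n" for n by (auto simp: S_def)
        then show ?thesis unfolding S'_def by blast
      qed
      ultimately show ?thesis by simp
    qed
    have "emeasure M (D \<inter> S (n + m)) = emeasure N (D \<inter> S (n + m))" for n
    proof (rule emeasure_eq_on_determined[OF sets])
      show "determined (n + m) (D \<inter> S (n + m))"
        by (intro determined_Int S determined_mono[OF D]) simp
      fix x assume "x \<in> D \<inter> S (n + m)"
      then show "emeasure M (cyl (n + m) x) = emeasure N (cyl (n + m) x)"
        by (intro eq) (auto simp: S_def)
    qed
    then show ?thesis
      using LIMSEQ_unique[OF lim[OF fin(1) sets(1)]] lim[OF fin(2) sets(2)] by simp
  qed
  \<comment> \<open>The restrictions of the two laws to \<open>S'\<close> agree on the generating
    \<pi>-system of determined events.\<close>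
  have "density M (indicator S') = density N (indicator S')"
  proof (rule measure_eqI_generator_eq[OF Int_stable_determined, where \<Omega>=UNIV and A="\<lambda>_. UNIV"])
    show "sets (density M (indicator S')) = sigma_sets UNIV {A. \<exists>n. determined n A}"
      "sets (density N (indicator S')) = sigma_sets UNIV {A. \<exists>n. determined n A}"
      by (simp_all add: sets sets_seq_space)
    show "range (\<lambda>_::nat. UNIV) \<subseteq> {A. \<exists>n. determined n (A :: (nat \<Rightarrow> 'a) set)}"
      by (auto simp: determined_def)
    have sM: "S' \<in> sets M" "S' \<in> sets N" using S'_sets sets by auto
    show "emeasure (density M (indicator S')) UNIV \<noteq> \<infinity>"
      using sM finite_measure.emeasure_finite[OF fin(1)] sets.top[of M] sets_eq_imp_space_eq[OF sets(1)]
      by (subst emeasure_restricted) auto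
    fix X assume "X \<in> {A :: (nat \<Rightarrow> 'a) set. \<exists>n. determined n A}"
    then obtain n where n: "determined n X" by auto
    show "emeasure (density M (indicator S')) X = emeasure (density N (indicator S')) X"
      using sM determined_sets[OF n] step[OF n] sets
      by (simp add: emeasure_restricted Int_commute)
  qed auto
  then have "emeasure (density M (indicator S')) A = emeasure (density N (indicator S')) A" by simp
  moreover have "A \<subseteq> S'" using A(2) by (auto simp: S'_def S_def)
  ultimately show ?thesis
    using S'_sets A(1) sets
    by (simp add: emeasure_restricted Int_absorb1)
qed

lemma measure_eqI_cyl:
  fixes M N :: "(nat \<Rightarrow> 'a::countable) measure"
  assumes fin: "finite_measure M" "finite_measure N"
    and sets: "sets M = sets seq_space" "sets N = sets seq_space"
    and eq: "\<And>n x. emeasure M (cyl n x) = emeasure N (cyl n x)"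
  shows "M = N"
  by (rule measure_eqI) (use emeasure_eq_on_related[OF fin sets, where R="\<lambda>_ _. True"] eq sets in auto)

section \<open>Shifted paths and trials at stopping times\<close>

definition reroot :: "nat \<Rightarrow> (nat \<Rightarrow> 'a::group_add) \<Rightarrow> nat \<Rightarrow> 'a" where
  "reroot k X = (\<lambda>n. X (k + n) - X k)"

lemma measurable_reroot [measurable]:
  "reroot k \<in> seq_space \<rightarrow>\<^sub>M (seq_space :: (nat \<Rightarrow> 'a::{group_add,countable}) measure)"
proof -
  have "(\<lambda>X. \<lambda>n\<in>UNIV. reroot k X n) \<in> seq_space \<rightarrow>\<^sub>M (seq_space :: (nat \<Rightarrow> 'a) measure)"
    unfolding seq_space_def
  proof (rule measurable_restrict)
    fix n :: nat
    have "(\<lambda>X. (X (k + n), X k)) \<in> seq_space \<rightarrow>\<^sub>M (count_space UNIV \<Otimes>\<^sub>M (count_space UNIV :: 'a measure))"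
      by measurable
    then have "(\<lambda>X. (X (k + n), X k)) \<in> seq_space \<rightarrow>\<^sub>M (count_space UNIV :: ('a \<times> 'a) measure)"
      by (simp add: pair_measure_countable)
    then have "(\<lambda>X. case_prod (-) (X (k + n), X k)) \<in> seq_space \<rightarrow>\<^sub>M (count_space UNIV :: 'a measure)"
      by (rule measurable_compose) simp
    then show "(\<lambda>X. reroot k X n) \<in> Pi\<^sub>M UNIV (\<lambda>_. count_space UNIV) \<rightarrow>\<^sub>M (count_space UNIV :: 'a measure)"
      unfolding reroot_def seq_space_def by simp
  qed
  then show ?thesis by (simp add: restrict_def)
qed

lemma reroot_vimage_sets [measurable]:
  "G \<in> sets seq_space \<Longrightarrow>
    reroot k -` G \<in> sets (seq_space :: (nat \<Rightarrow> 'a::{group_add,countable}) measure)"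
  using measurable_sets[OF measurable_reroot] by fastforce

text \<open>A strong Markov bound at the first time \<open>k \<ge> m\<close> at which
  \<open>T\<close> holds. The prefixes up to that time give disjoint cylinders, each contained in
  \<open>C\<close> if it meets \<open>C\<close>, because \<open>C\<close> is determined by then; the
  assumed bounds are summed over these cylinders.\<close>

lemma first_time_bound:
  fixes M :: "(nat \<Rightarrow> 'a::{countable,ab_group_add}) measure"
  assumes "finite_measure M" and sets: "sets M = sets seq_space" and "d \<ge> 0"
    and C: "determined m C" and G: "G \<in> sets seq_space"
    and T: "\<And>k X Y. (\<And>i. i \<le> k \<Longrightarrow> X i = Y i) \<Longrightarrow> T k X \<Longrightarrow> T k Y"
    and bound: "\<And>k x. k \<ge> m \<Longrightarrow> T k x \<Longrightarrow>
      d * measure M (cyl k x) \<le> measure M (cyl k x \<inter> reroot k -` G)"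
  shows "d * measure M (C \<inter> {X. \<exists>k\<ge>m. T k X}) \<le>
    measure M (C \<inter> {X. \<exists>k\<ge>m. T k X \<and> reroot k X \<in> G})"
proof -
  interpret finite_measure M by fact
  \<comment> \<open>The prefixes have various lengths; a list of length \<open>k + 1\<close> records
    the time \<open>k\<close>, which \<open>E\<close> and \<open>F\<close> recover as
    \<open>length xs - 1\<close>.\<close>
  define I where "I = {xs. \<exists>k X. k \<ge> m \<and> xs = prefix_upto k X \<and> X \<in> C \<and> T k X \<and> (\<forall>j\<in>{m..<k}. \<not> T j X)}"
  define E where "E = (\<lambda>xs. prefix_upto (length xs - 1) -` {xs :: 'a list})"
  have E: "E (prefix_upto k X) = cyl k X" for k X
    by (simp add: E_def cyl_eq_vimage)
  have TT: "T k X \<longleftrightarrow> T k Y" if "\<And>i. i \<le> k \<Longrightarrow> X i = Y i" for k X Y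
    using T[of k X Y] T[of k Y X] that by auto
  have disj: "disjoint_family_on E I"
    unfolding disjoint_family_on_def
  proof (intro ballI impI, rule ccontr)
    fix xs ys assume "xs \<in> I" "ys \<in> I" "xs \<noteq> ys" "E xs \<inter> E ys \<noteq> {}"
    then obtain X k Y l Z where *: "k \<ge> m" "xs = prefix_upto k X" "T k X" "\<forall>j\<in>{m..<k}. \<not> T j X"
        "l \<ge> m" "ys = prefix_upto l Y" "T l Y" "\<forall>j\<in>{m..<l}. \<not> T j Y" "Z \<in> cyl k X" "Z \<in> cyl l Y"
      unfolding I_def using E by (smt (verit, ccfv_threshold) disjoint_iff mem_Collect_eq)
    have "T j Z \<longleftrightarrow> T j X" if "j \<le> k" for j
      using *(9) that by (intro TT) (auto simp: cyl_def)
    moreover have "T j Z \<longleftrightarrow> T j Y" if "j \<le> l" for j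
      using *(10) that by (intro TT) (auto simp: cyl_def)
    ultimately have "k = l"
      using * by (metis atLeastLessThan_iff le_refl less_imp_le linorder_neqE_nat)
    with * have "xs = ys" by (auto simp: prefix_upto_eq_iff cyl_def)
    with \<open>xs \<noteq> ys\<close> show False ..
  qed
  have I_cases: "\<exists>k x. k \<ge> m \<and> T k x \<and> E xs = cyl k x \<and> cyl k x \<subseteq> C" if "xs \<in> I" for xs
  proof -
    from that obtain k x where *: "k \<ge> m" "xs = prefix_upto k x" "x \<in> C" "T k x"
      by (auto simp: I_def)
    then show ?thesis
      using cyl_subset_determined[OF determined_mono[OF C]] E by metis
  qed
  have union: "C \<inter> {X. \<exists>k\<ge>m. T k X} = (\<Union>xs\<in>I. E xs)"
  proof (intro equalityI subsetI)
    fix X assume X: "X \<in> C \<inter> {X. \<exists>k\<ge>m. T k X}"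
    define k where "k = (LEAST k. k \<ge> m \<and> T k X)"
    have "k \<ge> m \<and> T k X" unfolding k_def by (rule LeastI_ex) (use X in auto)
    moreover have "\<not> T j X" if "j \<in> {m..<k}" for j
      using not_less_Least[of j "\<lambda>k. k \<ge> m \<and> T k X"] that by (auto simp: k_def)
    ultimately have "prefix_upto k X \<in> I" using X unfolding I_def by fastforce
    then show "X \<in> (\<Union>xs\<in>I. E xs)" by (force simp: E)
  next
    fix X assume "X \<in> (\<Union>xs\<in>I. E xs)"
    then obtain k x where *: "k \<ge> m" "T k x" "X \<in> cyl k x" "cyl k x \<subseteq> C"
      using I_cases by (metis UN_iff)
    have "T k X" by (rule T[OF _ *(2)]) (use *(3) in \<open>auto simp: cyl_def\<close>)
    then show "X \<in> C \<inter> {X. \<exists>k\<ge>m. T k X}" using * by auto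
  qed
  have E_sets: "E xs \<in> sets M" if "xs \<in> I" for xs
    using I_cases[OF that] sets by auto
  define F where "F = (\<lambda>xs. E xs \<inter> reroot (length xs - 1) -` G)"
  have F_sets: "F xs \<in> sets M" if "xs \<in> I" for xs
    using E_sets[OF that] G sets by (auto simp: F_def)
  have I: "countable I" by simp
  have Csets: "C \<in> sets M" using determined_sets[OF C] sets by simp
  have Tsets: "{X. T k X} \<in> sets M" for k
  proof -
    have "determined k {X. T k X}" unfolding determined_def using T by blast
    from determined_sets[OF this] show ?thesis by (simp add: sets)
  qed
  have target: "C \<inter> {X. \<exists>k\<ge>m. T k X \<and> reroot k X \<in> G} \<in> sets M"
  proof -
    have "C \<inter> {X. \<exists>k\<ge>m. T k X \<and> reroot k X \<in> G} = C \<inter> (\<Union>k\<in>{m..}. {X. T k X} \<inter> reroot k -` G)" by auto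
    also have "\<dots> \<in> sets M" using Tsets Csets G sets by (intro sets.Int sets.countable_UN') auto
    finally show ?thesis .
  qed
  have "ennreal (d * measure M (\<Union>xs\<in>I. E xs)) = ennreal d * emeasure M (\<Union>xs\<in>I. E xs)"
    using \<open>d \<ge> 0\<close> by (simp add: emeasure_eq_measure ennreal_mult)
  also have "\<dots> = ennreal d * (\<integral>\<^sup>+xs. emeasure M (E xs) \<partial>count_space I)"
    by (simp add: emeasure_UN_countable[OF E_sets I disj])
  also have "\<dots> = (\<integral>\<^sup>+xs. ennreal d * emeasure M (E xs) \<partial>count_space I)"
    by (simp add: nn_integral_cmult)
  also have "\<dots> \<le> (\<integral>\<^sup>+xs. emeasure M (F xs) \<partial>count_space I)"
  proof (rule nn_integral_mono)
    fix xs assume "xs \<in> space (count_space I)"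
    then have "xs \<in> I" by simp
    then obtain k x where k: "k \<ge> m" "T k x" "xs = prefix_upto k x" by (auto simp: I_def)
    have "d * measure M (E xs) \<le> measure M (F xs)"
      using bound[OF k(1,2)] by (simp add: F_def k(3) E)
    then show "ennreal d * emeasure M (E xs) \<le> emeasure M (F xs)"
      using \<open>d \<ge> 0\<close> by (simp add: emeasure_eq_measure flip: ennreal_mult)
  qed
  also have "\<dots> = emeasure M (\<Union>xs\<in>I. F xs)"
    by (rule emeasure_UN_countable[symmetric, OF F_sets I])
      (use disj in \<open>auto simp: disjoint_family_on_def F_def\<close>)
  also have "\<dots> \<le> emeasure M (C \<inter> {X. \<exists>k\<ge>m. T k X \<and> reroot k X \<in> G})"
  proof (rule emeasure_mono[OF _ target], safe)
    fix X xs assume X: "X \<in> F xs" "xs \<in> I"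
    then obtain k x where k: "k \<ge> m" "T k x" "xs = prefix_upto k x" by (auto simp: I_def)
    have X': "X \<in> cyl k x" "reroot k X \<in> G" using X(1) by (auto simp: F_def k(3) E)
    have "T k X" by (rule T[OF _ k(2)]) (use X'(1) in \<open>auto simp: cyl_def\<close>)
    then show "\<exists>k\<ge>m. T k X \<and> reroot k X \<in> G" using X' k by blast
    show "X \<in> C" using X union by (auto simp: F_def)
  qed
  finally show ?thesis
    unfolding union by (simp add: emeasure_eq_measure)
qed

text \<open>Approximating the complement of \<open>B\<close> by an event determined at a finite time replaces Levy's
  zero-one law.\<close>

lemma repeated_trials:
  fixes M :: "(nat \<Rightarrow> 'a::{countable,ab_group_add}) measure"
  assumes "finite_measure M" and sets: "sets M = sets seq_space" and d: "d > 0"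
    and G: "G \<in> sets seq_space" and B: "B \<in> sets seq_space"
    and T: "\<And>k X Y. (\<And>i. i \<le> k \<Longrightarrow> X i = Y i) \<Longrightarrow> T k X \<Longrightarrow> T k Y"
    and bound: "\<And>k x. T k x \<Longrightarrow> d * measure M (cyl k x) \<le> measure M (cyl k x \<inter> reroot k -` G)"
    and success: "\<And>k X. k \<ge> start \<Longrightarrow> T k X \<Longrightarrow> reroot k X \<in> G \<Longrightarrow> X \<in> B"
  shows "AE X in M. (\<exists>\<^sub>\<infinity>k. T k X) \<longrightarrow> X \<in> B"
proof -
  interpret finite_measure M by fact
  have space: "space M = UNIV" using sets_eq_imp_space_eq[OF sets] by simp
  have det: "determined k {X. T k X}" for k unfolding determined_def using T by blast
  have Tsets: "{X. T k X} \<in> sets M" for k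
    using determined_sets[OF det] sets by blast
  define A where "A = {X. \<exists>\<^sub>\<infinity>k. T k X} - B"
  have A: "A \<in> sets M"
  proof -
    have "{X. \<exists>\<^sub>\<infinity>k. T k X} = (\<Inter>n. \<Union>k\<in>{n..}. {X. T k X})"
      by (auto simp: INFM_nat_le)
    also have "\<dots> \<in> sets M" using Tsets by (intro sets.countable_INT' sets.countable_UN') auto
    finally show ?thesis using B sets by (auto simp: A_def)
  qed
  have "measure M A = 0"
  proof (rule ccontr)
    assume "measure M A \<noteq> 0"
    then have a: "measure M A > 0" by (simp add: zero_less_measure_iff)
    \<comment> \<open>The constant solves \<open>d * (measure M A - e) = e\<close>. Up to
      \<open>e\<close>, the paths in \<open>A\<close> lie in \<open>C\<close> and make a trial after
      \<open>m\<close>; at least a fraction \<open>d\<close> of the paths in \<open>C\<close> with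
      such a trial succeed, and success puts them into \<open>C \<inter> B\<close>, which has
      measure below \<open>e\<close>.\<close>
    define e where "e = d * measure M A / (1 + d)"
    have e: "e > 0" using a d by (auto simp: e_def)
    have "- B \<in> sets seq_space" using sets.compl_sets[OF B] by (simp add: Compl_eq_Diff_UNIV)
    then obtain n C where C: "determined n C" "measure M (- B - C) < e" "measure M (C - - B) < e"
      using determined_approx[OF \<open>finite_measure M\<close> sets _ e] by blast
    define m where "m = max n start"
    have Cm: "determined m C" using determined_mono[OF C(1)] by (simp add: m_def)
    have Cs: "C \<in> sets M" using determined_sets[OF C(1)] sets by simp
    have Bs: "B \<in> sets M" using B sets by simp
    have BC: "- B - C \<in> sets M"
      using Bs Cs sets.Diff[OF sets.compl_sets[OF Bs] Cs] by (simp add: space Compl_eq_Diff_UNIV)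
    have T's: "{X. \<exists>k\<ge>m. T k X} \<in> sets M"
    proof -
      have "{X. \<exists>k\<ge>m. T k X} = (\<Union>k\<in>{m..}. {X. T k X})" by auto
      also have "\<dots> \<in> sets M" using Tsets by (intro sets.countable_UN') auto
      finally show ?thesis .
    qed
    have "d * measure M (C \<inter> {X. \<exists>k\<ge>m. T k X}) \<le>
        measure M (C \<inter> {X. \<exists>k\<ge>m. T k X \<and> reroot k X \<in> G})"
      using d by (intro first_time_bound[OF \<open>finite_measure M\<close> sets _ Cm G T bound]) auto
    also have "\<dots> \<le> measure M (C - - B)"
      using success Cs Bs by (intro finite_measure_mono) (auto simp: m_def)
    finally have 1: "d * measure M (C \<inter> {X. \<exists>k\<ge>m. T k X}) < e" using C(3) by simp
    have "A \<subseteq> (C \<inter> {X. \<exists>k\<ge>m. T k X}) \<union> (- B - C)"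
      by (auto simp: A_def INFM_nat_le)
    then have "measure M A \<le> measure M ((C \<inter> {X. \<exists>k\<ge>m. T k X}) \<union> (- B - C))"
      using T's Cs BC by (intro finite_measure_mono) auto
    also have "\<dots> \<le> measure M (C \<inter> {X. \<exists>k\<ge>m. T k X}) + measure M (- B - C)"
      using T's Cs BC by (intro measure_Un_le) auto
    finally have "measure M A - e < measure M (C \<inter> {X. \<exists>k\<ge>m. T k X})" using C(2) by simp
    then have "d * (measure M A - e) < e" using 1 d by (meson mult_strict_left_mono less_trans)
    moreover have "d * (measure M A - e) = e" using d by (simp add: e_def field_simps)
    ultimately show False by simp
  qed
  then have "A \<in> null_sets M" using A by (simp add: null_sets_def emeasure_eq_measure)
  then have "AE X in M. X \<notin> A" by (rule AE_not_in)
  then show ?thesis unfolding A_def by eventually_elim blast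
qed

subsection \<open>The walk in a fixed environment\<close>

lemma path_space_eq_seq_space: "path_space = seq_space"
  by (simp add: path_space_def seq_space_def)

lemma UNIV_seq_space [simp]: "UNIV \<in> sets seq_space"
  using sets.top[of seq_space] by simp

definition valid_env :: "(int ^ 'd \<Rightarrow> (int ^ 'd) measure) \<Rightarrow> bool" where
  "valid_env \<omega> \<longleftrightarrow> (\<forall>x. \<omega> x \<in> space step_laws)"

definition env_shift :: "int ^ 'd \<Rightarrow> (int ^ 'd \<Rightarrow> 'b) \<Rightarrow> int ^ 'd \<Rightarrow> 'b" where
  "env_shift y \<omega> = (\<lambda>x. \<omega> (y + x))"

lemma valid_env_shift [simp]: "valid_env \<omega> \<Longrightarrow> valid_env (env_shift y \<omega>)"
  by (simp add: valid_env_def env_shift_def)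

lemma env_shift_env_shift: "env_shift z (env_shift y \<omega>) = env_shift (y + z) \<omega>"
  by (simp add: env_shift_def add.assoc)

lemma env_shift_0 [simp]: "env_shift 0 \<omega> = \<omega>"
  by (simp add: env_shift_def)

lemma prob_space_quenched: "valid_env \<omega> \<Longrightarrow> prob_space (quenched_law \<omega>)"
  by (simp add: valid_env_def prob_space_quenched_law)

lemma sets_quenched [simp]: "valid_env \<omega> \<Longrightarrow> sets (quenched_law \<omega>) = sets seq_space"
  by (simp add: valid_env_def sets_quenched_law path_space_eq_seq_space)

lemma space_quenched [simp]: "valid_env \<omega> \<Longrightarrow> space (quenched_law \<omega>) = UNIV"
  using sets_eq_imp_space_eq[OF sets_quenched] by simp

lemma measure_quenched_cyl:
  "valid_env \<omega> \<Longrightarrow> measure (quenched_law \<omega>) (cyl n x) =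
    (if x 0 = 0 then \<Prod>i<n. measure (\<omega> (x i)) {x (Suc i) - x i} else 0)"
  unfolding cyl_def by (rule quenched_law_cylinder) (simp add: valid_env_def)

lemma emeasure_quenched: "valid_env \<omega> \<Longrightarrow> emeasure (quenched_law \<omega>) A = ennreal (measure (quenched_law \<omega>) A)"
  by (simp add: prob_space_quenched finite_measure.emeasure_eq_measure prob_space.finite_measure)

lemma prod_lessThan_add:
  fixes f :: "nat \<Rightarrow> 'a::comm_monoid_mult"
  shows "(\<Prod>i<k + n. f i) = (\<Prod>i<k. f i) * (\<Prod>i<n. f (k + i))"
  by (induction n) (simp_all add: mult.assoc)

text \<open>As functions of \<open>A\<close> both sides are finite measures, and on cylinders the
  product formula for the concatenated path splits at time \<open>k\<close>.\<close>

lemma quenched_markov: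
  fixes \<omega> :: "int ^ 'd \<Rightarrow> (int ^ 'd) measure"
  assumes \<omega>: "valid_env \<omega>" and A: "A \<in> sets seq_space"
  shows "measure (quenched_law \<omega>) (cyl k x \<inter> reroot k -` A) =
    measure (quenched_law \<omega>) (cyl k x) * measure (quenched_law (env_shift (x k) \<omega>)) A"
proof -
  let ?Q = "quenched_law \<omega>" and ?Q' = "quenched_law (env_shift (x k) \<omega>)"
  interpret Q: prob_space ?Q by (rule prob_space_quenched[OF \<omega>])
  interpret Q': prob_space ?Q' by (rule prob_space_quenched) (simp add: \<omega>)
  define w where "w = measure ?Q (cyl k x)"
  define M where "M = distr (density ?Q (indicator (cyl k x))) seq_space (reroot k)"
  define N where "N = scale_measure (ennreal w) ?Q'"
  have cyl: "cyl k x \<in> sets ?Q" using \<omega> by simp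
  have reroot: "reroot k \<in> density ?Q (indicator (cyl k x)) \<rightarrow>\<^sub>M seq_space"
    using measurable_reroot \<omega> by (simp cong: measurable_cong_sets)
  have M: "emeasure M B = emeasure ?Q (cyl k x \<inter> reroot k -` B)" if "B \<in> sets seq_space" for B
    unfolding M_def emeasure_distr[OF reroot that]
    by (subst emeasure_restricted[OF cyl]) (use that \<omega> in auto)
  have N: "emeasure N B = ennreal w * emeasure ?Q' B" for B
    by (simp add: N_def)
  have "M = N"
  proof (rule measure_eqI_cyl)
    show "sets M = sets seq_space" "sets N = sets seq_space"
      using \<omega> by (simp_all add: M_def N_def)
    show "finite_measure M"
    proof (rule finite_measureI)
      have "space M \<in> sets seq_space" by (auto simp: M_def)
      then show "emeasure M (space M) \<noteq> \<infinity>" by (simp add: M Q.emeasure_finite)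
    qed
    show "finite_measure N"
      by (rule finite_measureI) (simp add: N Q'.emeasure_eq_measure ennreal_mult_eq_top_iff)
    fix n and z :: "nat \<Rightarrow> int ^ 'd"
    have "emeasure M (cyl n z) = ennreal (measure ?Q (cyl k x \<inter> reroot k -` cyl n z))"
      by (simp add: M Q.emeasure_eq_measure)
    also have "measure ?Q (cyl k x \<inter> reroot k -` cyl n z) = w * measure ?Q' (cyl n z)"
    proof (cases "z 0 = 0")
      case False
      then have "reroot k -` cyl n z = {}" by (force simp: cyl_def reroot_def)
      then show ?thesis using False \<omega> by (simp add: measure_quenched_cyl)
    next
      case True
      \<comment> \<open>The concatenation of \<open>x\<close> up to time \<open>k\<close> with
        \<open>z\<close> moved to \<open>x k\<close>; the pieces fit together because
        \<open>z 0 = 0\<close>.\<close>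
      define y where "y = (\<lambda>i. if i \<le> k then x i else x k + z (i - k))"
      have y: "y (k + i) = x k + z i" for i using True by (simp add: y_def)
      have "cyl k x \<inter> reroot k -` cyl n z = cyl (k + n) y"
      proof (intro equalityI subsetI)
        fix X assume X: "X \<in> cyl k x \<inter> reroot k -` cyl n z"
        have "X i = y i" if "i \<le> k + n" for i
        proof (cases "i \<le> k")
          case False
          then have "reroot k X (i - k) = z (i - k)" using X that by (simp add: cyl_def)
          then show ?thesis using False X by (auto simp: cyl_def reroot_def y_def algebra_simps)
        qed (use X in \<open>simp add: cyl_def y_def\<close>)
        then show "X \<in> cyl (k + n) y" by (simp add: cyl_def)
      next
        fix X assume X: "X \<in> cyl (k + n) y"
        have "X i = x i" if "i \<le> k" for i using X that by (simp add: cyl_def y_def)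
        moreover have "X (k + i) = x k + z i" if "i \<le> n" for i using X that y by (simp add: cyl_def)
        ultimately show "X \<in> cyl k x \<inter> reroot k -` cyl n z" by (simp add: cyl_def reroot_def)
      qed
      moreover have "y 0 = x 0" by (simp add: y_def)
      moreover have "(\<Prod>i<k. measure (\<omega> (y i)) {y (Suc i) - y i}) =
          (\<Prod>i<k. measure (\<omega> (x i)) {x (Suc i) - x i})"
        by (intro prod.cong) (auto simp: y_def)
      moreover have "measure (\<omega> (y (k + i))) {y (Suc (k + i)) - y (k + i)} =
          measure (env_shift (x k) \<omega> (z i)) {z (Suc i) - z i}" for i
        using y[of i] y[of "Suc i"] by (simp add: env_shift_def)
      ultimately show ?thesis
        using \<omega> True by (simp add: w_def measure_quenched_cyl prod_lessThan_add)
    qed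
    finally show "emeasure M (cyl n z) = emeasure N (cyl n z)"
      by (simp add: N Q'.emeasure_eq_measure ennreal_mult w_def)
  qed
  then have "ennreal (measure ?Q (cyl k x \<inter> reroot k -` A)) = ennreal (w * measure ?Q' A)"
    using M[OF A] N[of A] by (simp add: Q.emeasure_eq_measure Q'.emeasure_eq_measure ennreal_mult w_def)
  then show ?thesis by (simp add: w_def)
qed

text \<open>The quenched probability of \<open>A\<close> is a function of the environment in
  \<open>H\<close>. Such functions for disjoint regions are independent under
  \<open>env_law \<mu>\<close>, and all independence in the proof comes from this.\<close>

definition env_local :: "(int ^ 'd) set \<Rightarrow> (nat \<Rightarrow> int ^ 'd) set \<Rightarrow> bool" where
  "env_local H A \<longleftrightarrow> (\<forall>\<omega> \<omega>'. valid_env \<omega> \<longrightarrow> valid_env \<omega>' \<longrightarrow> (\<forall>z\<in>H. \<omega> z = \<omega>' z) \<longrightarrow>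
    measure (quenched_law \<omega>) A = measure (quenched_law \<omega>') A)"

lemma quenched_cyl_cong:
  assumes "valid_env \<omega>" "valid_env \<omega>'" and "\<And>i. i < n \<Longrightarrow> \<omega> (x i) = \<omega>' (x i)"
  shows "measure (quenched_law \<omega>) (cyl n x) = measure (quenched_law \<omega>') (cyl n x)"
  using assms by (auto simp: measure_quenched_cyl intro!: prod.cong)

text \<open>All prefixes of paths in \<open>A\<close> run inside \<open>H\<close>, and the
  probability of such a cylinder reads the environment only there.\<close>

lemma env_local_stay:
  fixes A :: "(nat \<Rightarrow> int ^ 'd) set"
  assumes A: "A \<in> sets seq_space" and H: "\<And>X n. X \<in> A \<Longrightarrow> X n \<in> H"
  shows "env_local H A"
  unfolding env_local_def
proof (intro allI impI)
  fix \<omega> \<omega>' :: "int ^ 'd \<Rightarrow> (int ^ 'd) measure"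
  assume *: "valid_env \<omega>" "valid_env \<omega>'" "\<forall>z\<in>H. \<omega> z = \<omega>' z"
  have "emeasure (quenched_law \<omega>) A = emeasure (quenched_law \<omega>') A"
  proof (rule emeasure_eq_on_related[where R="\<lambda>a _. a \<in> H"])
    fix n and x :: "nat \<Rightarrow> int ^ 'd"
    assume x: "\<And>i j. i \<le> n \<Longrightarrow> j \<le> n \<Longrightarrow> x i \<in> H"
    have "measure (quenched_law \<omega>) (cyl n x) = measure (quenched_law \<omega>') (cyl n x)"
      by (rule quenched_cyl_cong[OF *(1,2)]) (use *(3) x[of _ n] in auto)
    then show "emeasure (quenched_law \<omega>) (cyl n x) = emeasure (quenched_law \<omega>') (cyl n x)"
      using * by (simp add: emeasure_quenched)
  qed (use A H * in \<open>auto simp: prob_space_quenched prob_space.finite_measure\<close>)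
  then show "measure (quenched_law \<omega>) A = measure (quenched_law \<omega>') A"
    by (simp add: measure_def)
qed

lemma env_local_first_step: "env_local {0} (cyl 1 (\<lambda>i. if i = 0 then 0 else e))"
  by (auto simp: env_local_def measure_quenched_cyl)

definition nn_paths :: "(nat \<Rightarrow> int ^ 'd) set" where
  "nn_paths = {X. X 0 = 0 \<and> (\<forall>n. X (Suc n) - X n \<in> unit_vectors)}"

lemma step_law_outside:
  assumes "p \<in> space step_laws" "e \<notin> unit_vectors"
  shows "measure p {e} = 0"
proof -
  have "sets p = sets (count_space unit_vectors)"
    using assms(1) by (auto simp: step_laws_def space_prob_algebra)
  \<comment> \<open>A measure has the value 0 on sets outside its \<sigma>-algebra, which here
    consists of subsets of \<open>unit_vectors\<close>.\<close>
  then show ?thesis using assms(2) by (intro measure_notin_sets) auto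
qed

lemma quenched_cyl_pos_steps:
  assumes \<omega>: "valid_env \<omega>" and "measure (quenched_law \<omega>) (cyl n x) \<noteq> 0"
  shows "x 0 = 0" "i < n \<Longrightarrow> x (Suc i) - x i \<in> unit_vectors"
proof -
  have *: "x 0 = 0" "(\<Prod>i<n. measure (\<omega> (x i)) {x (Suc i) - x i}) \<noteq> 0"
    using assms by (auto simp: measure_quenched_cyl split: if_splits)
  then show "x 0 = 0" by simp
  assume "i < n"
  with *(2) have "measure (\<omega> (x i)) {x (Suc i) - x i} \<noteq> 0" by auto
  then show "x (Suc i) - x i \<in> unit_vectors"
    using step_law_outside \<omega> by (auto simp: valid_env_def)
qed

lemma nn_paths_sets [measurable]: "nn_paths \<in> sets (seq_space :: (nat \<Rightarrow> int ^ 'd) measure)"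
proof -
  have eq: "(nn_paths :: (nat \<Rightarrow> int ^ 'd) set) = (\<Inter>n. {X. X 0 = 0 \<and> X (Suc n) - X n \<in> unit_vectors})"
    by (auto simp: nn_paths_def)
  have "{X. X 0 = 0 \<and> X (Suc n) - X n \<in> unit_vectors} \<in> sets (seq_space :: (nat \<Rightarrow> int ^ 'd) measure)" for n
    by (rule determined_sets[of "Suc n"]) (simp add: determined_def)
  then show ?thesis unfolding eq by (intro sets.countable_INT) auto
qed

lemma quenched_nn_paths:
  assumes \<omega>: "valid_env \<omega>"
  shows "measure (quenched_law \<omega>) nn_paths = 1"
proof -
  interpret prob_space "quenched_law \<omega>" by (rule prob_space_quenched[OF \<omega>])
  have null: "AE X in quenched_law \<omega>. X 0 = 0 \<and> X (Suc n) - X n \<in> unit_vectors" for n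
  proof -
    define D where "D = {X :: nat \<Rightarrow> int ^ 'a. \<not> (X 0 = 0 \<and> X (Suc n) - X n \<in> unit_vectors)}"
    have D: "determined (Suc n) D" by (simp add: D_def determined_def)
    \<comment> \<open>Comparison with the null measure reduces the nullity of \<open>D\<close> to
      that of the cylinders in it.\<close>
    have "emeasure (quenched_law \<omega>) D = emeasure (null_measure seq_space) D"
    proof (rule emeasure_eq_on_determined[OF _ _ D])
      fix x assume "x \<in> D"
      then have "measure (quenched_law \<omega>) (cyl (Suc n) x) = 0"
        using quenched_cyl_pos_steps[OF \<omega>, of "Suc n" x] by (auto simp: D_def)
      then show "emeasure (quenched_law \<omega>) (cyl (Suc n) x) =
          emeasure (null_measure seq_space) (cyl (Suc n) x)"
        by (simp add: emeasure_eq_measure)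
    qed (simp_all add: \<omega>)
    then have "D \<in> null_sets (quenched_law \<omega>)"
      using determined_sets[OF D] \<omega> by (simp add: null_sets_def)
    from AE_not_in[OF this] show ?thesis by (simp add: D_def)
  qed
  have "AE X in quenched_law \<omega>. \<forall>n. X 0 = 0 \<and> X (Suc n) - X n \<in> unit_vectors"
    unfolding AE_all_countable using null ..
  then have "AE X in quenched_law \<omega>. X \<in> nn_paths"
    by (simp add: nn_paths_def)
  then show ?thesis using prob_eq_1 \<omega> by simp
qed

lemma real_vec_simps [simp]:
  "real_vec 0 = 0" "real_vec (x + y) = real_vec x + real_vec y"
  "real_vec (x - y) = real_vec x - real_vec y" "real_vec (- x) = - real_vec x"
  by (simp_all add: real_vec_def vec_eq_iff)

lemma norm_unit_vector: "e \<in> unit_vectors \<Longrightarrow> norm (real_vec e) = 1"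
proof -
  have *: "real_vec (axis i 1) = axis i 1" for i :: 'a
    by (simp add: real_vec_def vec_eq_iff axis_def)
  assume "e \<in> unit_vectors"
  then obtain i where "e = axis i 1 \<or> e = - axis i 1" by (auto simp: unit_vectors_def)
  then show ?thesis by (auto simp: *)
qed

lemma norm_nn_path:
  assumes "x 0 = 0" "\<And>i. i < n \<Longrightarrow> x (Suc i) - x i \<in> unit_vectors" "i \<le> n"
  shows "norm (real_vec (x i)) \<le> real i"
  using assms(3)
proof (induction i)
  case (Suc i)
  have "real_vec (x (Suc i)) = real_vec (x i) + real_vec (x (Suc i) - x i)" by simp
  then have "norm (real_vec (x (Suc i))) \<le> norm (real_vec (x i)) + norm (real_vec (x (Suc i) - x i))"
    by (metis norm_triangle_ineq)
  then show ?case using Suc norm_unit_vector[OF assms(2)[of i]] by simp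
qed (simp add: assms(1))

text \<open>Up to time \<open>n\<close> the walk stays within distance \<open>n\<close> of 0.
  Cylinders that leave this ball require an impossible start or step and have probability 0 in every
  environment.\<close>

lemma env_local_determined:
  assumes C: "determined n C"
  shows "env_local {z. norm (real_vec z) \<le> real n} C"
  unfolding env_local_def
proof (intro allI impI)
  fix \<omega> \<omega>' :: "int ^ 'a \<Rightarrow> (int ^ 'a) measure"
  assume *: "valid_env \<omega>" "valid_env \<omega>'" "\<forall>z\<in>{z. norm (real_vec z) \<le> real n}. \<omega> z = \<omega>' z"
  have "emeasure (quenched_law \<omega>) C = emeasure (quenched_law \<omega>') C"
  proof (rule emeasure_eq_on_determined[OF _ _ C])
    fix x :: "nat \<Rightarrow> int ^ 'a"
    have "measure (quenched_law \<omega>) (cyl n x) = measure (quenched_law \<omega>') (cyl n x)"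
    proof (cases "\<forall>i\<le>n. norm (real_vec (x i)) \<le> real n")
      case True
      then show ?thesis using * by (intro quenched_cyl_cong) auto
    next
      case False
      have "measure (quenched_law \<omega>) (cyl n x) = 0" if "valid_env \<omega>" for \<omega>
      proof (rule ccontr)
        assume "\<not> ?thesis"
        note pos = quenched_cyl_pos_steps[OF that this]
        have "norm (real_vec (x i)) \<le> real n" if "i \<le> n" for i
          using norm_nn_path[OF pos that] that by simp
        with False show False by blast
      qed
      then show ?thesis using * by simp
    qed
    then show "emeasure (quenched_law \<omega>) (cyl n x) = emeasure (quenched_law \<omega>') (cyl n x)"
      using * by (simp add: emeasure_quenched)
  qed (use * in auto)
  then show "measure (quenched_law \<omega>) C = measure (quenched_law \<omega>') C"
    by (simp add: measure_def)
qed

section \<open>Visited sites and the quenched probabilities seen from them\<close>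

lemma measurable_site_property:
  fixes P :: "int ^ 'd \<Rightarrow> bool"
  shows "{X. \<exists>k\<ge>m. P (X k)} \<in> sets seq_space"
proof -
  have "determined k {X. P (X k)}" for k by (simp add: determined_def)
  then have "{X. P (X k)} \<in> sets seq_space" for k by (rule determined_sets)
  then have "(\<Union>k\<in>{m..}. {X. P (X k)}) \<in> sets seq_space" by (intro sets.countable_UN') auto
  moreover have "{X. \<exists>k\<ge>m. P (X k)} = (\<Union>k\<in>{m..}. {X. P (X k)})" by auto
  ultimately show ?thesis by simp
qed

text \<open>Stop at the first visited site from which \<open>A\<close> has probability below
  \<epsilon>. As \<open>A\<close> is invariant under \<open>reroot\<close>, it then fails with
  conditional probability at least 1 - \<epsilon>.\<close>

lemma quenched_low_visit:
  assumes \<omega>: "valid_env \<omega>" and A: "A \<in> sets seq_space" "\<And>k X. reroot k X \<in> A \<longleftrightarrow> X \<in> A"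
    and "0 < \<epsilon>" "\<epsilon> < 1"
  shows "measure (quenched_law \<omega>)
    (A \<inter> {X. \<exists>k. measure (quenched_law (env_shift (X k) \<omega>)) A < \<epsilon>}) \<le> \<epsilon>"
proof -
  let ?Q = "quenched_law \<omega>"
  interpret prob_space ?Q by (rule prob_space_quenched[OF \<omega>])
  define h where "h z = measure (quenched_law (env_shift z \<omega>)) A" for z
  define V where "V = {X. \<exists>k::nat. h (X k) < \<epsilon>}"
  have V: "V \<in> sets ?Q"
    using measurable_site_property[of 0 "\<lambda>z. h z < \<epsilon>"] \<omega> by (simp add: V_def)
  have As: "A \<in> sets ?Q" using A \<omega> by simp
  have Ac: "- A \<in> sets seq_space"
    using sets.compl_sets[OF A(1)] by (simp add: Compl_eq_Diff_UNIV)
  have "(1 - \<epsilon>) * measure ?Q (UNIV \<inter> {X. \<exists>k\<ge>0. h (X k) < \<epsilon>}) \<le>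
      measure ?Q (UNIV \<inter> {X. \<exists>k\<ge>0. h (X k) < \<epsilon> \<and> reroot k X \<in> - A})"
  proof (rule first_time_bound)
    fix k :: nat and x assume "h (x k) < \<epsilon>"
    have "measure (quenched_law (env_shift (x k) \<omega>)) (- A) = 1 - h (x k)"
    proof -
      interpret Q': prob_space "quenched_law (env_shift (x k) \<omega>)"
        by (rule prob_space_quenched) (simp add: \<omega>)
      show ?thesis using Q'.prob_compl[of A] A \<omega> by (simp add: h_def Compl_eq_Diff_UNIV)
    qed
    then have "measure ?Q (cyl k x \<inter> reroot k -` (- A)) = measure ?Q (cyl k x) * (1 - h (x k))"
      by (simp add: quenched_markov[OF \<omega> Ac])
    then show "(1 - \<epsilon>) * measure ?Q (cyl k x) \<le> measure ?Q (cyl k x \<inter> reroot k -` (- A))"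
      using \<open>h (x k) < \<epsilon>\<close> by (simp add: mult_right_mono mult.commute[of _ "1 - h (x k)"])
  qed (use \<omega> assms Ac in \<open>auto simp: determined_def\<close>)
  then have 1: "(1 - \<epsilon>) * measure ?Q V \<le> measure ?Q (V - A)"
  proof -
    have "UNIV \<inter> {X. \<exists>k\<ge>0. h (X k) < \<epsilon> \<and> reroot k X \<in> - A} = V - A"
      using A(2) by (auto simp: V_def)
    then show ?thesis using \<open>(1 - \<epsilon>) * _ \<le> _\<close> by (simp add: V_def)
  qed
  have "measure ?Q (A \<inter> V) = measure ?Q V - measure ?Q (V - A)"
    using V As by (simp add: finite_measure_Diff' Int_commute)
  also have "\<dots> \<le> \<epsilon> * measure ?Q V" using 1 by (simp add: algebra_simps)
  also have "\<dots> \<le> \<epsilon>" using \<open>0 < \<epsilon>\<close> by simp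
  finally show ?thesis by (simp add: V_def h_def)
qed

text \<open>\<open>C\<close> stands for a finite-time approximation of \<open>- A\<close>. Stop at
  the first visit after time \<open>m\<close> to a site from which \<open>A\<close> has probability
  at least \<epsilon>: at least a fraction \<epsilon> of the paths in \<open>C\<close> with such a
  visit end up in \<open>C \<inter> A\<close>, so these paths are rare. The bound is kept quenched;
  it becomes small only on average over the environment.\<close>

lemma quenched_high_visit:
  assumes \<omega>: "valid_env \<omega>" and A: "A \<in> sets seq_space" "\<And>k X. reroot k X \<in> A \<longleftrightarrow> X \<in> A"
    and C: "determined m C" and "0 < \<epsilon>"
  shows "measure (quenched_law \<omega>)
    ({X. \<exists>k\<ge>m. \<epsilon> \<le> measure (quenched_law (env_shift (X k) \<omega>)) A} - A) \<le>
    measure (quenched_law \<omega>) (- A - C) + measure (quenched_law \<omega>) (C - - A) / \<epsilon>"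
proof -
  let ?Q = "quenched_law \<omega>"
  interpret prob_space ?Q by (rule prob_space_quenched[OF \<omega>])
  define h where "h z = measure (quenched_law (env_shift z \<omega>)) A" for z
  define V where "V = {X. \<exists>k\<ge>m. \<epsilon> \<le> h (X k)}"
  have V: "V \<in> sets ?Q"
    using measurable_site_property[of m "\<lambda>z. \<epsilon> \<le> h z"] \<omega> by (simp add: V_def)
  have As: "A \<in> sets ?Q" using A \<omega> by simp
  have Cs: "C \<in> sets ?Q" using determined_sets[OF C] \<omega> by simp
  have Ac: "- A \<in> sets ?Q"
    using sets.compl_sets[OF A(1)] \<omega> by (simp add: Compl_eq_Diff_UNIV)
  have "\<epsilon> * measure ?Q (C \<inter> V) \<le> measure ?Q (C \<inter> {X. \<exists>k\<ge>m. \<epsilon> \<le> h (X k) \<and> reroot k X \<in> A})"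
    unfolding V_def
  proof (rule first_time_bound)
    fix k :: nat and x assume "\<epsilon> \<le> h (x k)"
    then show "\<epsilon> * measure ?Q (cyl k x) \<le> measure ?Q (cyl k x \<inter> reroot k -` A)"
      by (simp add: quenched_markov[OF \<omega> A(1)] h_def mult.commute[of \<epsilon>] mult_left_mono)
  qed (use \<omega> assms in auto)
  also have "\<dots> \<le> measure ?Q (C - - A)"
    using Cs As Ac by (intro finite_measure_mono) (auto simp: A(2))
  finally have 1: "measure ?Q (C \<inter> V) \<le> measure ?Q (C - - A) / \<epsilon>"
    using \<open>0 < \<epsilon>\<close> by (simp add: field_simps)
  have "measure ?Q (V - A) \<le> measure ?Q ((- A - C) \<union> (C \<inter> V))"
    using V Cs Ac by (intro finite_measure_mono) auto
  also have "\<dots> \<le> measure ?Q (- A - C) + measure ?Q (C \<inter> V)"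
    using V Cs Ac by (intro measure_Un_le) auto
  finally show ?thesis using 1 by (simp add: V_def h_def)
qed

subsection \<open>The annealed walk\<close>

locale iid_env =
  fixes \<mu> :: "(int ^ 'd) measure measure"
  assumes prob_\<mu>: "prob_space \<mu>" and sets_\<mu>: "sets \<mu> = sets step_laws"
begin

abbreviation "env \<equiv> env_law \<mu>"
abbreviation "law \<equiv> annealed_law \<mu>"

lemma prob_space_env: "prob_space env"
  by (simp add: env_law_def prob_space_PiM prob_\<mu>)

lemma prob_space_law: "prob_space law"
  by (rule prob_space_annealed_law[OF prob_\<mu> sets_\<mu>])

lemma sets_env: "sets env = sets (\<Pi>\<^sub>M x\<in>UNIV. step_laws)"
  unfolding env_law_def by (rule sets_PiM_cong) (auto simp: sets_\<mu>)

lemma sets_law [simp]: "sets law = sets seq_space"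
  by (simp add: sets_annealed_law[OF prob_\<mu> sets_\<mu>] path_space_eq_seq_space)

lemma space_law [simp]: "space law = UNIV"
  using sets_eq_imp_space_eq[OF sets_law] by simp

lemma valid_env: "\<omega> \<in> space env \<Longrightarrow> valid_env \<omega>"
  using space_env_imp[OF _ sets_\<mu>] by (auto simp: valid_env_def)

lemma env_shift_measurable [measurable]: "env_shift y \<in> env \<rightarrow>\<^sub>M env"
proof -
  have "(\<lambda>\<omega>. \<lambda>x\<in>UNIV. \<omega> (y + x)) \<in> env \<rightarrow>\<^sub>M env"
    unfolding env_law_def by (intro measurable_restrict measurable_component_singleton) auto
  then show ?thesis by (simp add: env_shift_def[abs_def] restrict_def)
qed

lemma distr_env_shift: "distr env env (env_shift y) = env"
proof -
  have "distr (PiM UNIV (\<lambda>_. \<mu>)) (\<Pi>\<^sub>M i\<in>UNIV. \<mu>) (\<lambda>\<omega>. \<lambda>x\<in>UNIV. \<omega> (y + x)) = (\<Pi>\<^sub>M i\<in>UNIV. \<mu>)"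
    by (rule distr_PiM_reindex[where M="\<lambda>_. \<mu>"]) (auto simp: prob_\<mu>)
  then show ?thesis by (simp add: env_law_def env_shift_def[abs_def] restrict_def)
qed

lemma quenched_measurable [measurable]: "quenched_law \<in> env \<rightarrow>\<^sub>M prob_algebra seq_space"
  using quenched_law_measurable by (simp add: path_space_eq_seq_space cong: measurable_cong_sets[OF sets_env])

lemma quenched_prob_measurable:
  "A \<in> sets seq_space \<Longrightarrow> (\<lambda>\<omega>. measure (quenched_law \<omega>) A) \<in> borel_measurable env"
  by (rule measurable_compose[OF quenched_measurable measurable_measure_prob_algebra])

lemma quenched_shift_prob_measurable:
  "A \<in> sets seq_space \<Longrightarrow> (\<lambda>\<omega>. measure (quenched_law (env_shift y \<omega>)) A) \<in> borel_measurable env"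
  by (rule measurable_compose[OF env_shift_measurable quenched_prob_measurable])

lemma quenched_prob_le_1: "\<omega> \<in> space env \<Longrightarrow> measure (quenched_law (env_shift y \<omega>)) A \<le> 1"
  using valid_env prob_space_quenched[of "env_shift y \<omega>"] by (simp add: prob_space.prob_le_1)

lemma integrable_bounded:
  assumes "f \<in> borel_measurable env" "\<And>\<omega>. \<omega> \<in> space env \<Longrightarrow> 0 \<le> f \<omega> \<and> f \<omega> \<le> (1::real)"
  shows "integrable env f"
proof -
  interpret prob_space env by (rule prob_space_env)
  show ?thesis using assms by (intro integrable_const_bound[where B=1]) auto
qed

lemma integrable_quenched_shift:
  "A \<in> sets seq_space \<Longrightarrow> integrable env (\<lambda>\<omega>. measure (quenched_law (env_shift y \<omega>)) A)"
  by (intro integrable_bounded quenched_shift_prob_measurable) (auto intro: quenched_prob_le_1)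

lemma integrable_quenched:
  "A \<in> sets seq_space \<Longrightarrow> integrable env (\<lambda>\<omega>. measure (quenched_law \<omega>) A)"
  using integrable_quenched_shift[of A 0] by simp

lemma measure_law:
  "A \<in> sets seq_space \<Longrightarrow> measure law A = (\<integral>\<omega>. measure (quenched_law \<omega>) A \<partial>env)"
  using measure_annealed_law[OF prob_\<mu> sets_\<mu>] by (simp add: path_space_eq_seq_space)

lemma measure_law_shift:
  assumes A: "A \<in> sets seq_space"
  shows "measure law A = (\<integral>\<omega>. measure (quenched_law (env_shift y \<omega>)) A \<partial>env)"
proof -
  have "measure law A = (\<integral>\<omega>. measure (quenched_law \<omega>) A \<partial>distr env env (env_shift y))"
    by (simp add: measure_law[OF A] distr_env_shift)
  also have "\<dots> = (\<integral>\<omega>. measure (quenched_law (env_shift y \<omega>)) A \<partial>env)"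
    by (intro integral_distr env_shift_measurable quenched_prob_measurable A)
  finally show ?thesis .
qed

lemma env_independent:
  fixes f g :: "(int ^ 'd \<Rightarrow> (int ^ 'd) measure) \<Rightarrow> real"
  assumes f: "f \<in> borel_measurable env" "\<And>\<omega>. \<omega> \<in> space env \<Longrightarrow> 0 \<le> f \<omega> \<and> f \<omega> \<le> 1"
    and g: "g \<in> borel_measurable env" "\<And>\<omega>. \<omega> \<in> space env \<Longrightarrow> 0 \<le> g \<omega> \<and> g \<omega> \<le> 1"
    and loc_f: "\<And>\<omega> \<omega>'. \<omega> \<in> space env \<Longrightarrow> \<omega>' \<in> space env \<Longrightarrow> (\<And>x. x \<in> J \<Longrightarrow> \<omega> x = \<omega>' x) \<Longrightarrow> f \<omega> = f \<omega>'"
    and loc_g: "\<And>\<omega> \<omega>'. \<omega> \<in> space env \<Longrightarrow> \<omega>' \<in> space env \<Longrightarrow> (\<And>x. x \<in> K \<Longrightarrow> \<omega> x = \<omega>' x) \<Longrightarrow> g \<omega> = g \<omega>'"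
    and JK: "J \<inter> K = {}"
  shows "(\<integral>\<omega>. f \<omega> * g \<omega> \<partial>env) = (\<integral>\<omega>. f \<omega> \<partial>env) * (\<integral>\<omega>. g \<omega> \<partial>env)"
proof -
  interpret prob_space env by (rule prob_space_env)
  obtain \<omega>0 where \<omega>0: "\<omega>0 \<in> space env" using not_empty by blast
  \<comment> \<open>Independence is available for the restrictions of the environment to
    \<open>J\<close> and \<open>K\<close>, whereas \<open>f\<close> and \<open>g\<close> take full
    environments. The missing coordinates are filled in from a fixed \<open>\<omega>0\<close>, which
    by locality does not change the values.\<close>
  define ext where "ext L w = (\<lambda>x. if x \<in> L then w x else \<omega>0 x)"
    for L :: "(int ^ 'd) set" and w :: "int ^ 'd \<Rightarrow> (int ^ 'd) measure"
  have ext: "ext L \<in> (\<Pi>\<^sub>M x\<in>L. \<mu>) \<rightarrow>\<^sub>M env" for L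
  proof -
    have "(\<lambda>w. \<lambda>x\<in>UNIV. ext L w x) \<in> (\<Pi>\<^sub>M x\<in>L. \<mu>) \<rightarrow>\<^sub>M (\<Pi>\<^sub>M x\<in>UNIV. \<mu>)"
    proof (rule measurable_restrict)
      fix x
      have "\<omega>0 x \<in> space \<mu>" using \<omega>0 by (auto simp: env_law_def space_PiM)
      then show "(\<lambda>w. ext L w x) \<in> (\<Pi>\<^sub>M x\<in>L. \<mu>) \<rightarrow>\<^sub>M \<mu>"
        by (cases "x \<in> L") (simp_all add: ext_def measurable_component_singleton)
    qed
    then show ?thesis by (simp add: env_law_def restrict_def)
  qed
  have coord: "indep_vars (\<lambda>_. \<mu>) (\<lambda>x \<omega>. \<omega> x) UNIV"
  proof (subst indep_vars_iff_distr_eq_PiM')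
    show "distr env (\<Pi>\<^sub>M i\<in>UNIV. \<mu>) (\<lambda>\<omega>. \<lambda>i\<in>UNIV. \<omega> i) = (\<Pi>\<^sub>M i\<in>UNIV. distr env \<mu> (\<lambda>\<omega>. \<omega> i))"
      by (simp add: env_law_def distr_PiM_component[OF prob_\<mu>] restrict_def)
  qed (auto simp: env_law_def)
  define RJ where "RJ = (\<lambda>\<omega>. restrict (\<lambda>i. \<omega> i :: (int ^ 'd) measure) J)"
  define RK where "RK = (\<lambda>\<omega>. restrict (\<lambda>i. \<omega> i :: (int ^ 'd) measure) K)"
  have "indep_var (\<Pi>\<^sub>M x\<in>J. \<mu>) RJ (\<Pi>\<^sub>M x\<in>K. \<mu>) RK"
    unfolding RJ_def RK_def by (rule indep_var_restrict[OF coord JK]) auto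
  then have ind: "indep_var borel ((f \<circ> ext J) \<circ> RJ) borel ((g \<circ> ext K) \<circ> RK)"
    by (rule indep_var_compose) (auto intro!: measurable_comp[OF ext] f g)
  have m: "RJ \<in> env \<rightarrow>\<^sub>M (\<Pi>\<^sub>M x\<in>J. \<mu>)" "RK \<in> env \<rightarrow>\<^sub>M (\<Pi>\<^sub>M x\<in>K. \<mu>)"
    unfolding RJ_def RK_def env_law_def by (auto intro!: measurable_restrict)
  have extR: "ext J (RJ \<omega>) \<in> space env" "ext K (RK \<omega>) \<in> space env" if "\<omega> \<in> space env" for \<omega>
    using measurable_space[OF ext] measurable_space[OF m(1) that] measurable_space[OF m(2) that] by auto
  have fe: "((f \<circ> ext J) \<circ> RJ) \<omega> = f \<omega>" if "\<omega> \<in> space env" for \<omega>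
    unfolding o_def by (rule loc_f[OF extR(1)[OF that] that]) (simp add: ext_def RJ_def)
  have ge: "((g \<circ> ext K) \<circ> RK) \<omega> = g \<omega>" if "\<omega> \<in> space env" for \<omega>
    unfolding o_def by (rule loc_g[OF extR(2)[OF that] that]) (simp add: ext_def RK_def)
  have "integrable env f" "integrable env g" using f g by (auto intro: integrable_bounded)
  then have "integrable env ((f \<circ> ext J) \<circ> RJ)" "integrable env ((g \<circ> ext K) \<circ> RK)"
    using fe ge by (auto cong: Bochner_Integration.integrable_cong simp del: o_apply)
  from indep_var_lebesgue_integral[OF ind this]
  have "(\<integral>\<omega>. ((f \<circ> ext J) \<circ> RJ) \<omega> * ((g \<circ> ext K) \<circ> RK) \<omega> \<partial>env) =
      (\<integral>\<omega>. ((f \<circ> ext J) \<circ> RJ) \<omega> \<partial>env) * (\<integral>\<omega>. ((g \<circ> ext K) \<circ> RK) \<omega> \<partial>env)" .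
  moreover have "(\<integral>\<omega>. ((f \<circ> ext J) \<circ> RJ) \<omega> * ((g \<circ> ext K) \<circ> RK) \<omega> \<partial>env) = (\<integral>\<omega>. f \<omega> * g \<omega> \<partial>env)"
    by (intro Bochner_Integration.integral_cong refl arg_cong2[where f="(*)"] fe ge)
  moreover have "(\<integral>\<omega>. ((f \<circ> ext J) \<circ> RJ) \<omega> \<partial>env) = (\<integral>\<omega>. f \<omega> \<partial>env)"
    by (intro Bochner_Integration.integral_cong refl fe)
  moreover have "(\<integral>\<omega>. ((g \<circ> ext K) \<circ> RK) \<omega> \<partial>env) = (\<integral>\<omega>. g \<omega> \<partial>env)"
    by (intro Bochner_Integration.integral_cong refl ge)
  ultimately show ?thesis by simp
qed

lemma quenched_independent:
  assumes A: "A \<in> sets seq_space" "env_local J A" and B: "B \<in> sets seq_space" "env_local K B"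
    and disj: "\<And>z. z \<in> K \<Longrightarrow> y + z \<notin> J"
  shows "(\<integral>\<omega>. measure (quenched_law \<omega>) A * measure (quenched_law (env_shift y \<omega>)) B \<partial>env) =
    measure law A * measure law B"
proof -
  have "(\<integral>\<omega>. measure (quenched_law \<omega>) A * measure (quenched_law (env_shift y \<omega>)) B \<partial>env) =
      (\<integral>\<omega>. measure (quenched_law \<omega>) A \<partial>env) * (\<integral>\<omega>. measure (quenched_law (env_shift y \<omega>)) B \<partial>env)"
  proof (rule env_independent)
    show "J \<inter> (+) y ` K = {}" using disj by auto
    show "measure (quenched_law \<omega>) A = measure (quenched_law \<omega>') A"
      if "\<omega> \<in> space env" "\<omega>' \<in> space env" "\<And>x. x \<in> J \<Longrightarrow> \<omega> x = \<omega>' x" for \<omega> \<omega>'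
      using A(2) that valid_env by (auto simp: env_local_def)
    show "measure (quenched_law (env_shift y \<omega>)) B = measure (quenched_law (env_shift y \<omega>')) B"
      if "\<omega> \<in> space env" "\<omega>' \<in> space env" "\<And>x. x \<in> (+) y ` K \<Longrightarrow> \<omega> x = \<omega>' x" for \<omega> \<omega>'
    proof -
      have "\<forall>z\<in>K. env_shift y \<omega> z = env_shift y \<omega>' z" using that(3) by (simp add: env_shift_def)
      then show ?thesis
        using B(2) valid_env_shift[OF valid_env[OF that(1)]] valid_env_shift[OF valid_env[OF that(2)]]
        unfolding env_local_def by blast
    qed
    show "0 \<le> measure (quenched_law \<omega>) A \<and> measure (quenched_law \<omega>) A \<le> 1" if "\<omega> \<in> space env" for \<omega>
      using quenched_prob_le_1[OF that, of 0 A] by simp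
    show "0 \<le> measure (quenched_law (env_shift y \<omega>)) B \<and> measure (quenched_law (env_shift y \<omega>)) B \<le> 1"
      if "\<omega> \<in> space env" for \<omega>
      using quenched_prob_le_1[OF that, of y B] by simp
  qed (use A B in \<open>auto intro: quenched_prob_measurable quenched_shift_prob_measurable\<close>)
  then show ?thesis
    by (simp add: measure_law[OF A(1)] measure_law_shift[OF B(1), of y])
qed

text \<open>The range stops before \<open>k\<close>: at time \<open>k\<close> the site
  \<open>x k\<close> has been reached, but the step from it has not been taken.\<close>

lemma env_local_cyl: "env_local (x ` {..<k}) (cyl k x)"
  unfolding env_local_def by (auto intro!: quenched_cyl_cong)

lemma law_cyl_reroot:
  assumes G: "G \<in> sets seq_space"
  shows "measure law (cyl k x \<inter> reroot k -` G) =
    (\<integral>\<omega>. measure (quenched_law \<omega>) (cyl k x) * measure (quenched_law (env_shift (x k) \<omega>)) G \<partial>env)"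
proof -
  have "cyl k x \<inter> reroot k -` G \<in> sets seq_space" using G by auto
  from measure_law[OF this] show ?thesis
    by (simp add: quenched_markov[OF valid_env G] cong: Bochner_Integration.integral_cong)
qed

text \<open>The substitute for the Markov property under the annealed law: the past reads the sites
  \<open>x i\<close> with \<open>i < k\<close>, the future event reads \<open>x k + H\<close>, and
  the environment is independent on these two sets. Used with a half-space \<open>H\<close> at
  records and with \<open>H = {0}\<close> at sites visited for the first time.\<close>

lemma law_fresh:
  assumes G: "G \<in> sets seq_space" "env_local H G" and fresh: "\<And>i. i < k \<Longrightarrow> x i - x k \<notin> H"
  shows "measure law (cyl k x \<inter> reroot k -` G) = measure law (cyl k x) * measure law G"
  unfolding law_cyl_reroot[OF G(1)]
proof (rule quenched_independent[OF _ env_local_cyl G])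
  fix z assume "z \<in> H"
  then show "x k + z \<notin> x ` {..<k}" using fresh by (auto simp: image_iff) (metis add_diff_cancel_left')
qed simp

text \<open>For a fixed prefix, the quenched probability of \<open>G\<close> from \<open>x k\<close>
  has mean \<open>measure law G = 0\<close> because the environment is stationary, and there are
  only countably many prefixes.\<close>

lemma law_reroot_null:
  assumes G: "G \<in> sets seq_space" and null: "measure law G = 0"
  shows "AE X in law. \<forall>k. reroot k X \<notin> G"
  unfolding AE_all_countable
proof
  fix k
  interpret prob_space law by (rule prob_space_law)
  have cyl_null: "measure law (cyl k x \<inter> reroot k -` G) = 0" for x
  proof -
    have "(\<integral>\<omega>. measure (quenched_law \<omega>) (cyl k x) * measure (quenched_law (env_shift (x k) \<omega>)) G \<partial>env) \<le>
        (\<integral>\<omega>. measure (quenched_law (env_shift (x k) \<omega>)) G \<partial>env)"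
    proof (rule integral_mono)
      show "integrable env (\<lambda>\<omega>. measure (quenched_law \<omega>) (cyl k x) * measure (quenched_law (env_shift (x k) \<omega>)) G)"
        using G quenched_prob_le_1[of _ 0 "cyl k x"] quenched_prob_le_1[of _ "x k" G]
        by (intro integrable_bounded borel_measurable_times quenched_prob_measurable
              quenched_shift_prob_measurable) (auto intro: mult_le_one)
      show "measure (quenched_law \<omega>) (cyl k x) * measure (quenched_law (env_shift (x k) \<omega>)) G
          \<le> measure (quenched_law (env_shift (x k) \<omega>)) G" if "\<omega> \<in> space env" for \<omega>
        using quenched_prob_le_1[OF that, of 0 "cyl k x"] by (simp add: mult_left_le_one_le)
    qed (rule integrable_quenched_shift[OF G])
    then show ?thesis
      unfolding law_cyl_reroot[OF G] using null measure_law_shift[OF G, of "x k"]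
      by (simp add: integral_nonneg_AE antisym)
  qed
  have "reroot k -` G = (\<Union>xs\<in>range (prefix_upto k). prefix_upto k -` {xs} \<inter> reroot k -` G)" by auto
  also have "\<dots> \<in> null_sets law"
  proof (rule null_sets_UN')
    fix xs assume "xs \<in> range (prefix_upto k :: (nat \<Rightarrow> int ^ 'd) \<Rightarrow> _)"
    then obtain x where "xs = prefix_upto k x" by auto
    then show "prefix_upto k -` {xs} \<inter> reroot k -` G \<in> null_sets law"
      using cyl_null[of x] G by (auto simp: null_sets_def emeasure_eq_measure simp flip: cyl_eq_vimage)
  qed simp
  finally have "AE X in law. X \<notin> reroot k -` G" by (rule AE_not_in)
  then show "AE X in law. reroot k X \<notin> G" by simp
qed

lemma law_nn_paths: "AE X in law. X \<in> nn_paths"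
proof -
  interpret prob_space law by (rule prob_space_law)
  interpret env: prob_space env by (rule prob_space_env)
  have "measure law nn_paths = (\<integral>\<omega>. 1 \<partial>env)"
    unfolding measure_law[OF nn_paths_sets]
    by (intro Bochner_Integration.integral_cong refl quenched_nn_paths valid_env)
  then have "measure law nn_paths = 1" by (simp add: env.prob_space)
  then show ?thesis using prob_eq_1[of nn_paths] by simp
qed

end

subsection \<open>Kalikow's zero-one law\<close>

definition elevation :: "real ^ 'd \<Rightarrow> int ^ 'd \<Rightarrow> real" where
  "elevation l x = real_vec x \<bullet> l"

lemma elevation_simps [simp]:
  "elevation l 0 = 0" "elevation l (x + y) = elevation l x + elevation l y"
  "elevation l (x - y) = elevation l x - elevation l y" "elevation (- l) x = - elevation l x"
  by (simp_all add: elevation_def inner_add_left inner_diff_left)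

lemma elevation_reroot [simp]: "elevation l (reroot k X n) = elevation l (X (k + n)) - elevation l (X k)"
  by (simp add: reroot_def)

definition above :: "real ^ 'd \<Rightarrow> (nat \<Rightarrow> int ^ 'd) set" where
  "above l = {X. \<forall>n. 0 \<le> elevation l (X n)}"

definition unbounded_above :: "real ^ 'd \<Rightarrow> (nat \<Rightarrow> int ^ 'd) set" where
  "unbounded_above l = {X. \<forall>c::nat. \<exists>n. real c < elevation l (X n)}"

lemma mem_transience:
  "X \<in> directional_transience l \<longleftrightarrow> (\<forall>Z. \<exists>N. \<forall>n\<ge>N. Z \<le> elevation l (X n))"
  by (simp add: directional_transience_def elevation_def filterlim_at_top eventually_sequentially)

lemma transience_sets [simp]:
  "directional_transience l \<in> sets (seq_space :: (nat \<Rightarrow> int ^ 'd) measure)"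
  using directional_transience_sets[of l] by (simp add: path_space_eq_seq_space)

lemma elevation_sets [simp]:
  "{X. c \<le> elevation l (X n)} \<in> sets (seq_space :: (nat \<Rightarrow> int ^ 'd) measure)"
  "{X. c < elevation l (X n)} \<in> sets (seq_space :: (nat \<Rightarrow> int ^ 'd) measure)"
  by (rule determined_sets[of n], simp add: determined_def)+

lemma above_sets [simp]: "above l \<in> sets (seq_space :: (nat \<Rightarrow> int ^ 'd) measure)"
proof -
  have "above l = (\<Inter>n. {X. 0 \<le> elevation l (X n)})" by (auto simp: above_def)
  also have "\<dots> \<in> sets seq_space" by (intro sets.countable_INT) auto
  finally show ?thesis .
qed

lemma unbounded_above_sets [simp]:
  "unbounded_above l \<in> sets (seq_space :: (nat \<Rightarrow> int ^ 'd) measure)"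
proof -
  have "unbounded_above l = (\<Inter>c. \<Union>n. {X. real c < elevation l (X n)})"
    by (auto simp: unbounded_above_def)
  also have "\<dots> \<in> sets seq_space"
    by (intro sets.countable_INT sets.countable_UN' image_subsetI) auto
  finally show ?thesis .
qed

lemma unbounded_above_iff: "X \<in> unbounded_above l \<longleftrightarrow> (\<forall>b. \<exists>n. b < elevation l (X n))"
proof
  assume X: "X \<in> unbounded_above l"
  show "\<forall>b. \<exists>n. b < elevation l (X n)"
  proof
    fix b :: real
    obtain c :: nat where c: "b \<le> real c" using real_arch_simple[of b] ..
    obtain n where "real c < elevation l (X n)" using X unfolding unbounded_above_def by blast
    with c show "\<exists>n. b < elevation l (X n)" by (intro exI[of _ n]) simp
  qed
qed (simp add: unbounded_above_def)

lemma transience_reroot [simp]: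
  "reroot k X \<in> directional_transience l \<longleftrightarrow> X \<in> directional_transience l"
proof
  assume X: "X \<in> directional_transience l"
  show "reroot k X \<in> directional_transience l"
    unfolding mem_transience
  proof
    fix Z
    obtain N where "\<forall>n\<ge>N. Z + elevation l (X k) \<le> elevation l (X n)"
      using X unfolding mem_transience by blast
    then show "\<exists>N. \<forall>n\<ge>N. Z \<le> elevation l (reroot k X n)"
      by (intro exI[of _ N]) (auto simp: algebra_simps)
  qed
next
  assume X: "reroot k X \<in> directional_transience l"
  show "X \<in> directional_transience l"
    unfolding mem_transience
  proof
    fix Z
    obtain N where N: "\<forall>n\<ge>N. Z - elevation l (X k) \<le> elevation l (reroot k X n)"
      using X unfolding mem_transience by blast
    have "Z \<le> elevation l (X n)" if "n \<ge> N + k" for n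
      using N[rule_format, of "n - k"] that by simp
    then show "\<exists>N. \<forall>n\<ge>N. Z \<le> elevation l (X n)" by blast
  qed
qed

lemma transience_unbounded_above:
  assumes "X \<in> directional_transience l"
  shows "X \<in> unbounded_above l"
  unfolding unbounded_above_iff
proof
  fix b
  obtain N where "\<forall>n\<ge>N. b + 1 \<le> elevation l (X n)"
    using assms unfolding mem_transience by blast
  then show "\<exists>n. b < elevation l (X n)" by (intro exI[of _ N]) force
qed

lemma transience_reroot_above:
  assumes "X \<in> directional_transience l"
  shows "\<exists>k. reroot k X \<in> above l"
proof -
  \<comment> \<open>From time \<open>N\<close> on the walk is not below its starting level, so a
    minimum over \<open>{..N}\<close> is a global one.\<close>
  obtain N where N: "\<And>n. n \<ge> N \<Longrightarrow> elevation l (X 0) \<le> elevation l (X n)"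
    using assms unfolding mem_transience by blast
  have "\<exists>k\<in>{..N}. \<forall>j\<in>{..N}. elevation l (X k) \<le> elevation l (X j)"
    using ex_is_arg_min_if_finite[of "{..N}" "\<lambda>k. elevation l (X k)"]
    by (auto simp: is_arg_min_linorder)
  then obtain k where k: "\<And>j. j \<le> N \<Longrightarrow> elevation l (X k) \<le> elevation l (X j)" by auto
  have "elevation l (X k) \<le> elevation l (X n)" for n
    using k[of n] k[of 0] N[of n] by (cases "n \<le> N") auto
  then show ?thesis by (auto simp: above_def)
qed

text \<open>The inequality is strict so that all earlier sites lie outside the closed half-space
  above \<open>X k\<close>, as \<open>law_fresh\<close> requires. The bound \<open>c\<close> selects
  the high records.\<close>

definition record_time :: "real ^ 'd \<Rightarrow> real \<Rightarrow> nat \<Rightarrow> (nat \<Rightarrow> int ^ 'd) \<Rightarrow> bool" where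
  "record_time l c k X \<longleftrightarrow> c \<le> elevation l (X k) \<and> (\<forall>j<k. elevation l (X j) < elevation l (X k))"

lemma record_time_cong:
  "(\<And>i. i \<le> k \<Longrightarrow> X i = Y i) \<Longrightarrow> record_time l c k X \<Longrightarrow> record_time l c k Y"
  by (auto simp: record_time_def)

lemma unbounded_above_records:
  assumes "X \<in> unbounded_above l"
  shows "\<exists>\<^sub>\<infinity>k. record_time l c k X"
  unfolding INFM_nat
proof
  fix m
  \<comment> \<open>The first time above \<open>b\<close> is a record; by the choice of
    \<open>b\<close> it comes after \<open>m\<close> and has level at least
    \<open>c\<close>.\<close>
  define b where "b = Max (insert c ((\<lambda>j. elevation l (X j)) ` {..m}))"
  have ex: "\<exists>n. b < elevation l (X n)"
    using assms unfolding unbounded_above_iff by blast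
  define n where "n = (LEAST n. b < elevation l (X n))"
  have n: "b < elevation l (X n)" unfolding n_def by (rule LeastI_ex[OF ex])
  have "elevation l (X j) \<le> b" if "j \<le> m" for j
    unfolding b_def by (rule Max_ge) (use that in auto)
  then have "n > m" using n by (meson not_less)
  moreover have "elevation l (X j) \<le> b" if "j < n" for j
    using not_less_Least[OF that[unfolded n_def]] by simp
  moreover have "c \<le> b" by (simp add: b_def)
  ultimately show "\<exists>n>m. record_time l c n X"
    using n by (intro exI[of _ n]) (auto simp: record_time_def intro: le_less_trans)
qed

lemma unbounded_above_reroot:
  assumes "X \<in> unbounded_above l"
  shows "reroot k X \<in> unbounded_above l"
  unfolding unbounded_above_def
proof (intro CollectI allI)
  fix c :: nat
  obtain n where n: "n > k" "record_time l (real c + 1 + elevation l (X k)) n X"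
    using unbounded_above_records[OF assms] unfolding INFM_nat by blast
  then have "real c < elevation l (reroot k X (n - k))" by (simp add: record_time_def)
  then show "\<exists>n. real c < elevation l (reroot k X n)" ..
qed

definition first_step :: "int ^ 'd \<Rightarrow> (nat \<Rightarrow> int ^ 'd) set" where
  "first_step e = cyl 1 (\<lambda>i. if i = 0 then 0 else e)"

lemma first_step_sets [simp]: "first_step e \<in> sets seq_space"
  by (simp add: first_step_def)

lemma reroot_first_step: "reroot k X \<in> first_step e \<longleftrightarrow> X (Suc k) - X k = e"
  by (auto simp: first_step_def cyl_def reroot_def le_Suc_eq)

section \<open>Trials at records and at fresh sites\<close>

context iid_env
begin

text \<open>Contraposition of \<open>law_reroot_null\<close>. It turns the existence of a suitable
  time, such as a time of minimal level, into a positive probability for the walk from its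
  start.\<close>

lemma law_reroot_pos:
  assumes "G \<in> sets seq_space" "A \<in> sets seq_space" "measure law A > 0"
    and ae: "AE X in law. X \<in> A \<longrightarrow> (\<exists>k. reroot k X \<in> G)"
  shows "measure law G > 0"
proof (rule ccontr)
  interpret prob_space law by (rule prob_space_law)
  assume "\<not> measure law G > 0"
  then have "measure law G = 0" by (simp add: zero_less_measure_iff)
  from ae law_reroot_null[OF assms(1) this] have "AE X in law. X \<notin> A" by eventually_elim blast
  then have "measure law A = 0" using assms(2) by (subst prob_eq_0) auto
  with assms(3) show False by simp
qed

lemma law_above_transience_pos:
  assumes "measure law (directional_transience l) > 0"
  shows "measure law (above l \<inter> directional_transience l) > 0"
  by (rule law_reroot_pos[OF _ _ assms]) (auto dest: transience_reroot_above)

text \<open>The paths in \<open>G\<close> read only the half-space above their start, which is fresh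
  at a record.\<close>

lemma law_record_trial:
  assumes "G \<in> sets seq_space" "G \<subseteq> above l" and "record_time l c k x"
  shows "measure law G * measure law (cyl k x) \<le> measure law (cyl k x \<inter> reroot k -` G)"
proof -
  have "env_local {z. 0 \<le> elevation l z} G"
    using assms by (intro env_local_stay) (auto simp: above_def)
  from law_fresh[OF assms(1) this, of k x] assms(3) show ?thesis
    by (simp add: record_time_def mult.commute not_le)
qed

text \<open>A success at a record of level at least \<open>c\<close> keeps the walk at level
  \<open>c\<close> or higher from then on; this is applied to every natural number
  \<open>c\<close>.\<close>

lemma unbounded_above_imp_transience:
  assumes pos: "measure law (above l) > 0"
  shows "AE X in law. X \<in> unbounded_above l \<longrightarrow> X \<in> directional_transience l"
proof -
  interpret prob_space law by (rule prob_space_law)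
  have "AE X in law. (\<exists>\<^sub>\<infinity>k. record_time l (real c) k X) \<longrightarrow> X \<in> {X. \<exists>N. \<forall>n\<ge>N. real c \<le> elevation l (X n)}"
    for c :: nat
  proof (rule repeated_trials[OF _ sets_law pos above_sets, where start=0])
    have "{X. \<exists>N. \<forall>n\<ge>N. real c \<le> elevation l (X n)} = (\<Union>N. \<Inter>n\<in>{N..}. {X. real c \<le> elevation l (X n)})"
      by auto
    also have "\<dots> \<in> sets seq_space"
      by (intro sets.countable_UN image_subsetI sets.countable_INT') auto
    finally show "{X. \<exists>N. \<forall>n\<ge>N. real c \<le> elevation l (X n)} \<in> sets seq_space" .
    fix k X assume X: "record_time l (real c) k X" "reroot k X \<in> above l"
    have "real c \<le> elevation l (X n)" if "n \<ge> k" for n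
      using X that by (auto simp: above_def record_time_def dest!: spec[of _ "n - k"])
    then show "X \<in> {X. \<exists>N. \<forall>n\<ge>N. real c \<le> elevation l (X n)}" by blast
  qed (auto intro: law_record_trial record_time_cong finite_measure_axioms)
  then have "AE X in law. \<forall>c::nat. (\<exists>\<^sub>\<infinity>k. record_time l (real c) k X) \<longrightarrow>
      (\<exists>N. \<forall>n\<ge>N. real c \<le> elevation l (X n))"
    by (simp add: AE_all_countable)
  then show ?thesis
  proof eventually_elim
    case (elim X)
    show ?case
      unfolding mem_transience
    proof (intro impI allI)
      fix Z assume "X \<in> unbounded_above l"
      obtain c :: nat where "Z \<le> real c" using real_arch_simple[of Z] by blast
      moreover obtain N where "\<forall>n\<ge>N. real c \<le> elevation l (X n)"
        using elim unbounded_above_records[OF \<open>X \<in> unbounded_above l\<close>] by blast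
      ultimately show "\<exists>N. \<forall>n\<ge>N. Z \<le> elevation l (X n)" by (meson order_trans)
    qed
  qed
qed

text \<open>A walk that is unbounded above has infinitely many records, and a single success at one
  of them would make it bounded.\<close>

lemma bounded_above_if_trapped:
  assumes pos: "measure law (above l - unbounded_above l) > 0"
  shows "AE X in law. X \<notin> unbounded_above l"
proof -
  interpret prob_space law by (rule prob_space_law)
  have Bs: "- unbounded_above l \<in> sets seq_space"
    using sets.compl_sets[OF unbounded_above_sets[of l]] by (simp add: Compl_eq_Diff_UNIV)
  have "AE X in law. (\<exists>\<^sub>\<infinity>k. record_time l 0 k X) \<longrightarrow> X \<in> - unbounded_above l"
  proof (rule repeated_trials[OF finite_measure_axioms sets_law pos _ Bs, where start=0])
    show "above l - unbounded_above l \<in> sets seq_space" by auto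
    show "measure law (above l - unbounded_above l) * measure law (cyl k x) \<le>
        measure law (cyl k x \<inter> reroot k -` (above l - unbounded_above l))"
      if "record_time l 0 k x" for k x
      using that by (intro law_record_trial) auto
    show "record_time l 0 k Y" if "\<And>i. i \<le> k \<Longrightarrow> X i = Y i" "record_time l 0 k X" for k X Y
      using that by (rule record_time_cong)
    show "X \<in> - unbounded_above l" if "reroot k X \<in> above l - unbounded_above l" for k X
      using that unbounded_above_reroot by blast
  qed
  then show ?thesis 
  proof eventually_elim
    case (elim X)
    then show ?case using unbounded_above_records[of X l 0] by blast
  qed
qed

text \<open>Levels are measured in multiples of the height \<eta> of the step \<open>e\<close>. Take
  the largest \<open>j\<close> such that the walk is infinitely often at level
  \<open>j * \<eta>\<close> or higher. Infinitely many fresh sites up there would let the step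
  \<open>e\<close> be taken from such sites at arbitrarily late times, so that \<open>j + 1\<close>
  would qualify as well. Hence only finitely many sites up there are visited, and one of them is
  highest.\<close>

lemma maximum_attained:
  assumes e: "elevation l e > 0" "measure law (first_step e) > 0"
  shows "AE X in law. X \<notin> unbounded_above l \<longrightarrow> X \<notin> directional_transience (- l) \<longrightarrow>
    (\<exists>k. reroot k X \<in> above (- l))"
proof -
  interpret prob_space law by (rule prob_space_law)
  define \<eta> where "\<eta> = elevation l e"
  have \<eta>: "\<eta> > 0" using e by (simp add: \<eta>_def)
  define T where "T j k X \<longleftrightarrow> real_of_int j * \<eta> \<le> elevation l (X k) \<and> (\<forall>i<k. X i \<noteq> X k)"
    for j and k :: nat and X :: "nat \<Rightarrow> int ^ 'd"
  \<comment> \<open>The time bound \<open>k0\<close> is part of the target event, so that the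
    conclusions for all \<open>k0\<close> together give infinitely many visits.\<close>
  have "AE X in law. (\<exists>\<^sub>\<infinity>k. T j k X) \<longrightarrow> X \<in> {X. \<exists>n\<ge>k0. real_of_int (j + 1) * \<eta> \<le> elevation l (X n)}"
    for j and k0 :: nat
  proof (rule repeated_trials[OF _ sets_law e(2) first_step_sets measurable_site_property, where start=k0])
    fix k x assume "T j k x"
    then show "measure law (first_step e) * measure law (cyl k x) \<le>
        measure law (cyl k x \<inter> reroot k -` first_step e)"
      using law_fresh[of "first_step e" "{0}" k x] env_local_first_step[of e]
      by (simp add: first_step_def T_def mult.commute)
  next
    fix k X assume *: "k \<ge> k0" "T j k X" "reroot k X \<in> first_step e"
    have "elevation l (X (Suc k)) = elevation l (X k) + \<eta>"
      using *(3) unfolding reroot_first_step \<eta>_def by (metis elevation_simps(2) diff_add_cancel add.commute)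
    then have "real_of_int (j + 1) * \<eta> \<le> elevation l (X (Suc k))"
      using *(2) by (simp add: T_def algebra_simps)
    then show "X \<in> {X. \<exists>n\<ge>k0. real_of_int (j + 1) * \<eta> \<le> elevation l (X n)}"
      using *(1) le_SucI by blast
  qed (auto simp: T_def finite_measure_axioms)
  then have "AE X in law. \<forall>j k0. (\<exists>\<^sub>\<infinity>k. T j k X) \<longrightarrow>
      (\<exists>n\<ge>k0. real_of_int (j + 1) * \<eta> \<le> elevation l (X n))"
    unfolding AE_all_countable mem_Collect_eq by blast
  then show ?thesis
  proof eventually_elim
    case (elim X)
    show ?case
    proof (intro impI)
      assume "X \<notin> unbounded_above l" "X \<notin> directional_transience (- l)"
      then obtain c where c: "\<And>n. elevation l (X n) \<le> c"
        unfolding unbounded_above_iff by (auto simp: not_less)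
      \<comment> \<open>Without transience in direction \<open>- l\<close> some level
        \<open>- Z\<close> is exceeded at arbitrarily late times; this provides a first multiple of
        \<eta> with property \<open>P\<close>.\<close>
      obtain Z where "\<not> (\<exists>N. \<forall>n\<ge>N. Z \<le> elevation (- l) (X n))"
        using \<open>X \<notin> directional_transience (- l)\<close> unfolding mem_transience by blast
      then have Z: "\<exists>n\<ge>N. - Z < elevation l (X n)" for N
        by (metis elevation_simps(4) not_le minus_less_iff)
      define P where "P j \<longleftrightarrow> (\<exists>\<^sub>\<infinity>n. real_of_int j * \<eta> \<le> elevation l (X n))" for j
      define J where "J = {j. P j} \<inter> {\<lfloor>- Z / \<eta>\<rfloor>..\<lfloor>c / \<eta>\<rfloor>}"
      have P_le: "j \<le> \<lfloor>c / \<eta>\<rfloor>" if "P j" for j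
      proof -
        from that obtain n where "real_of_int j * \<eta> \<le> elevation l (X n)"
          unfolding P_def by (metis INFM_EX)
        then have "real_of_int j * \<eta> \<le> c" using c[of n] by simp
        then show ?thesis using \<eta> by (simp add: le_floor_iff pos_le_divide_eq)
      qed
      have "P \<lfloor>- Z / \<eta>\<rfloor>"
        unfolding P_def INFM_nat_le
      proof
        fix m
        have "real_of_int \<lfloor>- Z / \<eta>\<rfloor> * \<eta> \<le> - Z"
          using of_int_floor_le[of "- Z / \<eta>"] by (simp only: pos_le_divide_eq[OF \<eta>])
        moreover obtain n where "n \<ge> m" "- Z < elevation l (X n)" using Z by blast
        ultimately show "\<exists>n\<ge>m. real_of_int \<lfloor>- Z / \<eta>\<rfloor> * \<eta> \<le> elevation l (X n)" by force
      qed
      then have "\<lfloor>- Z / \<eta>\<rfloor> \<in> J" using P_le by (auto simp: J_def)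
      moreover have fJ: "finite J" by (simp add: J_def)
      ultimately have j: "Max J \<in> J" using Max_in by blast
      define j where "j = Max J"
      have "P j" using j by (simp add: j_def J_def)
      have "\<not> P (j + 1)"
      proof
        assume "P (j + 1)"
        then have "j + 1 \<in> J" using P_le[of "j + 1"] j by (simp add: J_def j_def)
        then show False using Max_ge[OF fJ, of "j + 1"] by (simp add: j_def)
      qed
      then obtain K where "\<And>n. n \<ge> K \<Longrightarrow> \<not> real_of_int (j + 1) * \<eta> \<le> elevation l (X n)"
        unfolding P_def INFM_nat_le by blast
      then have "\<not> (\<exists>\<^sub>\<infinity>k. T j k X)" using elim by blast
      then have fin: "finite {k. T j k X}" by (simp add: frequently_cofinite)
      define S where "S = {X n | n. real_of_int j * \<eta> \<le> elevation l (X n)}"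
      have "S \<subseteq> X ` {k. T j k X}"
      proof
        fix x assume "x \<in> S"
        then obtain n where n: "x = X n" "real_of_int j * \<eta> \<le> elevation l (X n)" by (auto simp: S_def)
        define k where "k = (LEAST k. X k = x)"
        have k: "X k = x" unfolding k_def by (rule LeastI[of _ n]) (simp add: n)
        have "X i \<noteq> X k" if "i < k" for i
          using not_less_Least[OF that[unfolded k_def]] k by simp
        then have "T j k X" using k n by (simp add: T_def)
        then show "x \<in> X ` {k. T j k X}" using k by blast
      qed
      then have "finite S" using fin finite_surj by blast
      moreover have "S \<noteq> {}" using \<open>P j\<close> unfolding S_def P_def by (auto dest: INFM_EX)
      ultimately obtain x where x: "x \<in> S" "\<And>z. z \<in> S \<Longrightarrow> elevation l z \<le> elevation l x"
        using ex_is_arg_min_if_finite[of S "\<lambda>z. - elevation l z"] by (auto simp: is_arg_min_linorder)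
      then obtain k where k: "x = X k" "real_of_int j * \<eta> \<le> elevation l (X k)" by (auto simp: S_def)
      have "elevation l (X n) \<le> elevation l (X k)" for n
      proof (cases "real_of_int j * \<eta> \<le> elevation l (X n)")
        case True
        then have "X n \<in> S" by (auto simp: S_def)
        then show ?thesis using x(2) k by simp
      qed (use k in linarith)
      then show "\<exists>k. reroot k X \<in> above (- l)" by (auto simp: above_def)
    qed
  qed
qed

lemma monotone_if_no_upward_step:
  assumes "\<And>e. elevation l e > 0 \<Longrightarrow> measure law (first_step e) = 0"
  shows "AE X in law. \<forall>k. elevation l (X (Suc k)) \<le> elevation l (X k)"
proof -
  have "AE X in law. \<forall>k. elevation l e > 0 \<longrightarrow> reroot k X \<notin> first_step e" for e
    using law_reroot_null[OF first_step_sets assms, of e] by (cases "elevation l e > 0") auto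
  then have "AE X in law. \<forall>e k. elevation l e > 0 \<longrightarrow> reroot k X \<notin> first_step e"
    by (subst AE_all_countable) auto
  then show ?thesis
    by eventually_elim (metis elevation_simps(3) reroot_first_step diff_gt_0_iff_gt not_less)
qed

lemma upward_step:
  assumes "measure law (directional_transience l) > 0"
  obtains e where "elevation l e > 0" "measure law (first_step e) > 0"
proof (rule ccontr)
  interpret prob_space law by (rule prob_space_law)
  assume "\<not> thesis"
  then have "AE X in law. \<forall>k. elevation l (X (Suc k)) \<le> elevation l (X k)"
    using that by (intro monotone_if_no_upward_step) (meson measure_nonneg order_antisym not_less)
  then have "AE X in law. X \<notin> directional_transience l"
  proof eventually_elim
    case (elim X)
    then have "elevation l (X n) \<le> elevation l (X 0)" for n by (induction n) (auto intro: order_trans)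
    then have "X \<notin> unbounded_above l" unfolding unbounded_above_iff by (metis not_less)
    then show ?case using transience_unbounded_above by blast
  qed
  then have "measure law (directional_transience l) = 0" by (subst prob_eq_0) auto
  with assms show False by simp
qed

theorem kalikow_zero_one:
  assumes pos: "measure law (directional_transience l) > 0"
  shows "AE X in law. X \<in> directional_transience l \<or> X \<in> directional_transience (- l)"
proof -
  interpret prob_space law by (rule prob_space_law)
  have "measure law (above l) \<ge> measure law (above l \<inter> directional_transience l)"
    by (intro finite_measure_mono) auto
  then have up: "AE X in law. X \<in> unbounded_above l \<longrightarrow> X \<in> directional_transience l"
    using law_above_transience_pos[OF pos] by (intro unbounded_above_imp_transience) simp
  \<comment> \<open>By \<open>up\<close>, a walk outside \<open>E\<close> is almost surely transient
    in one of the two directions.\<close>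
  define E where "E = - unbounded_above l - directional_transience (- l)"
  have E: "E \<in> sets seq_space"
    using sets.compl_sets[OF unbounded_above_sets[of l]] by (auto simp: E_def Compl_eq_Diff_UNIV)
  have "measure law E = 0"
  proof (rule ccontr)
    assume "measure law E \<noteq> 0"
    then have E_pos: "measure law E > 0" by (simp add: zero_less_measure_iff)
    obtain e where e: "elevation l e > 0" "measure law (first_step e) > 0"
      using upward_step[OF pos] .
    have "measure law (above (- l)) > 0"
      by (rule law_reroot_pos[OF above_sets E E_pos])
        (use maximum_attained[OF e] in \<open>eventually_elim; auto simp: E_def\<close>)
    \<comment> \<open>On \<open>E\<close> a walk unbounded in direction \<open>- l\<close> would be
      transient in this direction.\<close>
    from unbounded_above_imp_transience[OF this]
    have down: "AE X in law. X \<in> E \<longrightarrow> X \<notin> unbounded_above (- l)"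
      by eventually_elim (auto simp: E_def)
    have "AE X in law. X \<in> E \<longrightarrow> (\<exists>k. reroot k X \<in> above l)"
    \<comment> \<open>With a downward step available, \<open>maximum_attained\<close> for
      \<open>- l\<close> yields a minimum. Otherwise the levels never decrease, and time 0 is a
      minimum.\<close>
    proof (cases "\<exists>e. elevation (- l) e > 0 \<and> measure law (first_step e) > 0")
      case True
      then obtain e where "elevation (- l) e > 0" "measure law (first_step e) > 0" by blast
      from maximum_attained[OF this] down show ?thesis
        by eventually_elim (auto simp: E_def dest: transience_unbounded_above)
    next
      case False
      then have "AE X in law. \<forall>k. elevation (- l) (X (Suc k)) \<le> elevation (- l) (X k)"
        by (intro monotone_if_no_upward_step) (meson measure_nonneg order_antisym not_less)
      then show ?thesis
      proof eventually_elim
        case (elim X)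
        then have "elevation l (X 0) \<le> elevation l (X n)" for n by (induction n) (auto intro: order_trans)
        then have "reroot 0 X \<in> above l" by (auto simp: above_def)
        then show ?case by blast
      qed
    qed
    moreover have "reroot k X \<notin> unbounded_above l" if "X \<in> E" for k X
    proof -
      have "X \<notin> unbounded_above l" using that by (simp add: E_def)
      then obtain c where c: "\<And>n. elevation l (X n) \<le> c"
        unfolding unbounded_above_iff by (auto simp: not_less)
      have "elevation l (reroot k X n) \<le> c - elevation l (X k)" for n
        using c[of "k + n"] by simp
      then show ?thesis unfolding unbounded_above_iff by (metis not_less)
    qed
    ultimately have "measure law (above l - unbounded_above l) > 0"
      by (intro law_reroot_pos[OF _ E E_pos]) auto
    from bounded_above_if_trapped[OF this] have "AE X in law. X \<notin> directional_transience l"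
      by eventually_elim (use transience_unbounded_above in blast)
    then have "measure law (directional_transience l) = 0" by (subst prob_eq_0) auto
    with pos show False by simp
  qed
  then have "AE X in law. X \<notin> E" using E by (subst (asm) prob_eq_0) auto
  then show ?thesis using up by eventually_elim (auto simp: E_def)
qed

end

subsection \<open>Crossing lattice paths in the plane\<close>

definition adjacent :: "int \<times> int \<Rightarrow> int \<times> int \<Rightarrow> bool" where
  "adjacent u v \<longleftrightarrow> \<bar>fst u - fst v\<bar> + \<bar>snd u - snd v\<bar> = 1"

text \<open>The signed number of horizontal edges of the path \<open>p\<close> (up to time \<open>T\<close>) that cross the
  vertical ray going up from \<open>z + (1/2, 0)\<close>.\<close>

definition crossings :: "nat \<Rightarrow> (nat \<Rightarrow> int \<times> int) \<Rightarrow> int \<times> int \<Rightarrow> int" where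
  "crossings T p z = (\<Sum>i<T. if snd z < snd (p i)
     then of_bool (fst (p i) \<le> fst z) - of_bool (fst (p (Suc i)) \<le> fst z) else 0)"

text \<open>Raising the foot of the ray by one loses only the edge between \<open>(x, y + 1)\<close>
  and \<open>(x + 1, y + 1)\<close>, and \<open>p\<close> avoids one of its ends.\<close>

lemma crossings_vertical:
  assumes adj: "\<And>i. i < T \<Longrightarrow> adjacent (p i) (p (Suc i))"
    and avoid: "\<And>i. i \<le> T \<Longrightarrow> p i \<noteq> (x, y + 1)"
  shows "crossings T p (x, y + 1) = crossings T p (x, y)"
  unfolding crossings_def
proof (rule sum.cong[OF refl])
  fix i assume "i \<in> {..<T}"
  then have "adjacent (p i) (p (Suc i))" "p i \<noteq> (x, y + 1)" "p (Suc i) \<noteq> (x, y + 1)"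
    using adj avoid by auto
  then show "(if snd (x, y + 1) < snd (p i)
      then of_bool (fst (p i) \<le> fst (x, y + 1)) - of_bool (fst (p (Suc i)) \<le> fst (x, y + 1)) else 0) =
    (if snd (x, y) < snd (p i)
      then of_bool (fst (p i) \<le> fst (x, y)) - of_bool (fst (p (Suc i)) \<le> fst (x, y)) else (0::int))"
    by (cases "p i"; cases "p (Suc i)") (auto simp: adjacent_def)
qed

text \<open>The two rays enclose the half-column above \<open>(x + 1, y)\<close>. As the site at its
  bottom is avoided, \<open>p\<close> enters and leaves it only across the rays, and the net number
  of crossings telescopes to the presence of \<open>p\<close> there at times 0 and
  \<open>T\<close>.\<close>

lemma crossings_horizontal:
  assumes adj: "\<And>i. i < T \<Longrightarrow> adjacent (p i) (p (Suc i))"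
    and avoid: "\<And>i. i \<le> T \<Longrightarrow> p i \<noteq> (x + 1, y)"
  shows "crossings T p (x + 1, y) - crossings T p (x, y) =
    of_bool (fst (p 0) = x + 1 \<and> y < snd (p 0)) - of_bool (fst (p T) = x + 1 \<and> y < snd (p T))"
proof -
  let ?K = "\<lambda>i. of_bool (fst (p i) = x + 1 \<and> y < snd (p i)) :: int"
  have "crossings T p (x + 1, y) - crossings T p (x, y) = (\<Sum>i<T. ?K i - ?K (Suc i))"
    unfolding crossings_def sum_subtractf[symmetric]
  proof (rule sum.cong[OF refl])
    fix i assume "i \<in> {..<T}"
    then have "adjacent (p i) (p (Suc i))" "p i \<noteq> (x + 1, y)" "p (Suc i) \<noteq> (x + 1, y)"
      using adj avoid by auto
    then show "(if snd (x + 1, y) < snd (p i)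
        then of_bool (fst (p i) \<le> fst (x + 1, y)) - of_bool (fst (p (Suc i)) \<le> fst (x + 1, y)) else 0) -
      (if snd (x, y) < snd (p i)
        then of_bool (fst (p i) \<le> fst (x, y)) - of_bool (fst (p (Suc i)) \<le> fst (x, y)) else 0) =
      ?K i - ?K (Suc i)"
      by (cases "p i"; cases "p (Suc i)") (auto simp: adjacent_def)
  qed
  also have "\<dots> = ?K 0 - ?K T" by (rule sum_lessThan_telescope')
  finally show ?thesis .
qed

lemma adjacent_cases:
  assumes "adjacent u v"
  obtains x y where "u = (x, y)" "v = (x + 1, y)" | x y where "v = (x, y)" "u = (x + 1, y)"
    | x y where "u = (x, y)" "v = (x, y + 1)" | x y where "v = (x, y)" "u = (x, y + 1)"
proof -
  obtain a b c d where uv: "u = (a, b)" "v = (c, d)" by (metis surj_pair)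
  with assms have "(c = a + 1 \<and> d = b) \<or> (a = c + 1 \<and> d = b) \<or> (d = b + 1 \<and> a = c) \<or> (b = d + 1 \<and> a = c)"
    by (auto simp: adjacent_def)
  then show ?thesis using uv that by blast
qed

text \<open>Prolonged by vertical rays at both ends, \<open>p\<close> becomes a bi-infinite path which \<open>q\<close> can only
  meet in \<open>p\<close> itself. If it does not, the number of crossings, corrected by the upper ray, is constant
  along \<open>q\<close>.\<close>

lemma strip_crossing:
  fixes A B L :: real and p q :: "nat \<Rightarrow> int \<times> int"
  defines "u \<equiv> \<lambda>z :: int \<times> int. A * of_int (fst z) + B * of_int (snd z)"
  assumes B: "B > 0" "\<bar>A\<bar> \<le> B" and L: "L > 0"
    and p: "p 0 = (0, 0)" "\<And>i. i < T \<Longrightarrow> adjacent (p i) (p (Suc i))"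
      "\<And>i. i \<le> T \<Longrightarrow> 0 \<le> u (p i)" "\<And>i. i < T \<Longrightarrow> u (p i) < L" "L \<le> u (p T)"
    and q: "\<And>j. j < T' \<Longrightarrow> adjacent (q j) (q (Suc j))" "L \<le> u (q 0)" "u (q 0) < L + B"
      "\<And>j. j \<le> T' \<Longrightarrow> u (q j) \<le> u (q 0)" "\<And>j. j < T' \<Longrightarrow> 0 < u (q j)" "u (q T') \<le> 0"
    and disj: "\<And>i j. i \<le> T \<Longrightarrow> j \<le> T' \<Longrightarrow> p i \<noteq> q j"
  shows "fst (q 0) \<noteq> fst (p T)" "fst (p T) < fst (q 0) \<longleftrightarrow> 0 \<le> fst (q T')"
proof -
  \<comment> \<open>Here \<open>\<bar>A\<bar> \<le> B\<close> enters: a step changes the height by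
    at most \<open>B\<close>, while different sites of a column differ by at least \<open>B\<close>.
    Thus the bands of width \<open>B\<close> beyond the two levels contain the ends of the paths,
    and just one site of every column.\<close>
  have u_step: "\<bar>u v - u w\<bar> \<le> B" if "adjacent v w" for v w
    using that B by (cases rule: adjacent_cases) (auto simp: u_def algebra_simps)
  have u_vert: "u v + B \<le> u w" if "fst v = fst w" "snd v < snd w" for v w
  proof -
    have "B * (of_int (snd v) + 1) \<le> B * of_int (snd w)"
      using that B(1) by (intro mult_left_mono) auto
    then show ?thesis using that(1) by (simp add: u_def algebra_simps)
  qed
  have "T > 0" using p(1,5) L by (cases T) (auto simp: u_def)
  have "T' > 0" using q(2,6) L by (cases T') auto
  have pT: "u (p T) < L + B"
    using p(4)[of "T - 1"] u_step[OF p(2)[of "T - 1"]] \<open>T > 0\<close> by simp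
  have qT: "- B < u (q T')"
    using q(5)[of "T' - 1"] u_step[OF q(1)[of "T' - 1"]] \<open>T' > 0\<close> by simp
  have q_low: "- B < u (q j)" if "j \<le> T'" for j
    using q(5)[of j] qT that B(1) by (cases "j = T'") auto
  define a where "a = fst (p T)"
  \<comment> \<open>Tells on which side of the prolonged path \<open>z\<close> lies. Moving right
    into column \<open>a\<close>, below the end of \<open>p\<close>, crosses the upper ray and
    changes \<open>crossings\<close> by -1; the second term makes up for it.\<close>
  define I where "I z = crossings T p z + of_bool (a \<le> fst z)" for z
  \<comment> \<open>The bounds on \<open>u\<close> keep \<open>z\<close> off the two rays: in column
    0 it is not below \<open>p 0\<close>, in column \<open>a\<close> not above
    \<open>p T\<close>.\<close>
  define good where "good z \<longleftrightarrow> (\<forall>i\<le>T. p i \<noteq> z) \<and> - B < u z \<and> u z < L + B" for z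
  have good_q: "good (q j)" if "j \<le> T'" for j
    using disj that q_low[OF that] q(4)[OF that] q(3) by (auto simp: good_def)
  have horizontal: "I (x + 1, y) = I (x, y)" if "good (x + 1, y)" for x y
  proof -
    have 1: "\<not> (fst (p 0) = x + 1 \<and> y < snd (p 0))"
    proof
      assume "fst (p 0) = x + 1 \<and> y < snd (p 0)"
      then have "u (x + 1, y) + B \<le> u (p 0)" by (intro u_vert) auto
      then show False using that p(1) by (simp add: good_def u_def)
    qed
    have 2: "(fst (p T) = x + 1 \<and> y < snd (p T)) \<longleftrightarrow> a = x + 1"
    proof -
      have "y < snd (p T)" if a: "a = x + 1"
      proof (rule ccontr)
        assume "\<not> y < snd (p T)"
        moreover have "p T \<noteq> (x + 1, y)" using \<open>good (x + 1, y)\<close> by (simp add: good_def)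
        ultimately have "snd (p T) < y" using a by (cases "p T") (auto simp: a_def)
        then have "u (p T) + B \<le> u (x + 1, y)" using a by (intro u_vert) (auto simp: a_def)
        then show False using p(5) \<open>good (x + 1, y)\<close> by (simp add: good_def)
      qed
      then show ?thesis by (auto simp: a_def)
    qed
    have "crossings T p (x + 1, y) - crossings T p (x, y) = - of_bool (a = x + 1)"
      by (subst crossings_horizontal) (use p(2) that 1 2 in \<open>auto simp: good_def\<close>)
    then show ?thesis by (auto simp: I_def)
  qed
  have vertical: "I (x, y + 1) = I (x, y)" if "good (x, y + 1)" for x y
    using crossings_vertical[of T p x y] p(2) that by (simp add: I_def good_def)
  have "I (q j) = I (q 0)" if "j \<le> T'" for j
    using that
  proof (induction j)
    case (Suc j)
    from q(1)[of j] Suc.prems have "adjacent (q j) (q (Suc j))" by simp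
    then have "I (q (Suc j)) = I (q j)"
      using good_q[of j] good_q[of "Suc j"] Suc.prems
      by (cases rule: adjacent_cases) (auto simp: horizontal vertical)
    then show ?case using Suc by simp
  qed simp
  then have I_eq: "I (q T') = I (q 0)" by blast
  have p_high: "u (p i) < L + B" if "i \<le> T" for i
    using p(4)[of i] pT that B(1) by (cases "i = T") auto
  \<comment> \<open>Sites above \<open>q 0\<close> in its column have height at least
    \<open>L + B\<close>, which \<open>p\<close> never reaches.\<close>
  have "crossings T p (q 0) = 0"
    unfolding crossings_def
  proof (rule sum.neutral, rule ballI)
    fix i assume "i \<in> {..<T}"
    then have i: "adjacent (p i) (p (Suc i))" "u (p i) < L + B" "u (p (Suc i)) < L + B"
      using p(2) p_high by auto
    have *: "\<not> (fst z = fst (q 0) \<and> snd (q 0) < snd z)" if "u z < L + B" for z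
      using u_vert[of "q 0" z] that q(2) by auto
    show "(if snd (q 0) < snd (p i) then of_bool (fst (p i) \<le> fst (q 0)) -
        of_bool (fst (p (Suc i)) \<le> fst (q 0)) else 0) = (0::int)"
      using i(1) *[OF i(2)] *[OF i(3)] by (cases rule: adjacent_cases) auto
  qed
  then have I0: "I (q 0) = of_bool (a \<le> fst (q 0))" by (simp add: I_def)
  \<comment> \<open>All sites of \<open>p\<close> in the column of \<open>q T'\<close> lie above
    \<open>q T'\<close>, so the condition on the height holds at every crossing edge and the sum
    telescopes.\<close>
  have "crossings T p (q T') = (\<Sum>i<T. of_bool (fst (p i) \<le> fst (q T')) - of_bool (fst (p (Suc i)) \<le> fst (q T')))"
    unfolding crossings_def
  proof (rule sum.cong[OF refl])
    fix i assume "i \<in> {..<T}"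
    then have i: "adjacent (p i) (p (Suc i))" "0 \<le> u (p i)" "0 \<le> u (p (Suc i))"
        "p i \<noteq> q T'" "p (Suc i) \<noteq> q T'"
      using p(2) p(3) disj by auto
    have *: "\<not> (fst z = fst (q T') \<and> snd z \<le> snd (q T'))" if "0 \<le> u z" "z \<noteq> q T'" for z
    proof
      assume z: "fst z = fst (q T') \<and> snd z \<le> snd (q T')"
      then have "snd z < snd (q T')" using that(2) by (simp add: prod_eq_iff)
      then show False using u_vert[of z "q T'"] z that(1) q(6) B(1) by auto
    qed
    show "(if snd (q T') < snd (p i) then of_bool (fst (p i) \<le> fst (q T')) -
        of_bool (fst (p (Suc i)) \<le> fst (q T')) else 0) =
      (of_bool (fst (p i) \<le> fst (q T')) - of_bool (fst (p (Suc i)) \<le> fst (q T')) :: int)"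
      using i(1) *[OF i(2,4)] *[OF i(3,5)] by (cases rule: adjacent_cases) auto
  qed
  also have "\<dots> = of_bool (0 \<le> fst (q T')) - of_bool (a \<le> fst (q T'))"
    by (subst sum_lessThan_telescope') (simp add: p(1) a_def)
  finally have IT: "I (q T') = of_bool (0 \<le> fst (q T'))" by (simp add: I_def)
  show ne: "fst (q 0) \<noteq> fst (p T)"
  proof
    assume eq: "fst (q 0) = fst (p T)"
    have "p T \<noteq> q 0" using disj by simp
    with eq have "snd (p T) < snd (q 0) \<or> snd (q 0) < snd (p T)" by (auto simp: prod_eq_iff)
    then show False
    proof
      assume "snd (p T) < snd (q 0)"
      with eq have "u (p T) + B \<le> u (q 0)" by (intro u_vert) auto
      with p(5) q(3) show False by simp
    next
      assume "snd (q 0) < snd (p T)"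
      with eq have "u (q 0) + B \<le> u (p T)" by (intro u_vert) auto
      with pT q(2) show False by simp
    qed
  qed
  show "fst (p T) < fst (q 0) \<longleftrightarrow> 0 \<le> fst (q T')"
    using I_eq I0 IT ne by (auto simp: a_def)
qed

subsection \<open>Two walks in the same environment\<close>

abbreviation pair_space :: "((nat \<Rightarrow> int ^ 'd) \<times> (nat \<Rightarrow> int ^ 'd)) measure" where
  "pair_space \<equiv> seq_space \<Otimes>\<^sub>M seq_space"

definition meet :: "int ^ 'd \<Rightarrow> ((nat \<Rightarrow> int ^ 'd) \<times> (nat \<Rightarrow> int ^ 'd)) set" where
  "meet y = {(X, Y). \<exists>i j. X i = y + Y j}"

text \<open>Two walks as one path of pairs of sites, the second walk moved to its true position. In
  this form \<open>emeasure_eq_on_related\<close>, stated for any countable state space, can compare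
  their joint laws.\<close>

definition zip_paths :: "int ^ 'd \<Rightarrow> (nat \<Rightarrow> int ^ 'd) \<times> (nat \<Rightarrow> int ^ 'd) \<Rightarrow> nat \<Rightarrow> (int ^ 'd) \<times> (int ^ 'd)" where
  "zip_paths y XY = (\<lambda>n. (fst XY n, y + snd XY n))"

definition unzip_paths :: "int ^ 'd \<Rightarrow> (nat \<Rightarrow> (int ^ 'd) \<times> (int ^ 'd)) \<Rightarrow> (nat \<Rightarrow> int ^ 'd) \<times> (nat \<Rightarrow> int ^ 'd)" where
  "unzip_paths y Z = (\<lambda>n. fst (Z n), \<lambda>n. snd (Z n) - y)"

lemma unzip_zip_paths [simp]: "unzip_paths y (zip_paths y XY) = XY"
  by (simp add: zip_paths_def unzip_paths_def)

lemma zip_unzip_paths [simp]: "zip_paths y (unzip_paths y Z) = Z"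
  by (simp add: zip_paths_def unzip_paths_def)

lemma measurable_seq_spaceI:
  assumes "\<And>n. (\<lambda>x. f x n) \<in> M \<rightarrow>\<^sub>M count_space UNIV"
  shows "f \<in> M \<rightarrow>\<^sub>M seq_space"
proof -
  have "(\<lambda>x. \<lambda>n\<in>UNIV. f x n) \<in> M \<rightarrow>\<^sub>M seq_space"
    unfolding seq_space_def by (rule measurable_restrict) (rule assms)
  then show ?thesis by (simp add: restrict_def)
qed

lemma measurable_zip_paths [measurable]: "zip_paths y \<in> pair_space \<rightarrow>\<^sub>M seq_space"
proof (rule measurable_seq_spaceI)
  fix n
  have "(\<lambda>XY. (fst XY n, snd XY n)) \<in> pair_space \<rightarrow>\<^sub>M (count_space UNIV \<Otimes>\<^sub>M count_space (UNIV :: (int ^ 'a) set))"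
    by measurable
  then have "(\<lambda>XY. (fst XY n, snd XY n)) \<in> pair_space \<rightarrow>\<^sub>M count_space (UNIV :: ((int ^ 'a) \<times> (int ^ 'a)) set)"
    by (simp add: pair_measure_countable)
  then have "(\<lambda>XY. (\<lambda>(a, b). (a, y + b)) (fst XY n, snd XY n)) \<in> pair_space \<rightarrow>\<^sub>M count_space UNIV"
    by (rule measurable_compose) simp
  then show "(\<lambda>XY. zip_paths y XY n) \<in> pair_space \<rightarrow>\<^sub>M count_space UNIV"
    by (simp add: zip_paths_def)
qed

lemma measurable_unzip_paths [measurable]: "unzip_paths y \<in> seq_space \<rightarrow>\<^sub>M pair_space"
  unfolding unzip_paths_def
  by (intro measurable_Pair measurable_seq_spaceI measurable_compose[OF measurable_seq_coordinate]) simp_all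

lemma space_pair_space [simp]: "space pair_space = UNIV"
  by (simp add: space_pair_measure)

lemma meet_sets [simp]: "meet y \<in> sets pair_space"
proof -
  define D where "D = (\<lambda>i j. {Z :: nat \<Rightarrow> (int ^ 'a) \<times> (int ^ 'a). fst (Z i) = snd (Z j)})"
  have "determined (max i j) (D i j)" for i j by (simp add: D_def determined_def)
  then have D: "D i j \<in> sets seq_space" for i j by (rule determined_sets)
  have "meet y = zip_paths y -` (\<Union>i. \<Union>j. D i j) \<inter> space pair_space"
    by (auto simp: meet_def zip_paths_def D_def; metis)
  also have "\<dots> \<in> sets pair_space"
    by (intro measurable_sets[OF measurable_zip_paths] sets.countable_UN image_subsetI D)
  finally show ?thesis .
qed

lemma Times_sets [simp]:
  "A \<in> sets seq_space \<Longrightarrow> B \<in> sets seq_space \<Longrightarrow> A \<times> B \<in> sets pair_space"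
  by (rule pair_measureI)

lemma measure_pair_Times:
  assumes "prob_space M" "prob_space N" "A \<in> sets M" "B \<in> sets N"
  shows "measure (M \<Otimes>\<^sub>M N) (A \<times> B) = measure M A * measure N B"
proof -
  interpret M: prob_space M by fact
  interpret N: prob_space N by fact
  have "emeasure (M \<Otimes>\<^sub>M N) (A \<times> B) = emeasure M A * emeasure N B"
    by (rule N.emeasure_pair_measure_Times) fact+
  then show ?thesis by (simp add: measure_def enn2real_mult)
qed

lemma transience_disjoint:
  assumes "X \<in> directional_transience l"
  shows "X \<notin> directional_transience (- l)"
proof
  assume "X \<in> directional_transience (- l)"
  then obtain N where N: "\<forall>n\<ge>N. 1 \<le> elevation (- l) (X n)" unfolding mem_transience by blast
  obtain N' where N': "\<forall>n\<ge>N'. 0 \<le> elevation l (X n)" using assms unfolding mem_transience by blast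
  show False using N[rule_format, of "max N N'"] N'[rule_format, of "max N N'"] by simp
qed

context iid_env
begin

text \<open>The walks start at \<open>0\<close> and at \<open>y\<close>; the second component is the displacement from \<open>y\<close>.\<close>

definition two_walks :: "int ^ 'd \<Rightarrow> ((nat \<Rightarrow> int ^ 'd) \<times> (nat \<Rightarrow> int ^ 'd)) measure" where
  "two_walks y = env \<bind> (\<lambda>\<omega>. quenched_law \<omega> \<Otimes>\<^sub>M quenched_law (env_shift y \<omega>))"

lemma two_walks_kernel:
  "(\<lambda>\<omega>. quenched_law \<omega> \<Otimes>\<^sub>M quenched_law (env_shift y \<omega>)) \<in> env \<rightarrow>\<^sub>M prob_algebra pair_space"
  by (intro measurable_pair_prob quenched_measurable
      measurable_compose[OF env_shift_measurable quenched_measurable])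

lemma env_in_prob_algebra: "env \<in> space (prob_algebra env)"
  by (simp add: space_prob_algebra prob_space_env)

lemma sets_two_walks [simp]: "sets (two_walks y) = sets pair_space"
  unfolding two_walks_def by (rule sets_bind'[OF env_in_prob_algebra two_walks_kernel])

lemma prob_space_two_walks: "prob_space (two_walks y)"
  unfolding two_walks_def by (rule prob_space_bind'[OF env_in_prob_algebra two_walks_kernel])

lemma sets_quenched_pair:
  "valid_env \<omega> \<Longrightarrow> sets (quenched_law \<omega> \<Otimes>\<^sub>M quenched_law (env_shift y \<omega>)) = sets pair_space"
  by (intro sets_pair_measure_cong) simp_all

lemma prob_space_quenched_pair:
  "valid_env \<omega> \<Longrightarrow> prob_space (quenched_law \<omega> \<Otimes>\<^sub>M quenched_law (env_shift y \<omega>))"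
  by (intro prob_space_pair prob_space_quenched) simp_all

lemma two_walks_measurable:
  "S \<in> sets pair_space \<Longrightarrow>
    (\<lambda>\<omega>. measure (quenched_law \<omega> \<Otimes>\<^sub>M quenched_law (env_shift y \<omega>)) S) \<in> borel_measurable env"
  by (rule measurable_compose[OF two_walks_kernel measurable_measure_prob_algebra])

lemma measure_two_walks:
  assumes S: "S \<in> sets pair_space"
  shows "measure (two_walks y) S =
    (\<integral>\<omega>. measure (quenched_law \<omega> \<Otimes>\<^sub>M quenched_law (env_shift y \<omega>)) S \<partial>env)"
proof -
  have "emeasure (two_walks y) S =
      (\<integral>\<^sup>+\<omega>. emeasure (quenched_law \<omega> \<Otimes>\<^sub>M quenched_law (env_shift y \<omega>)) S \<partial>env)"
    unfolding two_walks_def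
    by (rule emeasure_bind_prob_algebra[OF env_in_prob_algebra two_walks_kernel S])
  also have "\<dots> = (\<integral>\<^sup>+\<omega>. ennreal (measure (quenched_law \<omega> \<Otimes>\<^sub>M quenched_law (env_shift y \<omega>)) S) \<partial>env)"
    using prob_space_quenched_pair[OF valid_env]
    by (intro nn_integral_cong)
      (simp add: finite_measure.emeasure_eq_measure prob_space.finite_measure)
  finally show ?thesis
    using integral_eq_nn_integral[OF two_walks_measurable[OF S]] by (simp add: measure_def[of "two_walks y"])
qed

lemma two_walks_Times:
  assumes "A \<in> sets seq_space" "B \<in> sets seq_space"
  shows "measure (two_walks y) (A \<times> B) =
    (\<integral>\<omega>. measure (quenched_law \<omega>) A * measure (quenched_law (env_shift y \<omega>)) B \<partial>env)"
  unfolding measure_two_walks[OF Times_sets[OF assms]]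
  by (intro Bochner_Integration.integral_cong refl measure_pair_Times)
    (auto simp: valid_env prob_space_quenched assms)

lemma two_walks_fst:
  assumes A: "A \<in> sets seq_space"
  shows "measure (two_walks y) (A \<times> UNIV) = measure law A"
proof -
  have "measure (quenched_law (env_shift y \<omega>)) UNIV = 1" if "\<omega> \<in> space env" for \<omega>
    using prob_space.prob_space[OF prob_space_quenched[OF valid_env_shift[OF valid_env[OF that]]]]
      space_quenched[OF valid_env_shift[OF valid_env[OF that]]] by metis
  then show ?thesis
    by (simp add: two_walks_Times A measure_law cong: Bochner_Integration.integral_cong)
qed

lemma two_walks_snd:
  assumes A: "A \<in> sets seq_space"
  shows "measure (two_walks y) (UNIV \<times> A) = measure law A"
proof -
  have "measure (quenched_law \<omega>) UNIV = 1" if "\<omega> \<in> space env" for \<omega>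
    using prob_space.prob_space[OF prob_space_quenched[OF valid_env[OF that]]]
      space_quenched[OF valid_env[OF that]] by metis
  then show ?thesis
    by (simp add: two_walks_Times A measure_law_shift[OF A, of y] cong: Bochner_Integration.integral_cong)
qed

lemma two_walks_local_Times:
  assumes "A \<in> sets seq_space" "env_local J A" "B \<in> sets seq_space" "env_local K B"
    and "\<And>z. z \<in> K \<Longrightarrow> y + z \<notin> J"
  shows "measure (two_walks y) (A \<times> B) = measure law A * measure law B"
  using assms by (simp add: two_walks_Times quenched_independent)

text \<open>On a pair of cylinders through disjoint sets of sites the quenched probabilities read
  disjoint parts of the environment, so the mean of their product is the product of their means.
  Paths that never meet have only such prefixes.\<close>

lemma two_walks_avoiding:
  assumes S: "S \<in> sets pair_space" and avoid: "S \<inter> meet y = {}"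
  shows "measure (two_walks y) S = measure (law \<Otimes>\<^sub>M law) S"
proof -
  interpret W: prob_space "two_walks y" by (rule prob_space_two_walks)
  interpret I: prob_space "law \<Otimes>\<^sub>M law" by (intro prob_space_pair prob_space_law)
  have sets_I: "sets (law \<Otimes>\<^sub>M law) = sets pair_space" by (intro sets_pair_measure_cong) simp_all
  have zip: "zip_paths y \<in> two_walks y \<rightarrow>\<^sub>M seq_space" "zip_paths y \<in> law \<Otimes>\<^sub>M law \<rightarrow>\<^sub>M seq_space"
    using measurable_zip_paths[of y]
    by (simp_all add: measurable_cong_sets[OF sets_two_walks refl] measurable_cong_sets[OF sets_I refl])
  have space: "space (two_walks y) = UNIV" "space (law \<Otimes>\<^sub>M law) = UNIV"
    using sets_eq_imp_space_eq[OF sets_two_walks[of y]] sets_eq_imp_space_eq[OF sets_I] by simp_all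
  define S' where "S' = unzip_paths y -` S"
  have S': "S' \<in> sets seq_space"
    using measurable_sets[OF measurable_unzip_paths[of y] S] by (simp add: S'_def)
  have vS': "zip_paths y -` S' = S" by (auto simp: S'_def)
  have "emeasure (distr (two_walks y) seq_space (zip_paths y)) S' =
      emeasure (distr (law \<Otimes>\<^sub>M law) seq_space (zip_paths y)) S'"
  proof (rule emeasure_eq_on_related[where R="\<lambda>a b. fst a \<noteq> snd b"])
    show "finite_measure (distr (two_walks y) seq_space (zip_paths y))"
      using W.prob_space_distr[OF zip(1)] by (rule prob_space.finite_measure)
    show "finite_measure (distr (law \<Otimes>\<^sub>M law) seq_space (zip_paths y))"
      using I.prob_space_distr[OF zip(2)] by (rule prob_space.finite_measure)
    show "fst (Z i) \<noteq> snd (Z j)" if "Z \<in> S'" for Z i j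
    proof
      assume "fst (Z i) = snd (Z j)"
      then have "unzip_paths y Z \<in> meet y" by (auto simp: meet_def unzip_paths_def)
      with that avoid show False by (auto simp: S'_def)
    qed
    fix n and z :: "nat \<Rightarrow> (int ^ 'd) \<times> (int ^ 'd)"
    assume R: "\<And>i j. i \<le> n \<Longrightarrow> j \<le> n \<Longrightarrow> fst (z i) \<noteq> snd (z j)"
    define x where "x = (\<lambda>i. fst (z i))"
    define x' where "x' = (\<lambda>i. snd (z i) - y)"
    have v: "zip_paths y -` cyl n z = cyl n x \<times> cyl n x'"
      by (auto simp: zip_paths_def cyl_def x_def x'_def prod_eq_iff algebra_simps)
    have "measure (two_walks y) (cyl n x \<times> cyl n x') = measure law (cyl n x) * measure law (cyl n x')"
      by (rule two_walks_local_Times[OF _ env_local_cyl _ env_local_cyl])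
        (use not_sym[OF R] in \<open>auto simp: x_def x'_def image_iff dest!: less_imp_le\<close>)
    also have "\<dots> = measure (law \<Otimes>\<^sub>M law) (cyl n x \<times> cyl n x')"
      by (rule measure_pair_Times[symmetric]) (auto simp: prob_space_law)
    finally show "emeasure (distr (two_walks y) seq_space (zip_paths y)) (cyl n z) =
        emeasure (distr (law \<Otimes>\<^sub>M law) seq_space (zip_paths y)) (cyl n z)"
      by (simp add: emeasure_distr zip space v W.emeasure_eq_measure I.emeasure_eq_measure)
  qed (auto simp: S')
  then show ?thesis
    by (simp add: emeasure_distr zip space S' vS' W.emeasure_eq_measure I.emeasure_eq_measure)
qed

text \<open>Finite-time approximations of the events read the environment in balls of radius
  \<open>m\<close> and \<open>m'\<close> around 0 and \<open>y\<close>, which are disjoint for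
  \<open>y\<close> far away. Replacing \<open>C\<close> and \<open>C'\<close> by \<open>G\<close>
  and \<open>G'\<close> costs \<open>2 * \<epsilon>\<close> in the joint probability and
  \<open>2 * \<epsilon>\<close> in the product.\<close>

lemma two_walks_asymptotically_independent:
  assumes G: "G \<in> sets seq_space" "G' \<in> sets seq_space" and "\<epsilon> > 0"
  shows "\<exists>N::nat. \<forall>y. real N < norm (real_vec y) \<longrightarrow>
    measure law G * measure law G' - 4 * \<epsilon> \<le> measure (two_walks y) (G \<times> G')"
proof -
  interpret prob_space law by (rule prob_space_law)
  obtain m C where C: "determined m C" "measure law (G - C) < \<epsilon>" "measure law (C - G) < \<epsilon>"
    using determined_approx[OF finite_measure_axioms sets_law G(1) \<open>\<epsilon> > 0\<close>] by blast
  obtain m' C' where C': "determined m' C'" "measure law (G' - C') < \<epsilon>" "measure law (C' - G') < \<epsilon>"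
    using determined_approx[OF finite_measure_axioms sets_law G(2) \<open>\<epsilon> > 0\<close>] by blast
  note [simp] = G determined_sets[OF C(1)] determined_sets[OF C'(1)]
  show ?thesis
  proof (intro exI[of _ "m + m'"] allI impI)
    fix y :: "int ^ 'd" assume y: "real (m + m') < norm (real_vec y)"
    interpret W: prob_space "two_walks y" by (rule prob_space_two_walks)
    have "measure (two_walks y) (C \<times> C') = measure law C * measure law C'"
    proof (rule two_walks_local_Times[OF _ env_local_determined[OF C(1)] _ env_local_determined[OF C'(1)]])
      fix z :: "int ^ 'd" assume "z \<in> {z. norm (real_vec z) \<le> real m'}"
      moreover have "norm (real_vec y) \<le> norm (real_vec (y + z)) + norm (real_vec z)"
        using norm_triangle_ineq4[of "real_vec (y + z)" "real_vec z"] by simp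
      ultimately show "y + z \<notin> {z. norm (real_vec z) \<le> real m}" using y by auto
    qed auto
    moreover have "measure (two_walks y) (C \<times> C') \<le>
        measure (two_walks y) (G \<times> G') + \<epsilon> + \<epsilon>"
    proof -
      have V: "G \<times> G' \<in> W.events" "(C - G) \<times> UNIV \<in> W.events" "UNIV \<times> (C' - G') \<in> W.events"
        by (simp_all add: sets.Diff)
      then have "measure (two_walks y) (C \<times> C') \<le>
          measure (two_walks y) ((G \<times> G' \<union> (C - G) \<times> UNIV) \<union> UNIV \<times> (C' - G'))"
        by (intro W.finite_measure_mono sets.Un) auto
      also have "\<dots> \<le> measure (two_walks y) (G \<times> G' \<union> (C - G) \<times> UNIV) +
          measure (two_walks y) (UNIV \<times> (C' - G'))"
        by (intro measure_Un_le sets.Un V)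
      also have "measure (two_walks y) (G \<times> G' \<union> (C - G) \<times> UNIV) \<le>
          measure (two_walks y) (G \<times> G') + measure (two_walks y) ((C - G) \<times> UNIV)"
        by (intro measure_Un_le V)
      finally show ?thesis
        using C(3) C'(3) two_walks_fst[of "C - G" y] two_walks_snd[of "C' - G'" y]
        by (simp add: sets.Diff)
    qed
    moreover have "measure law G * measure law G' - measure law C * measure law C' \<le> 2 * \<epsilon>"
    proof -
      have close: "measure law H - measure law D \<le> \<epsilon>"
        if "measure law (H - D) < \<epsilon>" "H \<in> sets seq_space" "D \<in> sets seq_space" for H D
      proof -
        have "measure law H \<le> measure law (D \<union> (H - D))"
          using that by (intro finite_measure_mono) auto
        also have "\<dots> \<le> measure law D + measure law (H - D)"
          using that by (intro measure_Un_le) auto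
        finally show ?thesis using that by simp
      qed
      have "measure law G * measure law G' - measure law C * measure law C' =
          measure law G * (measure law G' - measure law C') + measure law C' * (measure law G - measure law C)"
        by (simp add: algebra_simps)
      also have "\<dots> \<le> 1 * \<epsilon> + 1 * \<epsilon>"
      proof (rule add_mono)
        have *: "a * t \<le> 1 * \<epsilon>" if "0 \<le> a" "a \<le> 1" "t \<le> \<epsilon>" for a t
          using mult_left_mono[OF that(3,1)] mult_left_le_one_le[OF less_imp_le[OF \<open>\<epsilon> > 0\<close>] that(1,2)] by simp
        show "measure law G * (measure law G' - measure law C') \<le> 1 * \<epsilon>"
          using close[OF C'(2)] by (intro *) auto
        show "measure law C' * (measure law G - measure law C) \<le> 1 * \<epsilon>"
          using close[OF C(2)] by (intro *) auto
      qed
      finally show ?thesis by simp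
    qed
    ultimately show "measure law G * measure law G' - 4 * \<epsilon> \<le> measure (two_walks y) (G \<times> G')"
      by linarith
  qed
qed

text \<open>If the walks meet at \<open>z\<close>, late for one of them, then the quenched probability from \<open>z\<close> of
  the behaviour of this walk is close to \<open>1\<close>, and it is unlikely that the other walk behaves
  differently after its visit of \<open>z\<close>.\<close>

lemma two_walks_meet:
  assumes A: "A \<in> sets seq_space" "\<And>k X. reroot k X \<in> A \<longleftrightarrow> X \<in> A"
    and B: "B \<in> sets seq_space" "\<And>k X. reroot k X \<in> B \<longleftrightarrow> X \<in> B"
    and AB: "A \<inter> B = {}" and "\<epsilon> > 0"
  shows "\<exists>N::nat. \<forall>y. real N < norm (real_vec y) \<longrightarrow>
    measure (two_walks y) ((A \<inter> nn_paths) \<times> (B \<inter> nn_paths) \<inter> meet y) \<le> \<epsilon>"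
proof -
  interpret prob_space law by (rule prob_space_law)
  \<comment> \<open>There are six errors of size \<delta>: one from each of the two low visits, two
    from each of the means of \<open>bA\<close> and \<open>bB\<close>. The value 1/2 ensures
    \<open>\<delta> < 1\<close>.\<close>
  define \<delta> where "\<delta> = min (1 / 2) (\<epsilon> / 6)"
  have \<delta>: "0 < \<delta>" "\<delta> < 1" "6 * \<delta> \<le> \<epsilon>" using \<open>\<epsilon> > 0\<close> by (auto simp: \<delta>_def)
  have Compl: "- A \<in> sets seq_space" "- B \<in> sets seq_space"
    using sets.compl_sets[OF A(1)] sets.compl_sets[OF B(1)] by (simp_all add: Compl_eq_Diff_UNIV)
  \<comment> \<open>The accuracy is \<open>\<delta>\<^sup>2\<close> because
    \<open>quenched_high_visit\<close> divides by \<delta>.\<close>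
  obtain m C where C: "determined m C" "measure law (- A - C) < \<delta>\<^sup>2" "measure law (C - - A) < \<delta>\<^sup>2"
    using determined_approx[OF finite_measure_axioms sets_law Compl(1), of "\<delta>\<^sup>2"] \<delta>(1) by auto
  obtain m' C' where C': "determined m' C'" "measure law (- B - C') < \<delta>\<^sup>2" "measure law (C' - - B) < \<delta>\<^sup>2"
    using determined_approx[OF finite_measure_axioms sets_law Compl(2), of "\<delta>\<^sup>2"] \<delta>(1) by auto
  have Cs: "C \<in> sets seq_space" "C' \<in> sets seq_space"
    using determined_sets C(1) C'(1) by blast+
  define bA where "bA \<omega> = measure (quenched_law \<omega>) (- A - C) + measure (quenched_law \<omega>) (C - - A) / \<delta>" for \<omega>
  define bB where "bB \<omega> = measure (quenched_law \<omega>) (- B - C') + measure (quenched_law \<omega>) (C' - - B) / \<delta>" for \<omega>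
  show ?thesis
  proof (intro exI[of _ "m + m'"] allI impI)
    fix y :: "int ^ 'd" assume y: "real (m + m') < norm (real_vec y)"
    define S where "S = (A \<inter> nn_paths) \<times> (B \<inter> nn_paths) \<inter> meet y"
    have S: "S \<in> sets pair_space" unfolding S_def by (intro sets.Int Times_sets A B) auto
    have quenched: "measure (quenched_law \<omega> \<Otimes>\<^sub>M quenched_law (env_shift y \<omega>)) S \<le>
        2 * \<delta> + bA (env_shift y \<omega>) + bB \<omega>" if "\<omega> \<in> space env" for \<omega>
    proof -
      have \<omega>: "valid_env \<omega>" "valid_env (env_shift y \<omega>)" using valid_env[OF that] by simp_all
      let ?Q = "quenched_law \<omega>" and ?Q' = "quenched_law (env_shift y \<omega>)"
      interpret QQ: prob_space "?Q \<Otimes>\<^sub>M ?Q'" by (rule prob_space_quenched_pair[OF \<omega>(1)])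
      \<comment> \<open>In \<open>V1\<close> and \<open>V3\<close> a walk visits a site from which
        its own behaviour is unlikely; in \<open>V2\<close> and \<open>V4\<close> it visits, at a
        late time, a site from which the behaviour of the other walk is not unlikely.\<close>
      define V1 where "V1 = A \<inter> {X. \<exists>k. measure (quenched_law (env_shift (X k) \<omega>)) A < \<delta>}"
      define V2 where "V2 = {X. \<exists>k\<ge>m. \<delta> \<le> measure (quenched_law (env_shift (X k) (env_shift y \<omega>))) A} - A"
      define V3 where "V3 = B \<inter> {X. \<exists>k. measure (quenched_law (env_shift (X k) (env_shift y \<omega>))) B < \<delta>}"
      define V4 where "V4 = {X. \<exists>k\<ge>m'. \<delta> \<le> measure (quenched_law (env_shift (X k) \<omega>)) B} - B"
      have Vs: "V1 \<in> sets seq_space" "V2 \<in> sets seq_space" "V3 \<in> sets seq_space" "V4 \<in> sets seq_space"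
        using measurable_site_property[of 0 "\<lambda>z. measure (quenched_law (env_shift z \<omega>)) A < \<delta>"]
          measurable_site_property[of m "\<lambda>z. \<delta> \<le> measure (quenched_law (env_shift z (env_shift y \<omega>))) A"]
          measurable_site_property[of 0 "\<lambda>z. measure (quenched_law (env_shift z (env_shift y \<omega>))) B < \<delta>"]
          measurable_site_property[of m' "\<lambda>z. \<delta> \<le> measure (quenched_law (env_shift z \<omega>)) B"] A B
        by (simp_all add: V1_def V2_def V3_def V4_def)
      have "S \<subseteq> ((V1 \<times> UNIV \<union> UNIV \<times> V2) \<union> UNIV \<times> V3) \<union> V4 \<times> UNIV"
      proof
        fix XY assume XY: "XY \<in> S"
        obtain X Y where [simp]: "XY = (X, Y)" by (cases XY)
        from XY obtain i j where ij: "X i = y + Y j" by (auto simp: S_def meet_def)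
        from XY have X: "X \<in> A" "X \<in> nn_paths" "Y \<in> B" "Y \<in> nn_paths" by (auto simp: S_def)
        then have X': "X \<notin> B" "Y \<notin> A" using AB by auto
        have nX: "norm (real_vec (X i)) \<le> real i" "norm (real_vec (Y j)) \<le> real j"
          using X norm_nn_path[of X i i] norm_nn_path[of Y j j] by (auto simp: nn_paths_def)
        have "norm (real_vec y) \<le> norm (real_vec (X i)) + norm (real_vec (Y j))"
          using norm_triangle_ineq4[of "real_vec (X i)" "real_vec (Y j)"] ij by simp
        \<comment> \<open>Each walk needs as many steps as the distance it covers, so the two times
          of the visit add up to more than \<open>m + m'\<close>.\<close>
        then have "real (m + m') < real i + real j" using y nX by linarith
        then have late: "m' \<le> i \<or> m \<le> j" by linarith
        define h where "h = measure (quenched_law (env_shift (X i) \<omega>))"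
        have h': "measure (quenched_law (env_shift (Y j) (env_shift y \<omega>))) = h"
          by (simp add: env_shift_env_shift h_def ij)
        consider "h A < \<delta>" | "h B < \<delta>" | "\<delta> \<le> h A" "m \<le> j" | "\<delta> \<le> h B" "m' \<le> i"
          using late by linarith
        then show "XY \<in> ((V1 \<times> UNIV \<union> UNIV \<times> V2) \<union> UNIV \<times> V3) \<union> V4 \<times> UNIV"
        proof cases
          case 1
          then have "X \<in> V1" using X by (auto simp: V1_def h_def)
          then show ?thesis by simp
        next
          case 2
          then have "Y \<in> V3" using X by (auto simp: V3_def h' intro!: exI[of _ j])
          then show ?thesis by simp
        next
          case 3
          then have "Y \<in> V2" using X' by (auto simp: V2_def h' intro!: exI[of _ j])
          then show ?thesis by simp
        next
          case 4
          then have "X \<in> V4" using X' by (auto simp: V4_def h_def)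
          then show ?thesis by simp
        qed
      qed
      moreover have V_pair: "V1 \<times> UNIV \<in> QQ.events" "UNIV \<times> V2 \<in> QQ.events"
          "UNIV \<times> V3 \<in> QQ.events" "V4 \<times> UNIV \<in> QQ.events"
        using Vs by (simp_all add: sets_quenched_pair \<omega>)
      ultimately have "measure (?Q \<Otimes>\<^sub>M ?Q') S \<le>
          measure (?Q \<Otimes>\<^sub>M ?Q') (((V1 \<times> UNIV \<union> UNIV \<times> V2) \<union> UNIV \<times> V3) \<union> V4 \<times> UNIV)"
        by (intro QQ.finite_measure_mono) (simp_all add: sets.Un)
      also have "\<dots> \<le> measure (?Q \<Otimes>\<^sub>M ?Q') (V1 \<times> UNIV) + measure (?Q \<Otimes>\<^sub>M ?Q') (UNIV \<times> V2) +
          measure (?Q \<Otimes>\<^sub>M ?Q') (UNIV \<times> V3) + measure (?Q \<Otimes>\<^sub>M ?Q') (V4 \<times> UNIV)"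
        using V_pair measure_Un_le[OF V_pair(1,2)] measure_Un_le[OF sets.Un[OF V_pair(1,2)] V_pair(3)]
          measure_Un_le[OF sets.Un[OF sets.Un[OF V_pair(1,2)] V_pair(3)] V_pair(4)]
        by linarith
      also have "\<dots> = measure ?Q V1 + measure ?Q' V2 + measure ?Q' V3 + measure ?Q V4"
        using prob_space.prob_space[OF prob_space_quenched[OF \<omega>(1)]]
          prob_space.prob_space[OF prob_space_quenched[OF \<omega>(2)]]
        by (simp add: measure_pair_Times prob_space_quenched \<omega> Vs)
      also have "\<dots> \<le> \<delta> + bA (env_shift y \<omega>) + \<delta> + bB \<omega>"
        unfolding V1_def V2_def V3_def V4_def bA_def bB_def using \<delta> \<omega> A B C(1) C'(1)
        by (intro add_mono quenched_low_visit quenched_high_visit) auto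
      finally show ?thesis by simp
    qed
    have bA: "integrable env (\<lambda>\<omega>. bA (env_shift y \<omega>))" "(\<integral>\<omega>. bA (env_shift y \<omega>) \<partial>env) \<le> 2 * \<delta>"
    proof -
      note i = integrable_quenched_shift[where y=y]
      have m: "- A - C \<in> sets seq_space" "C - - A \<in> sets seq_space" using Cs Compl A by auto
      show "integrable env (\<lambda>\<omega>. bA (env_shift y \<omega>))"
        unfolding bA_def using i[OF m(1)] i[OF m(2)] by simp
      have "(\<integral>\<omega>. bA (env_shift y \<omega>) \<partial>env) = measure law (- A - C) + measure law (C - - A) / \<delta>"
        unfolding bA_def measure_law_shift[OF m(1), of y] measure_law_shift[OF m(2), of y]
        using i[OF m(1)] i[OF m(2)] by simp
      also have "\<dots> \<le> \<delta>\<^sup>2 + \<delta>\<^sup>2 / \<delta>"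
        using C(2,3) \<delta>(1) by (intro add_mono divide_right_mono) auto
      also have "\<dots> \<le> 2 * \<delta>" using \<delta> by (simp add: power2_eq_square)
      finally show "(\<integral>\<omega>. bA (env_shift y \<omega>) \<partial>env) \<le> 2 * \<delta>" .
    qed
    have bB: "integrable env bB" "(\<integral>\<omega>. bB \<omega> \<partial>env) \<le> 2 * \<delta>"
    proof -
      note i = integrable_quenched
      have m: "- B - C' \<in> sets seq_space" "C' - - B \<in> sets seq_space" using Cs Compl B by auto
      show "integrable env bB"
        unfolding bB_def using i[OF m(1)] i[OF m(2)] by simp
      have "(\<integral>\<omega>. bB \<omega> \<partial>env) = measure law (- B - C') + measure law (C' - - B) / \<delta>"
        unfolding bB_def measure_law[OF m(1)] measure_law[OF m(2)]
        using i[OF m(1)] i[OF m(2)] by simp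
      also have "\<dots> \<le> \<delta>\<^sup>2 + \<delta>\<^sup>2 / \<delta>"
        using C'(2,3) \<delta>(1) by (intro add_mono divide_right_mono) auto
      also have "\<dots> \<le> 2 * \<delta>" using \<delta> by (simp add: power2_eq_square)
      finally show "(\<integral>\<omega>. bB \<omega> \<partial>env) \<le> 2 * \<delta>" .
    qed
    interpret env: prob_space env by (rule prob_space_env)
    have "measure (two_walks y) S \<le> (\<integral>\<omega>. 2 * \<delta> + bA (env_shift y \<omega>) + bB \<omega> \<partial>env)"
      unfolding measure_two_walks[OF S]
    proof (rule integral_mono)
      show "integrable env (\<lambda>\<omega>. measure (quenched_law \<omega> \<Otimes>\<^sub>M quenched_law (env_shift y \<omega>)) S)"
        using prob_space.prob_le_1[OF prob_space_quenched_pair[OF valid_env]]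
        by (intro integrable_bounded two_walks_measurable S) auto
    qed (use bA(1) bB(1) quenched in auto)
    also have "\<dots> = 2 * \<delta> + (\<integral>\<omega>. bA (env_shift y \<omega>) \<partial>env) + (\<integral>\<omega>. bB \<omega> \<partial>env)"
      using bA(1) bB(1) by (simp add: env.prob_space)
    also have "\<dots> \<le> \<epsilon>" using bA(2) bB(2) \<delta>(3) by linarith
    finally show "measure (two_walks y) ((A \<inter> nn_paths) \<times> (B \<inter> nn_paths) \<inter> meet y) \<le> \<epsilon>"
      by (simp add: S_def)
  qed
qed

end

subsection \<open>The planar zero-one law\<close>

text \<open>\<beta> is the coordinate in which \<open>l\<close> has its larger component, with the
  sign that makes the coefficient positive, and \<alpha> is the other one. This gives
  \<open>\<bar>A\<bar> \<le> B\<close> for \<open>strip_crossing\<close>.\<close>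

lemma planar_coordinates:
  fixes l :: "real ^ 2"
  assumes "l \<noteq> 0"
  obtains B A :: real and \<alpha> \<beta> :: "int ^ 2 \<Rightarrow> int" where
    "B > 0" "\<bar>A\<bar> \<le> B" "\<And>x. elevation l x = A * of_int (\<alpha> x) + B * of_int (\<beta> x)"
    "\<alpha> 0 = 0" "\<beta> 0 = 0" "\<And>s t. \<exists>x. \<alpha> x = s \<and> \<beta> x = t"
    "\<And>x y. \<alpha> x = \<alpha> y \<Longrightarrow> \<beta> x = \<beta> y \<Longrightarrow> x = y"
    "\<And>x y. y - x \<in> unit_vectors \<Longrightarrow> adjacent (\<alpha> x, \<beta> x) (\<alpha> y, \<beta> y)"
proof -
  obtain i j :: 2 where ij: "i \<noteq> j" "UNIV = {i, j}" "\<bar>l $ j\<bar> \<le> \<bar>l $ i\<bar>"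
  proof (cases "\<bar>l $ 1\<bar> \<le> \<bar>l $ 2\<bar>")
    case True
    show thesis by (rule that[of 2 1]) (use True in \<open>simp_all add: UNIV_2 insert_commute\<close>)
  next
    case False
    show thesis by (rule that[of 1 2]) (use False in \<open>simp_all add: UNIV_2\<close>)
  qed
  have ij_cases: "k = i \<or> k = j" for k using UNIV_I[of k] unfolding ij(2) by simp
  have vec_eq: "x = y \<longleftrightarrow> x $ i = y $ i \<and> x $ j = y $ j" for x y :: "'c ^ 2"
  proof
    assume eq: "x $ i = y $ i \<and> x $ j = y $ j"
    have "x $ k = y $ k" for k using ij_cases[of k] eq by (elim disjE) simp_all
    then show "x = y" by (simp add: vec_eq_iff)
  qed simp
  have "l $ i \<noteq> 0"
  proof
    assume "l $ i = 0"
    with ij(3) have "l $ j = 0" by simp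
    with \<open>l $ i = 0\<close> have "l = 0" by (subst vec_eq) simp
    with assms show False by simp
  qed
  define \<sigma> :: int where "\<sigma> = (if l $ i > 0 then 1 else -1)"
  define \<alpha> :: "int ^ 2 \<Rightarrow> int" where "\<alpha> x = x $ j" for x
  define \<beta> :: "int ^ 2 \<Rightarrow> int" where "\<beta> x = \<sigma> * x $ i" for x
  show thesis
  proof (rule that[of "\<bar>l $ i\<bar>" "l $ j" \<alpha> \<beta>])
    show "\<bar>l $ i\<bar> > 0" using \<open>l $ i \<noteq> 0\<close> by simp
    show "\<bar>l $ j\<bar> \<le> \<bar>l $ i\<bar>" by (rule ij(3))
    show "elevation l x = l $ j * of_int (\<alpha> x) + \<bar>l $ i\<bar> * of_int (\<beta> x)" for x
      using ij(1) by (simp add: elevation_def inner_vec_def ij(2) real_vec_def \<alpha>_def \<beta>_def \<sigma>_def)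
    show "\<exists>x. \<alpha> x = s \<and> \<beta> x = t" for s t
      using ij(1) by (intro exI[of _ "\<chi> k. if k = i then \<sigma> * t else s"]) (simp add: \<alpha>_def \<beta>_def \<sigma>_def)
    show "\<alpha> x = \<alpha> y \<Longrightarrow> \<beta> x = \<beta> y \<Longrightarrow> x = y" for x y
      by (subst vec_eq) (auto simp: \<alpha>_def \<beta>_def \<sigma>_def split: if_splits)
    show "adjacent (\<alpha> x, \<beta> x) (\<alpha> y, \<beta> y)" if "y - x \<in> unit_vectors" for x y
    proof -
      from that obtain k where "y - x = axis k 1 \<or> y - x = - axis k 1" by (auto simp: unit_vectors_def)
      then have d: "\<bar>y $ m - x $ m\<bar> = (if m = k then 1 else 0)" for m
        by (auto simp: axis_def vec_eq_iff split: if_splits)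
      have "\<bar>\<sigma> * x $ i - \<sigma> * y $ i\<bar> = \<bar>y $ i - x $ i\<bar>" by (simp add: \<sigma>_def abs_minus_commute)
      then show ?thesis
        using d[of i] d[of j] ij(1) ij_cases[of k]
        by (auto simp: adjacent_def \<alpha>_def \<beta>_def abs_minus_commute split: if_splits)
    qed
  qed (simp_all add: \<alpha>_def \<beta>_def)
qed

text \<open>A property of the site of first passage, as an event. It fails on paths that never reach
  the level, whatever \<open>P\<close> is; on transient paths it respects negation.\<close>

definition first_hit :: "real ^ 'd \<Rightarrow> real \<Rightarrow> (int ^ 'd \<Rightarrow> bool) \<Rightarrow> (nat \<Rightarrow> int ^ 'd) set" where
  "first_hit l L P = {X. \<exists>n. L \<le> elevation l (X n) \<and> (\<forall>m<n. elevation l (X m) < L) \<and> P (X n)}"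

lemma first_hit_sets [simp]: "first_hit l L P \<in> sets (seq_space :: (nat \<Rightarrow> int ^ 'd) measure)"
proof -
  have "{X. L \<le> elevation l (X n) \<and> (\<forall>m<n. elevation l (X m) < L) \<and> P (X n)} \<in>
      sets (seq_space :: (nat \<Rightarrow> int ^ 'd) measure)" for n
    by (rule determined_sets[of n]) (simp add: determined_def)
  then have "(\<Union>n. {X. L \<le> elevation l (X n) \<and> (\<forall>m<n. elevation l (X m) < L) \<and> P (X n)}) \<in>
      sets (seq_space :: (nat \<Rightarrow> int ^ 'd) measure)"
    by (intro sets.countable_UN image_subsetI)
  moreover have "first_hit l L P =
      (\<Union>n. {X. L \<le> elevation l (X n) \<and> (\<forall>m<n. elevation l (X m) < L) \<and> P (X n)})"
    by (auto simp: first_hit_def)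
  ultimately show ?thesis by simp
qed

lemma first_hit_Compl: "X \<in> directional_transience l \<Longrightarrow>
  X \<in> first_hit l L (\<lambda>z. \<not> P z) \<longleftrightarrow> X \<notin> first_hit l L P"
proof
  assume "X \<in> first_hit l L (\<lambda>z. \<not> P z)"
  then obtain n where n: "L \<le> elevation l (X n)" "\<forall>m<n. elevation l (X m) < L" "\<not> P (X n)"
    unfolding first_hit_def by blast
  show "X \<notin> first_hit l L P"
  proof
    assume "X \<in> first_hit l L P"
    then obtain k where k: "L \<le> elevation l (X k)" "\<forall>m<k. elevation l (X m) < L" "P (X k)"
      unfolding first_hit_def by blast
    then have "k = n" using n by (meson linorder_neqE_nat not_le)
    with n k show False by simp
  qed
next
  assume "X \<in> directional_transience l" "X \<notin> first_hit l L P"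
  then obtain N where "\<forall>n\<ge>N. L \<le> elevation l (X n)" unfolding mem_transience by blast
  then have ex: "L \<le> elevation l (X N)" by simp
  define n where "n = (LEAST n. L \<le> elevation l (X n))"
  have n: "L \<le> elevation l (X n)" unfolding n_def using ex by (rule LeastI)
  have "elevation l (X m) < L" if "m < n" for m
    using not_less_Least[OF that[unfolded n_def]] by simp
  then show "X \<in> first_hit l L (\<lambda>z. \<not> P z)"
    using n \<open>X \<notin> first_hit l L P\<close> unfolding first_hit_def by blast
qed

section \<open>Two planar walks that avoid each other\<close>

context
  fixes l :: "real ^ 2" and \<alpha> \<beta> :: "int ^ 2 \<Rightarrow> int" and A B :: real
  assumes B: "B > 0" "\<bar>A\<bar> \<le> B"
    and elev: "\<And>x. elevation l x = A * of_int (\<alpha> x) + B * of_int (\<beta> x)"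
    and origin: "\<alpha> 0 = 0" "\<beta> 0 = 0"
    and inj: "\<And>x y. \<alpha> x = \<alpha> y \<Longrightarrow> \<beta> x = \<beta> y \<Longrightarrow> x = y"
    and adj: "\<And>x y. y - x \<in> unit_vectors \<Longrightarrow> adjacent (\<alpha> x, \<beta> x) (\<alpha> y, \<beta> y)"
begin

text \<open>Stop \<open>X\<close> at its first passage to level \<open>L\<close>, and
  \<open>y + Y\<close> at its first passage to level 0 or below, which for \<open>Y\<close> is a
  descent by \<open>elevation l y\<close>. By \<open>strip_crossing\<close>, \<open>X\<close>
  arrives to the left of \<open>y\<close> exactly if the other walk arrives in column 0 or to the
  right of it.\<close>

lemma crossing_paths_meet:
  assumes L: "L > 0" and y: "L \<le> elevation l y" "elevation l y < L + B"
    and X: "X \<in> nn_paths" "X \<in> above l" "X \<in> first_hit l L P"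
    and Y: "Y \<in> nn_paths" "Y \<in> above (- l)" "Y \<in> first_hit (- l) (elevation l y) Q"
    and disj: "(X, Y) \<notin> meet y"
  shows "\<exists>a b. P a \<and> Q b \<and> \<alpha> y \<noteq> \<alpha> a \<and> (\<alpha> a < \<alpha> y \<longleftrightarrow> 0 \<le> \<alpha> (y + b))"
proof -
  obtain T where T: "L \<le> elevation l (X T)" "\<And>m. m < T \<Longrightarrow> elevation l (X m) < L" "P (X T)"
    using X(3) unfolding first_hit_def by blast
  obtain T' where T': "elevation l y \<le> elevation (- l) (Y T')"
      "\<And>m. m < T' \<Longrightarrow> elevation (- l) (Y m) < elevation l y" "Q (Y T')"
    using Y(3) unfolding first_hit_def by blast
  define p where "p i = (\<alpha> (X i), \<beta> (X i))" for i
  define q where "q j = (\<alpha> (y + Y j), \<beta> (y + Y j))" for j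
  have p: "A * of_int (fst (p i)) + B * of_int (snd (p i)) = elevation l (X i)" for i
    by (simp add: p_def elev)
  have q: "A * of_int (fst (q j)) + B * of_int (snd (q j)) = elevation l y + elevation l (Y j)" for j
    unfolding q_def fst_conv snd_conv elev[symmetric] by simp
  have Y0: "Y 0 = 0" "elevation l (Y j) \<le> 0" for j
    using Y(1,2) by (auto simp: nn_paths_def above_def)
  have pq: "p i \<noteq> q j" for i j
    using disj inj[of "X i" "y + Y j"] by (auto simp: p_def q_def meet_def)
  have p_adj: "adjacent (p i) (p (Suc i))" for i
    using X(1) unfolding p_def by (intro adj) (simp add: nn_paths_def)
  have q_adj: "adjacent (q j) (q (Suc j))" for j
    using Y(1) unfolding q_def by (intro adj) (simp add: nn_paths_def)
  have "p 0 = (0, 0)" "0 \<le> elevation l (X i)" for i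
    using X(1,2) by (simp_all add: p_def nn_paths_def origin above_def)
  moreover have "0 < elevation l y + elevation l (Y j)" if "j < T'" for j
    using T'(2)[OF that] by simp
  moreover have "elevation l y + elevation l (Y T') \<le> 0" using T'(1) by simp
  ultimately have "fst (q 0) \<noteq> fst (p T)" "fst (p T) < fst (q 0) \<longleftrightarrow> 0 \<le> fst (q T')"
    by - (rule strip_crossing[of B A L p T T' q],
      (simp_all only: p q Y0 elevation_simps add_0_right B L p_adj q_adj pq T y not_False_eq_True
        simp_thms add_le_same_cancel1))+
  then show ?thesis
    using T(3) T'(3) Y0(1) by (auto simp: p_def q_def)
qed

end

lemma ex_median:
  fixes F :: "int \<Rightarrow> real"
  assumes "\<exists>n. c \<le> F n" "\<exists>n. F n < c" "\<And>m n. m \<le> n \<Longrightarrow> F n \<le> F m"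
  shows "\<exists>s. c \<le> F s \<and> F (s + 1) < c"
proof -
  obtain a b where ab: "c \<le> F a" "F b < c" using assms(1,2) by blast
  define S where "S = {a..b} \<inter> {s. c \<le> F s}"
  have "a \<le> b" using ab assms(3)[of b a] by (cases "a \<le> b") auto
  then have S: "finite S" "a \<in> S" using ab by (auto simp: S_def)
  then have M: "Max S \<in> S" using Max_in by blast
  have "F (Max S + 1) < c"
  proof (rule ccontr)
    assume "\<not> ?thesis"
    moreover from this have "Max S + 1 \<le> b"
      using ab(2) assms(3)[of b "Max S + 1"] by (cases "Max S + 1 \<le> b") auto
    ultimately have "Max S + 1 \<in> S" using M by (auto simp: S_def)
    then show False using Max_ge[OF S(1), of "Max S + 1"] by simp
  qed
  then show ?thesis using M by (auto simp: S_def)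
qed

section \<open>The median site and the final contradiction\<close>

locale planar_iid_env = iid_env \<mu> for \<mu> :: "(int ^ 2) measure measure"
begin

lemma crossing_probability:
  fixes l :: "real ^ 2"
  defines "G \<equiv> \<lambda>l. above l \<inter> directional_transience l \<inter> nn_paths"
  assumes "l \<noteq> 0"
  shows "\<exists>y. real N < norm (real_vec y) \<and>
    measure law (G l) * measure law (G (- l)) / 4 \<le> measure (law \<Otimes>\<^sub>M law) (G l \<times> G (- l) \<inter> meet y)"
proof -
  interpret prob_space law by (rule prob_space_law)
  interpret I: prob_space "law \<Otimes>\<^sub>M law" by (intro prob_space_pair prob_space_law)
  have sets_I: "I.events = sets pair_space" by (intro sets_pair_measure_cong) simp_all
  obtain B A :: real and \<alpha> \<beta> :: "int ^ 2 \<Rightarrow> int" where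
    B: "B > 0" "\<bar>A\<bar> \<le> B" and elev: "\<And>x. elevation l x = A * of_int (\<alpha> x) + B * of_int (\<beta> x)"
    and origin: "\<alpha> 0 = 0" "\<beta> 0 = 0" and surj: "\<And>s t. \<exists>x. \<alpha> x = s \<and> \<beta> x = t"
    and inj: "\<And>x y. \<alpha> x = \<alpha> y \<Longrightarrow> \<beta> x = \<beta> y \<Longrightarrow> x = y"
    and adj: "\<And>x y. y - x \<in> unit_vectors \<Longrightarrow> adjacent (\<alpha> x, \<beta> x) (\<alpha> y, \<beta> y)"
    by (rule planar_coordinates[OF \<open>l \<noteq> 0\<close>]) (rule that, assumption+)
  define p where "p = measure law (G l)"
  define q where "q = measure law (G (- l))"
  have G: "G k \<in> sets seq_space" for k :: "real ^ 2" by (simp add: G_def sets.Int)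
  \<comment> \<open>By the Cauchy-Schwarz inequality a site at level \<open>L\<close> or higher has
    norm at least \<open>N + 1\<close>.\<close>
  define L where "L = (real N + 1) * norm l"
  have L: "L > 0" using \<open>l \<noteq> 0\<close> by (simp add: L_def)
  \<comment> \<open>The sites of a column have spacing \<open>B\<close> in height, so every column
    meets the band; hence the column of \<open>y\<close> can be prescribed.\<close>
  have site: "\<exists>y. \<alpha> y = s \<and> L \<le> elevation l y \<and> elevation l y < L + B" for s
  proof -
    define t where "t = \<lceil>(L - A * of_int s) / B\<rceil>"
    obtain y where y: "\<alpha> y = s" "\<beta> y = t" using surj by blast
    have "(L - A * of_int s) / B \<le> of_int t" "of_int t < (L - A * of_int s) / B + 1"
      by (simp_all add: t_def) linarith
    then have "L - A * of_int s \<le> of_int t * B" "of_int t * B < L - A * of_int s + B"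
      using B(1) by (simp_all add: field_simps)
    then show ?thesis using y by (intro exI[of _ y]) (simp add: elev mult.commute)
  qed
  have meeting: "\<exists>a b. P a \<and> Q b \<and> \<alpha> y \<noteq> \<alpha> a \<and> (\<alpha> a < \<alpha> y \<longleftrightarrow> 0 \<le> \<alpha> (y + b))"
    if "L \<le> elevation l y" "elevation l y < L + B" "X \<in> G l" "X \<in> first_hit l L P"
      "Y \<in> G (- l)" "Y \<in> first_hit (- l) (elevation l y) Q" "(X, Y) \<notin> meet y" for X Y P Q y
  proof (rule crossing_paths_meet[where X=X and Y=Y and A=A and B=B and L=L and \<beta>=\<beta>])
    show "X \<in> nn_paths" "X \<in> above l" "Y \<in> nn_paths" "Y \<in> above (- l)"
      using that by (simp_all add: G_def)
  qed (fact that B elev origin inj adj L)+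
  have far: "real N < norm (real_vec y)" if "L \<le> elevation l y" for y
  proof -
    have "(real N + 1) * norm l \<le> norm (real_vec y) * norm l"
      using that norm_cauchy_schwarz[of "real_vec y" l] by (simp add: L_def elevation_def)
    then show ?thesis using \<open>l \<noteq> 0\<close> by simp
  qed
  show ?thesis
  proof (cases "p = 0")
    case True
    obtain y where "L \<le> elevation l y" using site by blast
    then show ?thesis using far True by (auto simp: p_def)
  next
    case False
    then have "p > 0" by (simp add: p_def zero_less_measure_iff)
    \<comment> \<open>The tail function of the column of first passage. It decreases from
      \<open>p\<close> at minus infinity to 0 at plus infinity, because every path in
      \<open>G l\<close> has a first passage.\<close>
    define F where "F s = measure law (G l \<inter> first_hit l L (\<lambda>z. s \<le> \<alpha> z))" for s
    have meas: "G l \<inter> first_hit l L P \<in> sets law" for P using G by (simp add: sets.Int)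
    have hit: "\<exists>z. X \<in> first_hit l L (\<lambda>w. w = z)" if "X \<in> G l" for X
    proof -
      have "X \<in> first_hit l L (\<lambda>_. True)"
        using first_hit_Compl[of X l L "\<lambda>_. False"] that by (auto simp: G_def first_hit_def)
      then show ?thesis by (auto simp: first_hit_def)
    qed
    have hit_mono: "first_hit l L P \<subseteq> first_hit l L Q" if "\<And>z. P z \<Longrightarrow> Q z" for P Q
      using that unfolding first_hit_def by blast
    have F_mono: "F n \<le> F m" if "m \<le> n" for m n
      unfolding F_def by (intro finite_measure_mono meas Int_mono order_refl hit_mono) (use that in simp)
    have "(\<lambda>n. F (- int n)) \<longlonglongrightarrow> measure law (\<Union>n. G l \<inter> first_hit l L (\<lambda>z. - int n \<le> \<alpha> z))"
      unfolding F_def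
    proof (rule finite_Lim_measure_incseq)
      show "range (\<lambda>n. G l \<inter> first_hit l L (\<lambda>z. - int n \<le> \<alpha> z)) \<subseteq> sets law" using meas by blast
      show "incseq (\<lambda>n. G l \<inter> first_hit l L (\<lambda>z. - int n \<le> \<alpha> z))"
        unfolding incseq_def by (intro allI impI Int_mono order_refl hit_mono) auto
    qed
    moreover have "(\<Union>n. G l \<inter> first_hit l L (\<lambda>z. - int n \<le> \<alpha> z)) = G l"
    proof -
      have "\<exists>n. X \<in> first_hit l L (\<lambda>z. - int n \<le> \<alpha> z)" if X: "X \<in> G l" for X
      proof -
        obtain z where "X \<in> first_hit l L (\<lambda>w. w = z)" using hit[OF X] by blast
        then have "X \<in> first_hit l L (\<lambda>w. - int (nat (- \<alpha> z)) \<le> \<alpha> w)"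
          by (rule subsetD[OF hit_mono, rotated]) auto
        then show ?thesis by blast
      qed
      then show ?thesis by auto
    qed
    ultimately have "(\<lambda>n. F (- int n)) \<longlonglongrightarrow> p" by (simp add: p_def)
    then have "\<forall>\<^sub>F n in sequentially. p / 2 < F (- int n)"
      by (rule order_tendstoD) (use \<open>p > 0\<close> in auto)
    then have F1: "\<exists>n. p / 2 \<le> F n" by (auto simp: eventually_sequentially intro: less_imp_le)
    have "(\<lambda>n. F (int n)) \<longlonglongrightarrow> measure law (\<Inter>n. G l \<inter> first_hit l L (\<lambda>z. int n \<le> \<alpha> z))"
      unfolding F_def
    proof (rule finite_Lim_measure_decseq)
      show "range (\<lambda>n. G l \<inter> first_hit l L (\<lambda>z. int n \<le> \<alpha> z)) \<subseteq> sets law" using meas by blast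
      show "decseq (\<lambda>n. G l \<inter> first_hit l L (\<lambda>z. int n \<le> \<alpha> z))"
        unfolding decseq_def by (intro allI impI Int_mono order_refl hit_mono) auto
    qed
    moreover have "(\<Inter>n. G l \<inter> first_hit l L (\<lambda>z. int n \<le> \<alpha> z)) = {}"
    proof -
      have "\<exists>n. X \<notin> first_hit l L (\<lambda>z. int n \<le> \<alpha> z)" if X: "X \<in> G l" for X
      proof -
        obtain z where "X \<in> first_hit l L (\<lambda>w. w = z)" using hit[OF X] by blast
        then have "X \<in> first_hit l L (\<lambda>w. \<not> int (nat (\<alpha> z + 1)) \<le> \<alpha> w)"
          by (rule subsetD[OF hit_mono, rotated]) auto
        then show ?thesis using first_hit_Compl[of X l L "\<lambda>w. int (nat (\<alpha> z + 1)) \<le> \<alpha> w"] X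
          unfolding G_def by blast
      qed
      then show ?thesis by auto
    qed
    ultimately have "(\<lambda>n. F (int n)) \<longlonglongrightarrow> 0" by simp
    then have "\<forall>\<^sub>F n in sequentially. F (int n) < p / 2"
      by (rule order_tendstoD) (use \<open>p > 0\<close> in auto)
    then have F2: "\<exists>n. F n < p / 2" by (auto simp: eventually_sequentially)
    obtain s where s: "p / 2 \<le> F s" "F (s + 1) < p / 2"
      using ex_median[OF F1 F2 F_mono] by blast
    \<comment> \<open>Arrivals in column \<open>s\<close> count for both halves. This is harmless:
      by \<open>meeting\<close>, paths that avoid each other do not arrive in the column of
      \<open>y\<close>.\<close>
    have s': "p / 2 \<le> measure law (G l \<inter> first_hit l L (\<lambda>z. \<alpha> z \<le> s))"
    proof -
      have "G l \<inter> first_hit l L (\<lambda>z. \<alpha> z \<le> s) = G l - (G l \<inter> first_hit l L (\<lambda>z. s + 1 \<le> \<alpha> z))"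
        using first_hit_Compl[of _ l L "\<lambda>z. s + 1 \<le> \<alpha> z"] by (auto simp: G_def not_le)
      then have "measure law (G l \<inter> first_hit l L (\<lambda>z. \<alpha> z \<le> s)) = p - F (s + 1)"
        using meas G by (simp add: finite_measure_Diff F_def p_def)
      then show ?thesis using s(2) by simp
    qed
    obtain y where y: "\<alpha> y = s" "L \<le> elevation l y" "elevation l y < L + B" using site by blast
    \<comment> \<open>For the second walk no median is chosen, as \<open>y\<close> is already fixed.
      One of \<open>H\<close> and \<open>H'\<close> carries at least \<open>q / 2\<close>, and the
      half of the first walk is chosen to contradict it.\<close>
    define H where "H = first_hit (- l) (elevation l y) (\<lambda>z. 0 \<le> \<alpha> (y + z))"
    define H' where "H' = first_hit (- l) (elevation l y) (\<lambda>z. \<not> 0 \<le> \<alpha> (y + z))"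
    have H: "G (- l) \<inter> H \<in> sets seq_space" "G (- l) \<inter> H' \<in> sets seq_space"
      using G by (simp_all add: H_def H'_def sets.Int)
    have "q \<le> measure law (G (- l) \<inter> H) + measure law (G (- l) \<inter> H')"
    proof -
      have "G (- l) = (G (- l) \<inter> H) \<union> (G (- l) \<inter> H')"
        using first_hit_Compl[of _ "- l"] by (auto simp: G_def H_def H'_def)
      then show ?thesis
        using measure_Un_le[of "G (- l) \<inter> H" law "G (- l) \<inter> H'"] H by (simp add: q_def)
    qed
    then consider "q / 2 \<le> measure law (G (- l) \<inter> H)" | "q / 2 \<le> measure law (G (- l) \<inter> H')"
      by linarith
    then obtain V W where V: "V \<in> sets seq_space" "p / 2 \<le> measure law V"
      and W: "W \<in> sets seq_space" "q / 2 \<le> measure law W"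
      and VW: "V \<times> W \<subseteq> G l \<times> G (- l) \<inter> meet y"
    proof cases
      case 1
      have "(X, Y) \<in> meet y" if "X \<in> G l \<inter> first_hit l L (\<lambda>z. s \<le> \<alpha> z)" "Y \<in> G (- l) \<inter> H" for X Y
      proof (rule ccontr)
        assume "(X, Y) \<notin> meet y"
        then show False
          using meeting[OF y(2,3), of X "\<lambda>z. s \<le> \<alpha> z" Y "\<lambda>z. 0 \<le> \<alpha> (y + z)"] that y(1)
          by (auto simp: H_def)
      qed
      then show ?thesis
        using 1 s(1) H(1) meas by (intro that[of "G l \<inter> first_hit l L (\<lambda>z. s \<le> \<alpha> z)" "G (- l) \<inter> H"]) (auto simp: F_def)
    next
      case 2
      have "(X, Y) \<in> meet y" if "X \<in> G l \<inter> first_hit l L (\<lambda>z. \<alpha> z \<le> s)" "Y \<in> G (- l) \<inter> H'" for X Y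
      proof (rule ccontr)
        assume "(X, Y) \<notin> meet y"
        then show False
          using meeting[OF y(2,3), of X "\<lambda>z. \<alpha> z \<le> s" Y "\<lambda>z. \<not> 0 \<le> \<alpha> (y + z)"] that y(1)
          by (auto simp: H'_def)
      qed
      then show ?thesis
        using 2 s' H(2) meas by (intro that[of "G l \<inter> first_hit l L (\<lambda>z. \<alpha> z \<le> s)" "G (- l) \<inter> H'"]) auto
    qed
    have "(p / 2) * (q / 2) \<le> measure law V * measure law W"
      using V W \<open>p > 0\<close> by (intro mult_mono) (auto simp: q_def)
    also have "\<dots> = measure (law \<Otimes>\<^sub>M law) (V \<times> W)"
      by (rule measure_pair_Times[symmetric]) (simp_all add: V W prob_space_law)
    also have "\<dots> \<le> measure (law \<Otimes>\<^sub>M law) (G l \<times> G (- l) \<inter> meet y)"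
      by (rule I.finite_measure_mono[OF VW]) (auto simp: sets_I intro!: sets.Int Times_sets G)
    finally show ?thesis using far[OF y(2)] by (auto simp: p_def q_def)
  qed
qed

text \<open>For \<open>y\<close> far away the walks both succeed with probability at least
  \<open>p * q - 4 * \<epsilon>\<close>. Of this, meetings account for at most \<epsilon>; the rest
  is the same as for independent walks, at most \<open>3 / 4 * p * q\<close> for the
  \<open>y\<close> of \<open>crossing_probability\<close>.\<close>

lemma opposite_transience_null:
  fixes l :: "real ^ 2"
  assumes "l \<noteq> 0" and pos: "measure law (directional_transience l) > 0"
  shows "measure law (directional_transience (- l)) = 0"
proof (rule ccontr)
  interpret prob_space law by (rule prob_space_law)
  interpret I: prob_space "law \<Otimes>\<^sub>M law" by (intro prob_space_pair prob_space_law)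
  have sets_I: "I.events = sets pair_space" by (intro sets_pair_measure_cong) simp_all
  assume "measure law (directional_transience (- l)) \<noteq> 0"
  then have pos': "measure law (directional_transience (- l)) > 0" by (simp add: zero_less_measure_iff)
  define G where "G = (\<lambda>l :: real ^ 2. above l \<inter> directional_transience l \<inter> nn_paths)"
  have G: "G k \<in> sets seq_space" for k by (simp add: G_def sets.Int)
  have G_pos: "measure law (G k) > 0" if "measure law (directional_transience k) > 0" for k
  proof -
    have "measure law (G k) = measure law (above k \<inter> directional_transience k)"
      using law_nn_paths by (intro finite_measure_eq_AE) (auto simp: G_def sets.Int)
    then show ?thesis using law_above_transience_pos[OF that] by simp
  qed
  define p where "p = measure law (G l)"
  define q where "q = measure law (G (- l))"
  have pq: "p * q > 0" using G_pos[OF pos] G_pos[OF pos'] by (simp add: p_def q_def)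
  \<comment> \<open>The contradiction requires \<open>5 * \<epsilon> < p * q / 4\<close>; here
    \<open>5 * \<epsilon> = p * q / 8\<close>.\<close>
  define \<epsilon> where "\<epsilon> = p * q / 40"
  have \<epsilon>: "\<epsilon> > 0" using pq by (simp add: \<epsilon>_def)
  obtain N where N: "\<And>y. real N < norm (real_vec y) \<Longrightarrow> p * q - 4 * \<epsilon> \<le> measure (two_walks y) (G l \<times> G (- l))"
    using two_walks_asymptotically_independent[OF G[of l] G[of "- l"] \<epsilon>] unfolding p_def q_def by blast
  have disj: "directional_transience l \<inter> directional_transience (- l) = {}"
    using transience_disjoint by blast
  obtain N' where N': "\<And>y. real N' < norm (real_vec y) \<Longrightarrow> measure (two_walks y)
      ((directional_transience l \<inter> nn_paths) \<times> (directional_transience (- l) \<inter> nn_paths) \<inter> meet y) \<le> \<epsilon>"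
    using two_walks_meet[OF transience_sets transience_reroot transience_sets transience_reroot disj \<epsilon>] by blast
  obtain y where y: "real (N + N') < norm (real_vec y)"
      "p * q / 4 \<le> measure (law \<Otimes>\<^sub>M law) (G l \<times> G (- l) \<inter> meet y)"
    using crossing_probability[OF \<open>l \<noteq> 0\<close>, of "N + N'"] unfolding p_def q_def G_def by blast
  interpret W: prob_space "two_walks y" by (rule prob_space_two_walks)
  define S where "S = G l \<times> G (- l)"
  have S: "S \<in> sets pair_space" by (simp add: S_def G)
  have "measure (two_walks y) S = measure (two_walks y) (S \<inter> meet y) + measure (two_walks y) (S - meet y)"
    using S W.finite_measure_Union[of "S \<inter> meet y" "S - meet y"] by (auto simp: Int_Diff_Un sets.Int sets.Diff)
  also have "measure (two_walks y) (S \<inter> meet y) \<le> \<epsilon>"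
  proof -
    have "measure (two_walks y) (S \<inter> meet y) \<le> measure (two_walks y)
      ((directional_transience l \<inter> nn_paths) \<times> (directional_transience (- l) \<inter> nn_paths) \<inter> meet y)"
      by (intro W.finite_measure_mono) (auto simp: S_def G_def intro!: sets.Int Times_sets)
    also have "\<dots> \<le> \<epsilon>" using y(1) by (intro N') simp
    finally show ?thesis .
  qed
  also have "measure (two_walks y) (S - meet y) = measure (law \<Otimes>\<^sub>M law) (S - meet y)"
    using S by (intro two_walks_avoiding) auto
  also have "\<dots> = measure (law \<Otimes>\<^sub>M law) S - measure (law \<Otimes>\<^sub>M law) (S \<inter> meet y)"
    using S by (intro I.finite_measure_Diff') (auto simp: sets_I)
  also have "measure (law \<Otimes>\<^sub>M law) S = p * q"
    unfolding S_def p_def q_def by (rule measure_pair_Times) (simp_all add: G prob_space_law)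
  finally have "measure (two_walks y) S \<le> \<epsilon> + (p * q - p * q / 4)"
    using y(2) by (simp add: S_def)
  moreover have "p * q - 4 * \<epsilon> \<le> measure (two_walks y) S"
    unfolding S_def using y(1) by (intro N) simp
  ultimately show False using pq by (simp add: \<epsilon>_def)
qed

end

theorem theorem1p5:
  fixes \<mu> :: "(int ^ 2) measure measure" and l :: "real ^ 2"
  assumes "prob_space \<mu>" and "sets \<mu> = sets step_laws"
    and "l \<noteq> 0"
  shows "measure (annealed_law \<mu>) (directional_transience l) \<in> {0, 1}"
proof (cases "measure (annealed_law \<mu>) (directional_transience l) = 0")
  case False
  interpret planar_iid_env \<mu>
    by (intro planar_iid_env.intro iid_env.intro assms)
  interpret prob_space "annealed_law \<mu>" by (rule prob_space_law)
  from False have pos: "measure (annealed_law \<mu>) (directional_transience l) > 0"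
    by (simp add: zero_less_measure_iff)
  have "AE X in annealed_law \<mu>. X \<notin> directional_transience (- l)"
    using opposite_transience_null[OF assms(3) pos] by (subst (asm) prob_eq_0) simp_all
  with kalikow_zero_one[OF pos] have "AE X in annealed_law \<mu>. X \<in> directional_transience l"
    by eventually_elim blast
  then show ?thesis by (simp add: prob_eq_1)
qed simp

end
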